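(* Let $(N,\Pi)$ be a generalized number system with $N(x)\ll x$. Suppose there are $a>0$ and $K\in L^1(\mathbb{R})$ with $\hat K(0)\neq0$ such that $E*K\in L^1(\mathbb{R})$, where $E$ is defined by $N(x)=ax+xE(\log x)$ for $x\ge1$, $E(y)=0$ for $y<0$. Then $M(x)=o(x)$ as $x\to\infty$ implies $m(x)=o(1)$ as $x\to\infty$.
   Context: A generalized number system is a pair of non-decreasing right-continuous functions $N,\Pi$, both supported in $[1,\infty)$, with $N(1)=1$, $\Pi(1)=0$, linked by $\zeta(s)=\int_{1^-}^\infty x^{-s}\mathrm{d}N(x)=\exp\left(\int_1^\infty x^{-s}\mathrm{d}\Pi(x)\right)$ with both integrals convergent on some half-plane. The measure $\mathrm{d}M$ is the inverse of $\mathrm{d}N$ with respect to multiplicative convolution of measures on $[1,\infty)$, i.e. $\mathrm{d}M=\exp^{*_M}(-\mathrm{d}\Pi)$, so that $\int_{1^-}^\infty x^{-s}\mathrm{d}M(x)=1/\zeta(s)$; $M(x)=\int_{1^-}^x\mathrm{d}M(u)$ and $m(x)=\int_{1^-}^x u^{-1}\mathrm{d}M(u)$. $(E*K)(y)=\int E(y-u)K(u)\,\mathrm{d}u$; $\hat K(t)=\int e^{-ity}K(y)\,\mathrm{d}y$. *)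

theory Defs
  imports "HOL-Probability.Probability" "HOL-Library.Landau_Symbols"
begin

text \<open>\<open>interval_measure F\<close> is the Stieltjes measure \<open>dF\<close>; \<open>P\<close> stands for \<open>\<Pi>\<close>. Since \<open>N\<close> vanishes on \<open>{..<1}\<close> and
  \<open>N 1 = 1\<close>, the measure \<open>dN\<close> has a unit atom at \<open>1\<close>, which the integral over \<open>{1..}\<close> (from \<open>1-\<close>) includes.
  For these positive measures, convergence on a half-plane is the same as absolute convergence,
  that is, integrability.\<close>

definition gen_number_system :: "(real \<Rightarrow> real) \<Rightarrow> (real \<Rightarrow> real) \<Rightarrow> bool" where
  "gen_number_system N P \<longleftrightarrow>
     mono N \<and> (\<forall>x. continuous (at_right x) N) \<and> (\<forall>x<1. N x = 0) \<and> N 1 = 1 \<and>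
     mono P \<and> (\<forall>x. continuous (at_right x) P) \<and> (\<forall>x<1. P x = 0) \<and> P 1 = 0 \<and>
     (\<exists>\<sigma>. \<forall>s::complex. Re s > \<sigma> \<longrightarrow>
        set_integrable (interval_measure N) {1..} (\<lambda>x. complex_of_real x powr (- s)) \<and>
        set_integrable (interval_measure P) {1..} (\<lambda>x. complex_of_real x powr (- s)) \<and>
        (LINT x:{1..}|interval_measure N. complex_of_real x powr (- s)) =
          exp (LINT x:{1..}|interval_measure P. complex_of_real x powr (- s)))"

definition mult_conv :: "real measure \<Rightarrow> real measure \<Rightarrow> real measure" where
  "mult_conv A B = distr (A \<Otimes>\<^sub>M B) borel (\<lambda>(x, y). x * y)"

primrec mult_conv_power :: "real measure \<Rightarrow> nat \<Rightarrow> real measure" where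
  "mult_conv_power A 0 = return borel 1"
| "mult_conv_power A (Suc n) = mult_conv A (mult_conv_power A n)"

definition mult_conv_series :: "(nat \<Rightarrow> real) \<Rightarrow> real measure \<Rightarrow> real measure" where
  "mult_conv_series c A =
     measure_of UNIV (sets borel) (\<lambda>X. \<Sum>n. ennreal (c n) * emeasure (mult_conv_power A n) X)"

lemma sets_mult_conv_power [simp]: "sets (mult_conv_power A n) = sets borel"
  by (cases n) (simp_all add: mult_conv_def)

lemma space_mult_conv_power [simp]: "space (mult_conv_power A n) = UNIV"
  using sets_eq_imp_space_eq[OF sets_mult_conv_power, of A n] by simp

lemma sets_mult_conv_series [simp]: "sets (mult_conv_series c A) = sets borel"
  unfolding mult_conv_series_def
  by (metis sets.sets_measure_of_eq space_borel)

lemma emeasure_mult_conv_series: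
  assumes "X \<in> sets borel"
  shows "emeasure (mult_conv_series c A) X =
    (\<Sum>n. ennreal (c n) * emeasure (mult_conv_power A n) X)"
proof (rule emeasure_measure_of[OF mult_conv_series_def[of c A]])
  show "sets borel \<subseteq> Pow (UNIV :: real set)" by simp
  show "X \<in> sets (mult_conv_series c A)" using assms by simp
  show "positive (sets (mult_conv_series c A))
      (\<lambda>X. \<Sum>n. ennreal (c n) * emeasure (mult_conv_power A n) X)"
    by (simp add: positive_def)
  show "countably_additive (sets (mult_conv_series c A))
      (\<lambda>X. \<Sum>n. ennreal (c n) * emeasure (mult_conv_power A n) X)"
  proof (rule countably_additiveI)
    fix F :: "nat \<Rightarrow> real set"
    assume F: "range F \<subseteq> sets (mult_conv_series c A)" "disjoint_family F"
    have "(\<Sum>i. \<Sum>n. ennreal (c n) * emeasure (mult_conv_power A n) (F i)) =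
        (\<Sum>n. \<Sum>i. ennreal (c n) * emeasure (mult_conv_power A n) (F i))"
      using nn_integral_fst_count_space
        [of "\<lambda>(i, n). ennreal (c n) * emeasure (mult_conv_power A n) (F i)"]
        nn_integral_snd_count_space
        [of "\<lambda>(i, n). ennreal (c n) * emeasure (mult_conv_power A n) (F i)"]
      by (simp add: nn_integral_count_space_nat del: ennreal_suminf_cmult)
    also have "\<dots> = (\<Sum>n. ennreal (c n) * emeasure (mult_conv_power A n) (\<Union>i. F i))"
      using F by (simp add: suminf_emeasure)
    finally show "(\<Sum>i. \<Sum>n. ennreal (c n) * emeasure (mult_conv_power A n) (F i)) =
        (\<Sum>n. ennreal (c n) * emeasure (mult_conv_power A n) (\<Union> (range F)))" .
  qed
qed

text \<open>The signed measure \<open>dM = exp(- dP) = \<Sum>n. (-1)^n / n! dP^n\<close> (multiplicative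
  convolution powers), the convolution inverse of \<open>dN\<close>, is represented as the difference of the
  two positive measures formed by the even and by the odd terms of the exponential series. Both are
  bounded by \<open>exp(dP) = dN\<close>, so they are finite on bounded sets, though their difference is in
  general not a globally defined signed measure.\<close>

definition dM_even :: "(real \<Rightarrow> real) \<Rightarrow> real measure" where
  "dM_even P = mult_conv_series (\<lambda>n. if even n then 1 / fact n else 0) (interval_measure P)"

definition dM_odd :: "(real \<Rightarrow> real) \<Rightarrow> real measure" where
  "dM_odd P = mult_conv_series (\<lambda>n. if odd n then 1 / fact n else 0) (interval_measure P)"

definition M_fun :: "(real \<Rightarrow> real) \<Rightarrow> real \<Rightarrow> real" where
  "M_fun P x = measure (dM_even P) {1..x} - measure (dM_odd P) {1..x}"

definition m_fun :: "(real \<Rightarrow> real) \<Rightarrow> real \<Rightarrow> real" where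
  "m_fun P x = (LINT u:{1..x}|dM_even P. 1 / u) - (LINT u:{1..x}|dM_odd P. 1 / u)"

definition line_conv :: "(real \<Rightarrow> real) \<Rightarrow> (real \<Rightarrow> complex) \<Rightarrow> real \<Rightarrow> complex" where
  "line_conv E K y = (LINT u|lebesgue. complex_of_real (E (y - u)) * K u)"

definition fourier :: "(real \<Rightarrow> complex) \<Rightarrow> real \<Rightarrow> complex" where
  "fourier K t = (LINT y|lebesgue. exp (- (\<i> * complex_of_real t * complex_of_real y)) * K y)"

end

theory Submission
  imports Defs
begin

text \<open>Put \<open>\<mu>(y) = m(e\<^sup>y)\<close>. The relation \<open>dN * dM = \<delta>\<^sub>1\<close> becomes \<open>a \<mu> + E * d\<mu> = e\<^sup>-\<^sup>y\<close> on
  \<open>y \<ge> 0\<close>. Averaging over unit intervals replaces \<open>d\<mu>\<close> by \<open>d(y) = \<mu>(y) - \<mu>(y - 1)\<close>, which is bounded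
  because \<open>|dM| \<le> dN\<close> and \<open>N(x) = O(x)\<close>, and tends to \<open>0\<close> because \<open>M(x) = o(x)\<close>. If \<open>\<phi>\<close> is a kernel with
  \<open>E * \<phi>\<close> integrable, convolving with \<open>\<phi>\<close> shows that the averages of \<open>\<mu> * \<phi>\<close> tend to \<open>0\<close>, and the slow
  variation of \<open>\<mu>\<close> gives \<open>\<mu> \<rightarrow> 0\<close>, provided \<open>\<phi>\<close> has non-zero integral and a finite first moment: \<open>\<mu>\<close> is
  not known to be bounded at this stage, only that \<open>\<mu>(y) - \<mu>(y - v)\<close> grows at most linearly in \<open>v\<close>.

  Such a \<open>\<phi>\<close> is obtained from \<open>K\<close>, normalised to be real of integral \<open>1\<close>, by local Wiener inversion.
  Let \<open>V\<close> be a de la Vallee Poussin kernel and \<open>\<phi>\<close> a squared Fejer kernel with \<open>V * \<phi> = \<phi>\<close>, dilated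
  so that \<open>h = K * V - V\<close> has \<open>L\<^sup>1\<close> norm less than \<open>1\<close>. Then \<open>X = E * \<phi>\<close> satisfies
  \<open>X = (E * K) * \<phi> - h * X\<close>, a contraction whose inhomogeneous term is integrable.\<close>

section \<open>Fejer and de la Vallee Poussin kernels\<close>

text \<open>Two obstacles shape the development. First, a number system is defined through integral
  transforms only, and dM is in general no signed measure on the whole half-line. The convolution
  identities for dM are therefore stated between positive measures and obtained by comparing
  transforms on one vertical line: weighting by x^(-\<sigma>) and passing to log x gives finite
  measures, whose characteristic functions are these transforms and determine them. Second, a single
  kernel K with E * K integrable is given, and it may lack a first moment. It can be replaced
  because its normalised Fourier transform is 1 at frequency 0, hence close to 1 nearby: on a small
  interval around 0 it can be inverted, so any good kernel with spectrum in that interval inherits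
  the integrability. The squared Fejer kernel, suitably dilated, has such a spectrum and decays like
  x^(-4), which secures the moment. The contraction needs X to be bounded beforehand; this follows
  from N(x) = O(x), which makes E bounded.\<close>

lemma integrable_inv_1_plus_sq: "integrable lborel (\<lambda>x::real. 1 / (1 + x\<^sup>2))"
  using integrable_inverse_1_plus_square by (simp add: set_integrable_def einterval_def inverse_eq_divide)

text \<open>Half the Fourier transform of the triangle max 0 (1 - |t|). The integral form exhibits a
  superposition of cosines with frequencies in [0, 1], as the reproducing identity requires, and is
  regular at 0, where the closed form divides by zero.\<close>

definition fejer :: "real \<Rightarrow> real" where
  "fejer x = (LINT t:{0..1}|lborel. (1 - t) * cos (t * x))"

lemma fejer_measurable [measurable]: "fejer \<in> borel_measurable borel"
  unfolding fejer_def set_lebesgue_integral_def by measurable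

lemma fejer_eq: assumes "x \<noteq> 0" shows "fejer x = (1 - cos x) / x\<^sup>2"
proof -
  have "(LBINT t. (1 - t) * cos (t * x) * indicator {0..1} t) =
     ((1-1) * sin (1*x) / x - cos (1*x) / x\<^sup>2) - ((1-0) * sin (0*x) / x - cos (0*x) / x\<^sup>2)"
  proof (rule integral_FTC_Icc_real)
    fix t :: real
    show "((\<lambda>t. (1-t) * sin (t*x) / x - cos (t*x) / x\<^sup>2) has_field_derivative (1 - t) * cos (t * x)) (at t)"
      using assms by (auto intro!: derivative_eq_intros simp: field_simps power2_eq_square)
    show "isCont (\<lambda>t. (1 - t) * cos (t * x)) t" by (intro continuous_intros)
  qed auto
  then show ?thesis by (simp add: fejer_def set_lebesgue_integral_def mult.commute diff_divide_distrib)
qed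

lemma fejer_even [simp]: "fejer (- x) = fejer x" by (simp add: fejer_def)

lemma fejer_nonneg: "x \<noteq> 0 \<Longrightarrow> 0 \<le> fejer x" by (simp add: fejer_eq)

lemma fejer_abs_le_1: "\<bar>fejer x\<bar> \<le> 1"
proof -
  have "continuous_on {0..1} (\<lambda>t. (1 - t) * cos (t * x))" by (intro continuous_intros)
  from borel_integrable_atLeastAtMost'[OF this]
  have "integrable lborel (\<lambda>t. indicator {0..1} t *\<^sub>R ((1 - t) * cos (t * x)))" by (simp add: set_integrable_def)
  moreover have "integrable lborel (indicator {0..1::real} :: real \<Rightarrow> real)" by simp
  moreover have "norm (indicator {0..1} t *\<^sub>R ((1 - t) * cos (t * x))) \<le> indicator {0..1} t" for t
    by (cases "t \<in> {0..1}") (auto simp: abs_mult intro!: mult_le_one)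
  ultimately have "norm (LINT t|lborel. indicator {0..1} t *\<^sub>R ((1 - t) * cos (t * x)))
      \<le> (LINT t|lborel. indicator {0..1::real} t)"
    by (rule Bochner_Integration.integral_norm_bound_integral)
  then show ?thesis by (simp add: fejer_def set_lebesgue_integral_def)
qed

lemma fejer_bound: "\<bar>fejer x\<bar> \<le> 3 / (1 + x\<^sup>2)"
proof -
  have "\<bar>x\<^sup>2 * fejer x\<bar> \<le> 2"
  proof (cases "x = 0")
    case False
    then have "x\<^sup>2 * fejer x = 1 - cos x" by (simp add: fejer_eq)
    then show ?thesis using cos_ge_minus_one[of x] cos_le_one[of x] by linarith
  qed auto
  then have "x\<^sup>2 * \<bar>fejer x\<bar> \<le> 2" by (simp add: abs_mult)
  then have "\<bar>fejer x\<bar> * (1 + x\<^sup>2) \<le> 3" using fejer_abs_le_1[of x] by (simp add: algebra_simps)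
  then show ?thesis by (simp add: pos_le_divide_eq add_pos_nonneg)
qed

lemma isCont_fejer: "x \<noteq> 0 \<Longrightarrow> isCont fejer x"
proof -
  assume "x \<noteq> 0"
  then have "\<forall>\<^sub>F y in nhds x. fejer y = (1 - cos y) / y\<^sup>2"
    using fejer_eq by (auto simp: eventually_nhds intro!: exI[of _ "-{0}"])
  then have "isCont fejer x = isCont (\<lambda>y. (1 - cos y) / y\<^sup>2) x" by (rule isCont_cong)
  then show ?thesis using \<open>x \<noteq> 0\<close> by (auto intro!: continuous_intros)
qed

lemma fejer_integrable: "integrable lborel fejer"
  by (rule Bochner_Integration.integrable_bound[OF integrable_mult_right[OF integrable_inv_1_plus_sq, of 3]])
    (use fejer_bound in \<open>auto simp: abs_div\<close>)

text \<open>On [1, 2], a part of [0, pi], 1 - cos x is at least 1 - cos 1 and x^2 is at most 4. This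
  minorant makes the integrals of \<open>fejer\<close> and of its square positive without evaluating
  them.\<close>

lemma fejer_lower: "(1 - cos 1) / 4 * indicator {1..2} x \<le> fejer x" if "x \<noteq> 0"
proof (cases "x \<in> {1..2}")
  case True
  have "cos x \<le> cos 1" using True pi_gt3 by (intro cos_monotone_0_pi_le) auto
  moreover have "x\<^sup>2 \<le> 2\<^sup>2" using True by (intro power_mono) auto
  ultimately have "(1 - cos 1) / 4 \<le> (1 - cos x) / x\<^sup>2"
    using True by (intro frac_le) auto
  then show ?thesis using True by (simp add: fejer_eq)
qed (use that in \<open>simp add: fejer_nonneg\<close>)

lemma one_minus_cos_1_pos: "0 < 1 - cos (1::real)"
  using cos_monotone_0_pi[of 0 1] pi_gt3 by simp

definition fejer_mass :: real where "fejer_mass = integral\<^sup>L lborel fejer"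

lemma fejer_mass_pos: "0 < fejer_mass"
proof -
  have "(LINT x|lborel. (1 - cos 1) / 4 * indicator {1..2::real} x) \<le> fejer_mass" unfolding fejer_mass_def
  proof (intro integral_mono_AE fejer_integrable)
    show "AE x in lborel. (1 - cos 1) / 4 * indicator {1..2} x \<le> fejer x"
      using AE_lborel_singleton[of 0] by eventually_elim (rule fejer_lower)
  qed auto
  then show ?thesis using one_minus_cos_1_pos by simp
qed

text \<open>\<open>fejer\<close> decays only like x^(-2), so its first moment diverges; squaring
  gives decay x^(-4) at the price of doubling the spectrum to [-2, 2].\<close>

lemma fejer_sq_integrals: 
  shows "integrable lborel (\<lambda>x. (fejer x)\<^sup>2)" "integrable lborel (\<lambda>x. \<bar>x\<bar> * (fejer x)\<^sup>2)" "0 < (LINT x|lborel. (fejer x)\<^sup>2)"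
proof -
  have b: "(fejer x)\<^sup>2 \<le> 9 / (1+x\<^sup>2)^2" for x
    using power_mono[OF fejer_bound[of x] abs_ge_zero, of 2] by (simp add: power_divide)
  have b1: "\<bar>x\<bar> / (1+x\<^sup>2) \<le> 1" for x :: real
  proof -
    have "\<bar>x\<bar> \<le> 1 + \<bar>x\<bar>\<^sup>2" using zero_le_power2[of "\<bar>x\<bar> - 1"] by (simp add: power2_diff)
    then show ?thesis by (simp add: divide_le_eq add_pos_nonneg)
  qed
  have b2: "1 / (1+x\<^sup>2) \<le> 1" for x :: real by (simp add: divide_le_eq add_pos_nonneg)
  show i: "integrable lborel (\<lambda>x. (fejer x)\<^sup>2)"
  proof (rule Bochner_Integration.integrable_bound[OF integrable_mult_right[OF integrable_inv_1_plus_sq, of 9]])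
    have "(fejer x)\<^sup>2 \<le> 9 * (1/(1+x\<^sup>2))" for x
      using b[of x] mult_left_mono[OF b2[of x], of "9 * (1/(1+x\<^sup>2))"] by (simp add: power2_eq_square)
    then show "AE x in lborel. norm ((fejer x)\<^sup>2) \<le> norm (9 * (1/(1+x\<^sup>2)))" by (auto simp: abs_div)
  qed auto
  show "integrable lborel (\<lambda>x. \<bar>x\<bar> * (fejer x)\<^sup>2)"
  proof (rule Bochner_Integration.integrable_bound[OF integrable_mult_right[OF integrable_inv_1_plus_sq, of 9]])
    have "\<bar>x\<bar> * (fejer x)\<^sup>2 \<le> 9 * (1/(1+x\<^sup>2))" for x
      using mult_left_mono[OF b[of x], of "\<bar>x\<bar>"] mult_left_mono[OF b1[of x], of "9 * (1/(1+x\<^sup>2))"]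
      by (simp add: power2_eq_square ac_simps)
    then show "AE x in lborel. norm (\<bar>x\<bar> * (fejer x)\<^sup>2) \<le> norm (9 * (1/(1+x\<^sup>2)))" by (auto simp: abs_div abs_mult)
  qed auto
  have "(LINT x|lborel. ((1 - cos 1) / 4)\<^sup>2 * indicator {1..2::real} x) \<le> (LINT x|lborel. (fejer x)\<^sup>2)"
  proof (intro integral_mono_AE i)
    have "((1 - cos 1) / 4)\<^sup>2 * indicator {1..2} x \<le> (fejer x)\<^sup>2" if "x \<noteq> 0" for x
      using fejer_lower[OF that] one_minus_cos_1_pos power_mono[of "(1 - cos 1) / 4" "fejer x" 2] by (cases "x \<in> {1..2}") auto
    then show "AE x in lborel. ((1 - cos 1) / 4)\<^sup>2 * indicator {1..2} x \<le> (fejer x)\<^sup>2"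
      using AE_lborel_singleton[of 0] by auto
  qed auto
  then have "((1 - cos 1) / 4)\<^sup>2 \<le> (LINT x|lborel. (fejer x)\<^sup>2)" by simp
  moreover have "0 < ((1 - cos (1::real)) / 4)\<^sup>2" using one_minus_cos_1_pos by (intro zero_less_power) simp
  ultimately show "0 < (LINT x|lborel. (fejer x)\<^sup>2)" by linarith
qed

text \<open>With the factor b^2 the integrand is (1 - cos (b x)) / x^2 away from 0, for every real
  b. Zero and negative b are included because \<open>vp_cos\<close> shifts frequencies to r - 4, r -
  2 and r + 2.\<close>

lemma integral_fejer_scaled:
  "integrable lborel (\<lambda>x. b\<^sup>2 * fejer (b * x))" "(LINT x|lborel. b\<^sup>2 * fejer (b * x)) = \<bar>b\<bar> * fejer_mass"
proof -
  show "integrable lborel (\<lambda>x. b\<^sup>2 * fejer (b * x))"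
    using lborel_integrable_real_affine[OF fejer_integrable, of b 0] by (cases "b = 0") auto
  show "(LINT x|lborel. b\<^sup>2 * fejer (b * x)) = \<bar>b\<bar> * fejer_mass"
  proof (cases "b = 0")
    case False
    have "fejer_mass = \<bar>b\<bar> * (LINT x|lborel. fejer (b * x))"
      using lborel_integral_real_affine[OF False, of fejer 0] by (simp add: fejer_mass_def)
    then have "\<bar>b\<bar> * fejer_mass = (\<bar>b\<bar> * \<bar>b\<bar>) * (LINT x|lborel. fejer (b * x))" by (simp only: mult.assoc)
    also have "\<bar>b\<bar> * \<bar>b\<bar> = b\<^sup>2" by (simp add: power2_eq_square)
    finally show ?thesis by simp
  qed simp
qed

text \<open>The Fourier transform of this combination is a trapezoid, equal to 1 on [-2, 2] and to 0
  outside [-4, 4]. The plateau is the spectrum of the squared Fejer kernel.\<close>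

definition vallee_poussin :: "real \<Rightarrow> real" where
  "vallee_poussin x = (4\<^sup>2 * fejer (4 * x) - 2\<^sup>2 * fejer (2 * x)) / (2 * fejer_mass)"

lemma vp_measurable [measurable]: "vallee_poussin \<in> borel_measurable borel"
  unfolding vallee_poussin_def by measurable

lemma vp_integrable: "integrable lborel vallee_poussin"
  unfolding vallee_poussin_def
  by (intro integrable_divide Bochner_Integration.integrable_diff integral_fejer_scaled)

lemma vp_even [simp]: "vallee_poussin (- x) = vallee_poussin x"
  by (simp add: vallee_poussin_def)

text \<open>Multiplying (cos (2 x) - cos (4 x)) / x^2 by 2 cos (r x) produces Fejer kernels at the
  shifted frequencies r + 4, r - 4, r + 2, r - 2, with masses proportional to their absolute values.
  For |r| <= 2 these combine to 8 - 4 = 4, independently of r.\<close>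

lemma vp_cos:
  assumes "\<bar>r\<bar> \<le> 2" shows "(LINT x|lborel. vallee_poussin x * cos (r * x)) = 1"
proof -
  let ?g = "\<lambda>b x. b\<^sup>2 * fejer (b * x)"
  have g: "?g b x * x\<^sup>2 = 1 - cos (b * x)" if "x \<noteq> 0" for b x
    using that by (cases "b = 0") (auto simp: fejer_eq power_mult_distrib)
  let ?h = "\<lambda>x. (?g (r+4) x + ?g (r-4) x - ?g (r+2) x - ?g (r-2) x) / (4 * fejer_mass)"
  have eq: "vallee_poussin x * cos (r * x) = ?h x" if "x \<noteq> 0" for x
  proof -
    have "2 * (?g 4 x - ?g 2 x) * cos (r * x) * x\<^sup>2 = (?g (r+4) x + ?g (r-4) x - ?g (r+2) x - ?g (r-2) x) * x\<^sup>2"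
    proof -
      have "2 * (?g 4 x - ?g 2 x) * cos (r * x) * x\<^sup>2 = 2 * cos (r*x) * (?g 4 x * x\<^sup>2 - ?g 2 x * x\<^sup>2)"
        by (simp add: algebra_simps)
      also have "\<dots> = 2 * cos (r*x) * (cos (2*x) - cos (4*x))"
        unfolding g[OF that] by simp
      also have "\<dots> = ((1 - cos ((r+4)*x)) + (1 - cos ((r-4)*x)) - (1 - cos ((r+2)*x)) - (1 - cos ((r-2)*x)))"
        by (simp add: cos_add cos_diff algebra_simps)
      also have "\<dots> = (?g (r+4) x + ?g (r-4) x - ?g (r+2) x - ?g (r-2) x) * x\<^sup>2"
        unfolding g[OF that, symmetric] by (simp add: algebra_simps)
      finally show ?thesis .
    qed
    then have "2 * (?g 4 x - ?g 2 x) * cos (r * x) = ?g (r+4) x + ?g (r-4) x - ?g (r+2) x - ?g (r-2) x"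
      using that by (metis mult_right_cancel zero_eq_power2)
    then have "?h x = 2 * (?g 4 x - ?g 2 x) * cos (r * x) / (4 * fejer_mass)" by simp
    also have "\<dots> = vallee_poussin x * cos (r * x)"
      unfolding vallee_poussin_def by (simp add: divide_simps)
    finally show ?thesis ..
  qed
  have "(LINT x|lborel. vallee_poussin x * cos (r * x)) = (LINT x|lborel. ?h x)"
    by (rule integral_cong_AE) (use AE_lborel_singleton[of 0] eq in auto)
  also have "\<dots> = (\<bar>r+4\<bar> + \<bar>r-4\<bar> - \<bar>r+2\<bar> - \<bar>r-2\<bar>) * fejer_mass / (4 * fejer_mass)"
    by (simp only: integral_divide_zero Bochner_Integration.integral_diff Bochner_Integration.integral_add
        Bochner_Integration.integrable_diff Bochner_Integration.integrable_add integral_fejer_scaled)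
      (simp only: left_diff_distrib distrib_right)
  also have "\<bar>r+4\<bar> + \<bar>r-4\<bar> - \<bar>r+2\<bar> - \<bar>r-2\<bar> = 4" using assms unfolding abs_le_iff by linarith
  also have "4 * fejer_mass / (4 * fejer_mass) = 1" using fejer_mass_pos by simp
  finally show ?thesis .
qed

lemma vp_sin: "(LINT x|lborel. vallee_poussin x * sin (r * x)) = 0"
  using lborel_integral_real_affine[of "-1" "\<lambda>x. vallee_poussin x * sin (r * x)" 0] by simp

lemma vp_integrable_mult:
  assumes [measurable]: "g \<in> borel_measurable borel" and "\<And>x. \<bar>g x\<bar> \<le> B"
  shows "integrable lborel (\<lambda>x. vallee_poussin x * g x)"
proof (rule Bochner_Integration.integrable_bound[OF integrable_mult_left[OF vp_integrable, of B]])
  have "\<bar>g x\<bar> \<le> \<bar>B\<bar>" for x using assms(2)[of x] by linarith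
  then show "AE x in lborel. norm (vallee_poussin x * g x) \<le> norm (vallee_poussin x * B)"
    by (auto simp: abs_mult intro!: mult_left_mono)
qed measurable

text \<open>Frequencies on the plateau pass through the kernel unchanged; in the addition formula
  the sine term vanishes by evenness.\<close>

lemma vp_conv_cos:
  assumes "\<bar>r\<bar> \<le> 2" shows "(LINT u|lborel. vallee_poussin u * cos (r * (x - u))) = cos (r * x)"
proof -
  have i: "integrable lborel (\<lambda>u. vallee_poussin u * cos (r * u))" "integrable lborel (\<lambda>u. vallee_poussin u * sin (r * u))"
    by (rule vp_integrable_mult[where B=1]; simp)+
  have "(LINT u|lborel. vallee_poussin u * cos (r * (x - u))) =
     (LINT u|lborel. cos (r * x) * (vallee_poussin u * cos (r * u)) + sin (r * x) * (vallee_poussin u * sin (r * u)))"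
    by (intro Bochner_Integration.integral_cong) (auto simp: cos_diff algebra_simps)
  then show ?thesis using i by (simp add: vp_cos[OF assms] vp_sin)
qed

text \<open>As \<open>fejer\<close> superposes cosines, Fubini carries the reproducing property from
  cosines to \<open>fejer\<close>. The spare factor \<open>g\<close> permits two applications: first
  with \<open>g\<close> a cosine, then with \<open>g = fejer\<close>.\<close>

lemma vp_conv_fejer_mult:
  assumes [measurable]: "g \<in> borel_measurable borel" and B: "\<And>x. \<bar>g x\<bar> \<le> B"
    and rep: "\<And>t x. t \<in> {0..1} \<Longrightarrow> (LINT u|lborel. vallee_poussin u * (cos (t * (x - u)) * g (x - u))) = cos (t * x) * g x"
  shows "(LINT u|lborel. vallee_poussin u * (fejer (x - u) * g (x - u))) = fejer x * g x"
proof -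
  let ?f = "\<lambda>u t. vallee_poussin u * g (x - u) * (indicator {0..1} t * ((1 - t) * cos (t * (x - u))))"
  have B0: "0 \<le> B" using B[of 0] by linarith
  have int: "integrable (lborel \<Otimes>\<^sub>M lborel) (\<lambda>(u, t). ?f u t)"
  proof (rule lborel_pair.Fubini_integrable)
    have ii: "integrable lborel (\<lambda>t. indicator {0..1} t * ((1 - t) * cos (t * y)))" for y :: real
    proof -
      have "continuous_on {0..1} (\<lambda>t. (1 - t) * cos (t * y))" by (intro continuous_intros)
      from borel_integrable_atLeastAtMost'[OF this] show ?thesis by (simp add: set_integrable_def)
    qed
    show "AE u in lborel. integrable lborel (\<lambda>t. case (u, t) of (u, t) \<Rightarrow> ?f u t)"
      using ii by auto
    have le: "(LINT t|lborel. norm (?f u t)) \<le> \<bar>vallee_poussin u\<bar> * B" for u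
    proof -
      have "(LINT t|lborel. norm (?f u t)) \<le> (LINT t|lborel. \<bar>vallee_poussin u\<bar> * B * indicator {0..1::real} t)"
      proof (intro integral_mono)
        show "integrable lborel (\<lambda>t. norm (?f u t))" using ii by (intro integrable_norm integrable_mult_right) 
        fix t :: real
        have "\<bar>1 - t\<bar> * \<bar>cos (t * (x - u))\<bar> \<le> 1" if "t \<in> {0..1}" using that by (intro mult_le_one) auto
        then show "norm (?f u t) \<le> \<bar>vallee_poussin u\<bar> * B * indicator {0..1} t"
          using mult_mono[OF mult_left_mono[OF B[of "x-u"] abs_ge_zero[of "vallee_poussin u"]], of "\<bar>1 - t\<bar> * \<bar>cos (t * (x - u))\<bar>" 1] B0
          by (cases "t \<in> {0..1}") (auto simp: abs_mult simp del: abs_mult_self_eq)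
      qed auto
      then show ?thesis by simp
    qed
    have "integrable lborel (\<lambda>u. LINT t|lborel. norm (?f u t))"
      by (rule Bochner_Integration.integrable_bound[OF integrable_mult_left[OF integrable_abs[OF vp_integrable], of B]])
        (use le B0 in \<open>auto simp: abs_mult\<close>)
    then show "integrable lborel (\<lambda>u. LINT t|lborel. norm (case (u, t) of (u, t) \<Rightarrow> ?f u t))" by simp
  qed measurable
  have "(LINT u|lborel. vallee_poussin u * (fejer (x - u) * g (x - u))) = (LINT u|lborel. LINT t|lborel. ?f u t)"
  proof (intro Bochner_Integration.integral_cong refl)
    fix u
    have "vallee_poussin u * (fejer (x - u) * g (x - u)) = (vallee_poussin u * g (x - u)) * fejer (x - u)" by simp
    also have "\<dots> = (LINT t|lborel. ?f u t)"
      unfolding fejer_def set_lebesgue_integral_def by (simp only: real_scaleR_def integral_mult_right_zero)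
    finally show "vallee_poussin u * (fejer (x - u) * g (x - u)) = (LINT t|lborel. ?f u t)" .
  qed
  also have "\<dots> = (LINT t|lborel. LINT u|lborel. ?f u t)"
    using lborel_pair.Fubini_integral[OF int] by simp
  also have "\<dots> = (LINT t|lborel. indicator {0..1} t * (1 - t) * (LINT u|lborel. vallee_poussin u * (cos (t * (x - u)) * g (x - u))))"
    unfolding Bochner_Integration.integral_mult_right_zero[symmetric]
    by (auto simp: ac_simps intro!: Bochner_Integration.integral_cong)
  also have "\<dots> = (LINT t|lborel. indicator {0..1} t * ((1 - t) * cos (t * x)) * g x)"
    by (intro Bochner_Integration.integral_cong) (auto simp: indicator_def rep)
  finally show ?thesis by (simp add: fejer_def set_lebesgue_integral_def)
qed

lemma vp_conv_fejer_sq: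
  "(LINT u|lborel. vallee_poussin u * (fejer (x - u))\<^sup>2) = (fejer x)\<^sup>2"
proof -
  have "(LINT u|lborel. vallee_poussin u * (fejer (x - u) * cos (s * (x - u)))) = fejer x * cos (s * x)"
    if s: "s \<in> {0..1}" for s x
  proof (rule vp_conv_fejer_mult[where g="\<lambda>x. cos (s * x)" and B=1])
    fix t x :: real assume t: "t \<in> {0..1}"
    have i: "integrable lborel (\<lambda>u. vallee_poussin u * cos (r * (x - u)))" for r
      by (rule vp_integrable_mult[where B=1]; simp)
    \<comment> \<open>The product of two cosines with frequencies t, s in [0, 1] has frequencies t +
      s and t - s in [-2, 2]; this fixes the width of the plateau.\<close>
    have "(LINT u|lborel. vallee_poussin u * (cos (t * (x - u)) * cos (s * (x - u)))) =
      (LINT u|lborel. vallee_poussin u * cos ((t + s) * (x - u)) / 2 + vallee_poussin u * cos ((t - s) * (x - u)) / 2)"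
    proof (intro Bochner_Integration.integral_cong refl)
      fix u
      have "cos a * cos b = (cos (a + b) + cos (a - b)) / 2" for a b :: real
        by (simp add: cos_add cos_diff)
      then show "vallee_poussin u * (cos (t * (x - u)) * cos (s * (x - u))) =
          vallee_poussin u * cos ((t + s) * (x - u)) / 2 + vallee_poussin u * cos ((t - s) * (x - u)) / 2"
        unfolding distrib_right[of t s] left_diff_distrib[of t s]
        by (simp only: add_divide_distrib distrib_left times_divide_eq_right)
    qed
    also have "\<dots> = cos ((t+s)*x) / 2 + cos ((t-s)*x) / 2"
    proof -
      have "\<bar>t + s\<bar> \<le> 2" "\<bar>t - s\<bar> \<le> 2" using s t by auto
      then show ?thesis using i by (simp add: vp_conv_cos)
    qed
    also have "\<dots> = cos (t * x) * cos (s * x)"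
      by (simp add: cos_add cos_diff distrib_right left_diff_distrib field_simps)
    finally show "(LINT u|lborel. vallee_poussin u * (cos (t * (x - u)) * cos (s * (x - u)))) = cos (t * x) * cos (s * x)" .
  qed auto
  then have "(LINT u|lborel. vallee_poussin u * (fejer (x - u) * fejer (x - u))) = fejer x * fejer x"
    by (intro vp_conv_fejer_mult[where B=1] fejer_abs_le_1) (auto simp: ac_simps)
  then show ?thesis by (simp add: power2_eq_square)
qed

lemma vp_bound: "\<exists>B. \<forall>x. \<bar>vallee_poussin x\<bar> \<le> B / (1 + x\<^sup>2)"
proof (intro exI allI)
  fix x :: real
  have mono: "3 / (1 + (c*x)\<^sup>2) \<le> 3 / (1 + x\<^sup>2)" if "c \<ge> 1" for c
  proof -
    have "1 * x\<^sup>2 \<le> c\<^sup>2 * x\<^sup>2" by (rule mult_right_mono) (use that in \<open>auto simp: one_le_power\<close>)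
    then show ?thesis by (intro divide_left_mono) (auto simp: power_mult_distrib add_pos_nonneg)
  qed
  have "\<bar>4\<^sup>2 * fejer (4 * x) - 2\<^sup>2 * fejer (2 * x)\<bar> \<le> 20 * (3 / (1 + x\<^sup>2))"
    using fejer_bound[of "4*x"] fejer_bound[of "2*x"] mono[of 4] mono[of 2] by (simp only: power2_eq_square) linarith
  then have "\<bar>4\<^sup>2 * fejer (4 * x) - 2\<^sup>2 * fejer (2 * x)\<bar> / (2 * fejer_mass) \<le> 20 * (3 / (1 + x\<^sup>2)) / (2 * fejer_mass)"
    using fejer_mass_pos by (intro divide_right_mono) auto
  moreover have "\<bar>vallee_poussin x\<bar> = \<bar>4\<^sup>2 * fejer (4 * x) - 2\<^sup>2 * fejer (2 * x)\<bar> / (2 * fejer_mass)"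
    using fejer_mass_pos by (simp add: vallee_poussin_def abs_div)
  ultimately have "\<bar>vallee_poussin x\<bar> \<le> 20 * (3 / (1 + x\<^sup>2)) / (2 * fejer_mass)" by simp
  \<comment> \<open>30 = (4^2 + 2^2) * 3 / 2, the 3 coming from \<open>fejer_bound\<close>.\<close>
  then show "\<bar>vallee_poussin x\<bar> \<le> (30 / fejer_mass) / (1 + x\<^sup>2)" by simp
qed

text \<open>Continuity of translation in L^1. Dominated convergence suffices here: the kernel is
  continuous off 0, and a bounded shift changes the majorant B / (1 + x^2) only by a constant
  factor.\<close>

lemma vp_translation_tendsto:
  assumes "s \<longlonglongrightarrow> 0"
  shows "(\<lambda>n. LINT x|lborel. \<bar>vallee_poussin (x - s n) - vallee_poussin x\<bar>) \<longlonglongrightarrow> 0"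
proof -
  obtain B where B: "\<And>x. \<bar>vallee_poussin x\<bar> \<le> B / (1 + x\<^sup>2)" using vp_bound by blast
  have B0: "0 \<le> B" using B[of 0] by auto
  \<comment> \<open>The majorant holds for shifts of size at most 1, so an initial segment of the
    sequence is dropped.\<close>
  obtain n0 where n0: "\<And>n. n \<ge> n0 \<Longrightarrow> \<bar>s n\<bar> \<le> 1"
    using assms[unfolded tendsto_iff, rule_format, of 1] by (simp add: eventually_sequentially) (meson less_imp_le)
  let ?s = "\<lambda>n. s (n + n0)"
  have "(\<lambda>n. LINT x|lborel. \<bar>vallee_poussin (x - ?s n) - vallee_poussin x\<bar>) \<longlonglongrightarrow> (LINT x|(lborel::real measure). 0)"
  proof (rule integral_dominated_convergence[where w="\<lambda>x. 4 * B * (1 / (1 + x\<^sup>2))"])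
    show "integrable lborel (\<lambda>x. 4 * B * (1 / (1 + x\<^sup>2)))"
      by (intro integrable_mult_right integrable_inv_1_plus_sq)
    have s: "?s \<longlonglongrightarrow> 0" using assms by (rule LIMSEQ_ignore_initial_segment)
    have "(\<lambda>n. \<bar>vallee_poussin (x - ?s n) - vallee_poussin x\<bar>) \<longlonglongrightarrow> 0" if "x \<noteq> 0" for x
    proof -
      have "isCont vallee_poussin x"
      proof -
        have "isCont (\<lambda>x. fejer (c * x)) x" if "c \<noteq> 0" for c
          by (rule isCont_o2[where f="\<lambda>x. c * x"]) (use that \<open>x \<noteq> 0\<close> in \<open>auto intro!: isCont_fejer\<close>)
        then show ?thesis unfolding vallee_poussin_def using fejer_mass_pos
          by (intro isCont_divide isCont_diff isCont_mult continuous_const) auto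
      qed
      moreover have "(\<lambda>n. x - ?s n) \<longlonglongrightarrow> x" using tendsto_diff[OF tendsto_const s, of x] by simp
      ultimately have "(\<lambda>n. vallee_poussin (x - ?s n)) \<longlonglongrightarrow> vallee_poussin x"
        by (rule isCont_tendsto_compose)
      from tendsto_rabs[OF tendsto_diff[OF this tendsto_const[of "vallee_poussin x"]]]
      show ?thesis by simp
    qed
    then show "AE x in lborel. (\<lambda>n. \<bar>vallee_poussin (x - ?s n) - vallee_poussin x\<bar>) \<longlonglongrightarrow> 0"
      using AE_lborel_singleton[of 0] by auto
    fix n
    have frac: "1 / b \<le> 3 / a" if "a \<le> 3 * b" "0 < a" "0 < b" for a b :: real
    proof -
      have "1 / b * a \<le> 3" using that by (simp add: pos_divide_le_eq)
      then show ?thesis using that by (simp add: pos_le_divide_eq)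
    qed
    \<comment> \<open>From x^2 <= 2 (x - s)^2 + 2 s^2 and |s| <= 1 follows 1 + x^2 <= 3 (1 + (x -
      s)^2). The shifted term costs 3 B and the unshifted one B, whence 4 B.\<close>
    have "\<bar>vallee_poussin (x - ?s n) - vallee_poussin x\<bar> \<le> 4 * B * (1 / (1 + x\<^sup>2))" for x
    proof -
      have "x\<^sup>2 \<le> 2 * (x - ?s n)\<^sup>2 + 2 * (?s n)\<^sup>2"
        using zero_le_power2[of "x - 2 * ?s n"] by (simp add: power2_eq_square algebra_simps)
      moreover have "(?s n)\<^sup>2 \<le> 1" using n0[of "n + n0"] by (simp add: abs_square_le_1)
      ultimately have "1 + x\<^sup>2 \<le> 3 * (1 + (x - ?s n)\<^sup>2)" using zero_le_power2[of "x - ?s n"] unfolding distrib_left by linarith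
      then have "1 / (1 + (x - ?s n)\<^sup>2) \<le> 3 / (1 + x\<^sup>2)"
      proof (rule frac)
        show "0 < 1 + x\<^sup>2" "0 < 1 + (x - ?s n)\<^sup>2" by (simp_all add: add_pos_nonneg)
      qed
      from mult_left_mono[OF this B0] have "B / (1 + (x - ?s n)\<^sup>2) \<le> B * (3 / (1 + x\<^sup>2))" by simp
      then show ?thesis using B[of "x - ?s n"] B[of x] by simp
    qed
    then show "AE x in lborel. norm \<bar>vallee_poussin (x - ?s n) - vallee_poussin x\<bar> \<le> 4 * B * (1 / (1 + x\<^sup>2))" by simp
  qed measurable
  then show ?thesis
    using LIMSEQ_offset[of "\<lambda>n. LINT x|lborel. \<bar>vallee_poussin (x - s n) - vallee_poussin x\<bar>" n0 0] by simp
qed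

section \<open>Local Wiener inversion\<close>

lemma integrable_mult_bounded:
  fixes f g :: "'a \<Rightarrow> real"
  assumes "integrable M f" "g \<in> borel_measurable M" "\<And>x. \<bar>g x\<bar> \<le> B"
  shows "integrable M (\<lambda>x. f x * g x)"
proof (rule Bochner_Integration.integrable_bound[OF integrable_mult_left[OF assms(1), of B]])
  have "\<bar>g x\<bar> \<le> \<bar>B\<bar>" for x using assms(3)[of x] by linarith
  then show "AE x in M. norm (f x * g x) \<le> norm (f x * B)"
    by (auto simp: abs_mult intro!: mult_left_mono)
qed (use assms in measurable)

lemma lborel_integrable_reflect:
  fixes f :: "real \<Rightarrow> real"
  assumes "integrable lborel f"
  shows "integrable lborel (\<lambda>u. f (x - u))"
  using lborel_integrable_real_affine[OF assms, of "-1" x] by simp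

lemma lborel_integral_reflect:
  fixes f :: "real \<Rightarrow> real"
  shows "(LINT u|lborel. f (x - u)) = integral\<^sup>L lborel f"
  using lborel_integral_real_affine[of "-1" f x] by simp

lemma lborel_integral_shift:
  fixes f :: "real \<Rightarrow> real"
  shows "(LINT u|lborel. f (u - x)) = integral\<^sup>L lborel f"
  using lborel_integral_real_affine[of "1" f "-x"] by simp

lemma lborel_integrable_shift:
  fixes f :: "real \<Rightarrow> real"
  assumes "integrable lborel f"
  shows "integrable lborel (\<lambda>u. f (u - x))"
  using lborel_integrable_real_affine[OF assms, of "1" "-x"] by simp

lemma lborel_nn_integral_shift:
  fixes f :: "real \<Rightarrow> ennreal" and x :: real
  assumes [measurable]: "f \<in> borel_measurable borel"
  shows "(\<integral>\<^sup>+u. f (u - x) \<partial>lborel) = (\<integral>\<^sup>+u. f u \<partial>lborel)"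
  using nn_integral_real_affine[of f 1 "-x"] by simp

lemma integrable_product_bounded:
  fixes f g :: "real \<Rightarrow> real"
  assumes f: "integrable lborel f" and g: "integrable lborel g"
    and [measurable]: "case_prod E \<in> borel_measurable (borel \<Otimes>\<^sub>M borel)" and B: "\<And>u v. \<bar>E u v\<bar> \<le> B"
  shows "integrable (lborel \<Otimes>\<^sub>M lborel) (\<lambda>(u, v). f u * g v * E u v)"
proof -
  have [measurable]: "f \<in> borel_measurable borel" "g \<in> borel_measurable borel" using f g by auto
  have "integrable (lborel \<Otimes>\<^sub>M lborel) (\<lambda>(u, v). f u * g v)"
    by (rule lborel_pair.Fubini_integrable) (use f g in \<open>auto simp: abs_mult\<close>)
  from integrable_mult_bounded[OF this, of "case_prod E" B] B
  show ?thesis by (simp add: case_prod_beta')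
qed

text \<open>Only \<open>f\<close> and \<open>g\<close> are integrable, so the integration in
  \<open>u\<close> is carried by \<open>g\<close> and the one in \<open>v\<close> by
  \<open>f\<close>. This justifies f * (E * g) = E * (f * g) for bounded E.\<close>

lemma integrable_product_convolution:
  fixes f g :: "real \<Rightarrow> real"
  assumes f: "integrable lborel f" and g: "integrable lborel g"
    and [measurable]: "E \<in> borel_measurable borel" and B: "\<And>u. \<bar>E u\<bar> \<le> B"
  shows "integrable (lborel \<Otimes>\<^sub>M lborel) (\<lambda>(v, u). f v * E u * g (x - v - u))"
proof (rule lborel_pair.Fubini_integrable)
  have [measurable]: "f \<in> borel_measurable borel" "g \<in> borel_measurable borel" using f g by auto
  show "(\<lambda>(v, u). f v * E u * g (x - v - u)) \<in> borel_measurable (lborel \<Otimes>\<^sub>M lborel)" by measurable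
  have i: "integrable lborel (\<lambda>u. E u * g (x - v - u))" for v
    using integrable_mult_bounded[OF lborel_integrable_reflect[OF g, of "x - v"] _ B] by (simp add: mult.commute)
  show "AE v in lborel. integrable lborel (\<lambda>u. case (v, u) of (v, u) \<Rightarrow> f v * E u * g (x - v - u))"
    using i by (auto simp: mult.assoc)
  have le: "(LINT u|lborel. norm (f v * E u * g (x - v - u))) \<le> \<bar>f v\<bar> * (B * (LINT u|lborel. \<bar>g u\<bar>))" for v
  proof -
    have "(LINT u|lborel. norm (E u * g (x - v - u))) \<le> (LINT u|lborel. B * \<bar>g (x - v - u)\<bar>)"
      using B by (intro integral_mono integrable_norm i integrable_mult_right integrable_abs lborel_integrable_reflect[OF g])
        (auto simp: abs_mult intro!: mult_right_mono)
    also have "\<dots> = B * (LINT u|lborel. \<bar>g u\<bar>)"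
      using lborel_integral_reflect[of "\<lambda>u. \<bar>g u\<bar>" "x - v"] by simp
    finally show ?thesis by (simp add: abs_mult mult.assoc mult_left_mono)
  qed
  have "integrable lborel (\<lambda>v. LINT u|lborel. norm (f v * E u * g (x - v - u)))"
  proof (rule Bochner_Integration.integrable_bound[OF integrable_mult_left[OF integrable_abs[OF f], of "B * (LINT u|lborel. \<bar>g u\<bar>)"]])
    show "AE v in lborel. norm (LINT u|lborel. norm (f v * E u * g (x - v - u))) \<le> norm (\<bar>f v\<bar> * (B * (LINT u|lborel. \<bar>g u\<bar>)))"
      using le by (auto intro!: AE_I2 order_trans[OF _ abs_ge_self] simp: abs_of_nonneg simp del: abs_mult)
  qed measurable
  then show "integrable lborel (\<lambda>v. LINT u|lborel. norm (case (v, u) of (v, u) \<Rightarrow> f v * E u * g (x - v - u)))" by simp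
qed

text \<open>Associativity of convolution: in every use \<open>k v u\<close> is a function of x - v -
  u for a fixed x.\<close>

lemma lborel_fubini_swap:
  fixes f e :: "real \<Rightarrow> real" and k :: "real \<Rightarrow> real \<Rightarrow> real"
  assumes "integrable (lborel \<Otimes>\<^sub>M lborel) (\<lambda>(v, u). f v * e u * k v u)"
  shows "(LINT v|lborel. f v * (LINT u|lborel. e u * k v u)) = (LINT u|lborel. e u * (LINT v|lborel. f v * k v u))"
proof -
  have "(LINT v|lborel. LINT u|lborel. f v * (e u * k v u)) = (LINT u|lborel. LINT v|lborel. e u * (f v * k v u))"
    using lborel_pair.Fubini_integral[OF assms] by (simp add: mult.assoc mult.left_commute)
  then show ?thesis by simp
qed

text \<open>Iterating the hypothesis dominates \<open>X\<close> by partial sums of a geometric series in \<open>L\<^sup>1\<close> up to an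
  error \<open>B * \<delta> ^ n\<close>, which is harmless on bounded intervals.\<close>

lemma integrable_of_contraction:
  fixes X r h :: "real \<Rightarrow> real"
  assumes [measurable]: "X \<in> borel_measurable borel" and B: "\<And>x. \<bar>X x\<bar> \<le> B"
    and r: "integrable lborel r" and h: "integrable lborel h" and lt: "(LINT u|lborel. \<bar>h u\<bar>) < 1"
    and le: "\<And>x. \<bar>X x\<bar> \<le> \<bar>r x\<bar> + (LINT u|lborel. \<bar>h u\<bar> * \<bar>X (x - u)\<bar>)"
  shows "integrable lborel X"
proof -
  define \<delta> where "\<delta> = (LINT u|lborel. \<bar>h u\<bar>)"
  define R where "R = (LINT u|lborel. \<bar>r u\<bar>)"
  have [measurable]: "r \<in> borel_measurable borel" "h \<in> borel_measurable borel" using r h by auto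
  have B0: "0 \<le> B" using B[of 0] by linarith
  have \<delta>: "0 \<le> \<delta>" "\<delta> < 1" and R: "0 \<le> R" using lt by (auto simp: \<delta>_def R_def)
  have nh: "(\<integral>\<^sup>+u. ennreal \<bar>h u\<bar> \<partial>lborel) = ennreal \<delta>"
    unfolding \<delta>_def using h by (intro nn_integral_eq_integral) auto
  have nr: "(\<integral>\<^sup>+u. ennreal \<bar>r u\<bar> \<partial>lborel) = ennreal R"
    unfolding R_def using r by (intro nn_integral_eq_integral) auto
  have le': "ennreal \<bar>X x\<bar> \<le> ennreal \<bar>r x\<bar> + (\<integral>\<^sup>+u. ennreal \<bar>h u\<bar> * ennreal \<bar>X (x - u)\<bar> \<partial>lborel)" for x
  proof -
    have "integrable lborel (\<lambda>u. \<bar>h u\<bar> * \<bar>X (x - u)\<bar>)"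
      using h B by (intro integrable_mult_bounded[where B=B]) auto
    then have "(\<integral>\<^sup>+u. ennreal (\<bar>h u\<bar> * \<bar>X (x - u)\<bar>) \<partial>lborel) = ennreal (LINT u|lborel. \<bar>h u\<bar> * \<bar>X (x - u)\<bar>)"
      by (intro nn_integral_eq_integral) auto
    then show ?thesis using le[of x] by (simp add: ennreal_mult flip: ennreal_plus)
  qed
  \<comment> \<open>The sum of the geometric series of L^1 bounds; R + \<delta> S = S makes the
    bound stable under the iteration.\<close>
  define S where "S = R / (1 - \<delta>)"
  have S: "R + \<delta> * S = S" "0 \<le> S" using \<delta> R by (auto simp: S_def field_simps)
  have "\<exists>g\<in>borel_measurable borel. (\<integral>\<^sup>+x. g x \<partial>lborel) \<le> ennreal S \<and> (\<forall>x. ennreal \<bar>X x\<bar> \<le> g x + ennreal (B * \<delta> ^ n))" for n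
  proof (induction n)
    case 0
    show ?case using B by (intro bexI[of _ "\<lambda>_. 0"]) (auto intro: ennreal_leI)
  next
    case (Suc n)
    then obtain g where [measurable]: "g \<in> borel_measurable borel" and g: "(\<integral>\<^sup>+x. g x \<partial>lborel) \<le> ennreal S"
      "\<And>x. ennreal \<bar>X x\<bar> \<le> g x + ennreal (B * \<delta> ^ n)" by blast
    \<comment> \<open>Inserting the current bound for X into the right side of the hypothesis gives
      the next one; the constant error is multiplied by \<delta>, the mass of |h|.\<close>
    let ?g = "\<lambda>x. ennreal \<bar>r x\<bar> + (\<integral>\<^sup>+u. ennreal \<bar>h u\<bar> * g (x - u) \<partial>lborel)"
    have "(\<integral>\<^sup>+x. ?g x \<partial>lborel) = ennreal R + (\<integral>\<^sup>+x. \<integral>\<^sup>+u. ennreal \<bar>h u\<bar> * g (x - u) \<partial>lborel \<partial>lborel)"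
      using nr by (subst nn_integral_add) auto
    also have "(\<integral>\<^sup>+x. \<integral>\<^sup>+u. ennreal \<bar>h u\<bar> * g (x - u) \<partial>lborel \<partial>lborel) =
        (\<integral>\<^sup>+u. \<integral>\<^sup>+x. ennreal \<bar>h u\<bar> * g (x - u) \<partial>lborel \<partial>lborel)"
      by (rule lborel_pair.Fubini') measurable
    also have "\<dots> = ennreal \<delta> * (\<integral>\<^sup>+x. g x \<partial>lborel)"
      by (simp add: nn_integral_cmult lborel_nn_integral_shift nn_integral_multc nh)
    also have "ennreal R + \<dots> \<le> ennreal R + ennreal \<delta> * ennreal S"
      using g(1) by (intro add_left_mono mult_left_mono) auto
    also have "\<dots> = ennreal S"
      using \<delta> R S by (simp add: ennreal_mult[symmetric] ennreal_plus[symmetric] del: ennreal_plus)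
    finally have 1: "(\<integral>\<^sup>+x. ?g x \<partial>lborel) \<le> ennreal S" .
    have 2: "ennreal \<bar>X x\<bar> \<le> ?g x + ennreal (B * \<delta> ^ Suc n)" for x
    proof -
      have "(\<integral>\<^sup>+u. ennreal \<bar>h u\<bar> * ennreal \<bar>X (x - u)\<bar> \<partial>lborel)
          \<le> (\<integral>\<^sup>+u. ennreal \<bar>h u\<bar> * g (x - u) + ennreal \<bar>h u\<bar> * ennreal (B * \<delta> ^ n) \<partial>lborel)"
        unfolding distrib_left[symmetric] by (intro nn_integral_mono mult_left_mono g) auto
      also have "\<dots> = (\<integral>\<^sup>+u. ennreal \<bar>h u\<bar> * g (x - u) \<partial>lborel) + ennreal \<delta> * ennreal (B * \<delta> ^ n)"
        by (subst nn_integral_add) (auto simp: nn_integral_multc nh)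
      also have "ennreal \<delta> * ennreal (B * \<delta> ^ n) = ennreal (B * \<delta> ^ Suc n)"
        using \<delta> B0 by (simp add: ennreal_mult[symmetric] ac_simps)
      finally show ?thesis using le'[of x] by (simp add: add.assoc) (meson add_left_mono order_trans)
    qed
    show ?case by (rule bexI[of _ ?g]) (use 1 2 in auto)
  qed
  then obtain g where g[measurable]: "\<And>n. g n \<in> borel_measurable borel" and gS: "\<And>n. (\<integral>\<^sup>+x. g n x \<partial>lborel) \<le> ennreal S"
    and gX: "\<And>n x. ennreal \<bar>X x\<bar> \<le> g n x + ennreal (B * \<delta> ^ n)" by metis
  \<comment> \<open>First n tends to infinity on a fixed interval, where the constant error has
    finite integral; only then does the interval grow.\<close>
  have bd: "(\<integral>\<^sup>+x. ennreal \<bar>X x\<bar> * indicator {- real k..real k} x \<partial>lborel) \<le> ennreal S" for k :: nat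
  proof (rule tendsto_lowerbound)
    show "(\<lambda>n. ennreal (S + B * \<delta> ^ n * (2 * real k))) \<longlonglongrightarrow> ennreal S"
      using \<delta> by (intro tendsto_ennrealI) (auto intro!: tendsto_eq_intros LIMSEQ_power_zero)
    have "(\<integral>\<^sup>+x. ennreal \<bar>X x\<bar> * indicator {- real k..real k} x \<partial>lborel) \<le> ennreal (S + B * \<delta> ^ n * (2 * real k))" for n
    proof -
      have "(\<integral>\<^sup>+x. ennreal \<bar>X x\<bar> * indicator {- real k..real k} x \<partial>lborel) \<le>
         (\<integral>\<^sup>+x. g n x + ennreal (B * \<delta> ^ n) * indicator {- real k..real k} x \<partial>lborel)"
        using gX[of _ n] by (intro nn_integral_mono) (auto simp: indicator_def)
      also have "\<dots> = (\<integral>\<^sup>+x. g n x \<partial>lborel) + ennreal (B * \<delta> ^ n) * ennreal (2 * real k)"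
        by (subst nn_integral_add) (auto simp: nn_integral_cmult)
      also have "\<dots> \<le> ennreal S + ennreal (B * \<delta> ^ n) * ennreal (2 * real k)"
        using gS by (intro add_right_mono)
      also have "\<dots> = ennreal (S + B * \<delta> ^ n * (2 * real k))"
        using \<delta> B0 S by (simp add: ennreal_mult[symmetric])
      finally show ?thesis .
    qed
    then show "\<forall>\<^sub>F n in sequentially. (\<integral>\<^sup>+x. ennreal \<bar>X x\<bar> * indicator {- real k..real k} x \<partial>lborel) \<le> ennreal (S + B * \<delta> ^ n * (2 * real k))"
      by simp
  qed simp
  have "(\<integral>\<^sup>+x. ennreal \<bar>X x\<bar> \<partial>lborel) = (\<integral>\<^sup>+x. (SUP k::nat. ennreal \<bar>X x\<bar> * indicator {- real k..real k} x) \<partial>lborel)"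
  proof (rule nn_integral_cong)
    fix x
    show "ennreal \<bar>X x\<bar> = (SUP k::nat. ennreal \<bar>X x\<bar> * indicator {- real k..real k} x)"
    proof (rule antisym)
      obtain k :: nat where "\<bar>x\<bar> \<le> real k" using real_arch_simple by blast
      then have "ennreal \<bar>X x\<bar> = ennreal \<bar>X x\<bar> * indicator {- real k..real k} x"
        by (simp add: indicator_def abs_le_iff)
      also have "\<dots> \<le> (SUP k::nat. ennreal \<bar>X x\<bar> * indicator {- real k..real k} x)" by (rule SUP_upper) simp
      finally show "ennreal \<bar>X x\<bar> \<le> (SUP k::nat. ennreal \<bar>X x\<bar> * indicator {- real k..real k} x)" .
    qed (auto intro!: SUP_least simp: indicator_def)
  qed
  also have "\<dots> = (SUP k::nat. \<integral>\<^sup>+x. ennreal \<bar>X x\<bar> * indicator {- real k..real k} x \<partial>lborel)"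
    by (rule nn_integral_monotone_convergence_SUP)
      (auto simp: incseq_def le_fun_def indicator_def intro!: mult_left_mono)
  also have "\<dots> \<le> ennreal S" by (intro SUP_least bd)
  finally have "(\<integral>\<^sup>+x. ennreal \<bar>X x\<bar> \<partial>lborel) < \<infinity>" by (rule order.strict_trans1) simp
  then show ?thesis by (intro integrableI_bounded) auto
qed

text \<open>When K has integral 1, the first integral bounds the L^1 norm of K * W - W for the
  dilate W x = l V(l x) of V = \<open>vallee_poussin\<close>. Translating W by u amounts to
  translating V by l u, so the L^1 modulus of continuity tends to 0 for each u as l tends to 0, and
  it is at most twice the norm of V.\<close>

lemma small_contraction_scale:
  assumes K: "integrable lborel K"
  obtains l where "l > 0" "(LINT u|lborel. \<bar>K u\<bar> * (LINT y|lborel. \<bar>vallee_poussin (y - l * u) - vallee_poussin y\<bar>)) < 1"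
    "integrable lborel (\<lambda>u. \<bar>K u\<bar> * (LINT y|lborel. \<bar>vallee_poussin (y - l * u) - vallee_poussin y\<bar>))"
proof -
  have [measurable]: "K \<in> borel_measurable borel" using K by auto
  define \<omega> where "\<omega> s = (LINT y|lborel. \<bar>vallee_poussin (y - s) - vallee_poussin y\<bar>)" for s
  have [measurable]: "\<omega> \<in> borel_measurable borel" unfolding \<omega>_def by measurable
  define W where "W = (LINT y|lborel. \<bar>vallee_poussin y\<bar>)"
  have \<omega>: "\<bar>\<omega> s\<bar> \<le> 2 * W" for s
  proof -
    have "\<omega> s \<le> (LINT y|lborel. \<bar>vallee_poussin (y - s)\<bar> + \<bar>vallee_poussin y\<bar>)"
      unfolding \<omega>_def using vp_integrable lborel_integrable_shift[OF vp_integrable, of s]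
      by (intro integral_mono integrable_abs Bochner_Integration.integrable_diff Bochner_Integration.integrable_add) auto
    also have "\<dots> = 2 * W"
      using vp_integrable lborel_integrable_shift[OF vp_integrable, of s] lborel_integral_shift[of "\<lambda>y. \<bar>vallee_poussin y\<bar>" s]
      by (simp add: W_def)
    finally show ?thesis by (simp add: \<omega>_def)
  qed
  have int: "integrable lborel (\<lambda>u. \<bar>K u\<bar> * \<omega> (l * u))" for l
    using K \<omega> by (intro integrable_mult_bounded[where B="2*W"]) auto
  have "(\<lambda>n. LINT u|lborel. \<bar>K u\<bar> * \<omega> (inverse (real (Suc n)) * u)) \<longlonglongrightarrow> (LINT u|(lborel::real measure). 0)"
  proof (rule integral_dominated_convergence[where w="\<lambda>u. \<bar>K u\<bar> * (2 * W)"])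
    show "integrable lborel (\<lambda>u. \<bar>K u\<bar> * (2 * W))" using K by simp
    have "(\<lambda>n. \<bar>K u\<bar> * \<omega> (inverse (real (Suc n)) * u)) \<longlonglongrightarrow> 0" for u
    proof -
      have "(\<lambda>n. inverse (real (Suc n)) * u) \<longlonglongrightarrow> 0"
        using tendsto_mult_left_zero[OF LIMSEQ_inverse_real_of_nat] .
      from tendsto_mult_right_zero[OF vp_translation_tendsto[OF this], of "\<bar>K u\<bar>"] show ?thesis by (simp add: \<omega>_def)
    qed
    then show "AE u in lborel. (\<lambda>n. \<bar>K u\<bar> * \<omega> (inverse (real (Suc n)) * u)) \<longlonglongrightarrow> 0" by simp
    show "AE u in lborel. norm (\<bar>K u\<bar> * \<omega> (inverse (real (Suc n)) * u)) \<le> \<bar>K u\<bar> * (2 * W)" for n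
      using \<omega> by (auto simp: abs_mult intro!: mult_left_mono)
  qed measurable
  from order_tendstoD(2)[OF this, of 1]
  have "\<forall>\<^sub>F n in sequentially. (LINT u|lborel. \<bar>K u\<bar> * \<omega> (inverse (real (Suc n)) * u)) < 1" by simp
  from eventually_happens'[OF sequentially_bot this]
  obtain n where n: "(LINT u|lborel. \<bar>K u\<bar> * \<omega> (inverse (real (Suc n)) * u)) < 1" ..
  show ?thesis
    by (rule that[OF _ n[unfolded \<omega>_def] int[unfolded \<omega>_def]]) simp
qed

lemma obtain_moment_kernel:
  fixes E K :: "real \<Rightarrow> real"
  assumes [measurable]: "E \<in> borel_measurable borel" and B: "\<And>x. \<bar>E x\<bar> \<le> B"
    and K: "integrable lborel K" and K1: "integral\<^sup>L lborel K = 1"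
    and EK: "integrable lborel (\<lambda>x. LINT u|lborel. E (x - u) * K u)"
  obtains \<phi> where "integrable lborel \<phi>" "integrable lborel (\<lambda>x. \<bar>x\<bar> * \<phi> x)" "integral\<^sup>L lborel \<phi> > 0"
    "integrable lborel (\<lambda>x. LINT u|lborel. E (x - u) * \<phi> u)"
proof -
  obtain l where l: "l > 0" and
    lt: "(LINT u|lborel. \<bar>K u\<bar> * (LINT y|lborel. \<bar>vallee_poussin (y - l * u) - vallee_poussin y\<bar>)) < 1"
    and int_K\<omega>: "integrable lborel (\<lambda>u. \<bar>K u\<bar> * (LINT y|lborel. \<bar>vallee_poussin (y - l * u) - vallee_poussin y\<bar>))"
    using small_contraction_scale[OF K] .
  have [measurable]: "K \<in> borel_measurable borel" using K by auto
  \<comment> \<open>Both kernels are dilated by the same l, so that V * \<phi> = \<phi> survives.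
    The factor l in \<open>V\<close> preserves its integral.\<close>
  define V where "V x = l * vallee_poussin (l * x)" for x
  define \<phi> where "\<phi> x = (fejer (l * x))\<^sup>2" for x
  have [measurable]: "V \<in> borel_measurable borel" "\<phi> \<in> borel_measurable borel"
    unfolding V_def \<phi>_def by measurable
  have V: "integrable lborel V"
    unfolding V_def using lborel_integrable_real_affine[OF vp_integrable, of l 0] l by simp
  have \<phi>: "integrable lborel \<phi>"
    unfolding \<phi>_def using lborel_integrable_real_affine[OF fejer_sq_integrals(1), of l 0] l by simp
  have "integrable lborel (\<lambda>x. \<bar>l * x\<bar> * \<phi> x)"
    unfolding \<phi>_def using lborel_integrable_real_affine[OF fejer_sq_integrals(2), of l 0] l by simp
  then have "integrable lborel (\<lambda>x. inverse l * (\<bar>l * x\<bar> * \<phi> x))" by (rule integrable_mult_right)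
  moreover have "inverse l * (\<bar>l * x\<bar> * \<phi> x) = \<bar>x\<bar> * \<phi> x" for x using l by (simp add: abs_mult)
  ultimately have \<phi>x: "integrable lborel (\<lambda>x. \<bar>x\<bar> * \<phi> x)" by simp
  have \<phi>pos: "integral\<^sup>L lborel \<phi> > 0"
    using lborel_integral_real_affine[of l "\<lambda>x. (fejer x)\<^sup>2" 0] l fejer_sq_integrals(3)
    by (simp add: \<phi>_def[abs_def] zero_less_mult_iff)
  have V\<phi>: "(LINT u|lborel. V u * \<phi> (x - u)) = \<phi> x" for x
    using lborel_integral_real_affine[of l "\<lambda>u. vallee_poussin u * (fejer (l * x - u))\<^sup>2" 0] l
    by (simp add: V_def \<phi>_def vp_conv_fejer_sq right_diff_distrib mult.assoc)
  have V\<omega>: "(LINT x|lborel. \<bar>V (x - u) - V x\<bar>) = (LINT y|lborel. \<bar>vallee_poussin (y - l * u) - vallee_poussin y\<bar>)" for u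
  proof -
    have "(LINT x|lborel. \<bar>V (x - u) - V x\<bar>) = (LINT x|lborel. l * \<bar>vallee_poussin (l * x - l * u) - vallee_poussin (l * x)\<bar>)"
      using l by (simp add: V_def abs_mult right_diff_distrib[symmetric])
    then show ?thesis
      using lborel_integral_real_affine[of l "\<lambda>y. \<bar>vallee_poussin (y - l * u) - vallee_poussin y\<bar>" 0] l by simp
  qed
  have V\<phi>': "(LINT v|lborel. V v * \<phi> (x - v - u)) = \<phi> (x - u)" for x u
    using V\<phi>[of "x - u"] by (simp add: diff_diff_add add.commute)
  define F where "F x = (LINT u|lborel. E (x - u) * K u)" for x
  have F': "(LINT v|lborel. K v * E (x - v - u)) = F (x - u)" for x u
    by (simp add: F_def diff_diff_add add.commute mult.commute)
  define X where "X x = (LINT u|lborel. E (x - u) * \<phi> u)" for x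
  \<comment> \<open>Since K has integral 1 this is K * V - V, written so that the L^1 modulus of
    continuity of V bounds its norm.\<close>
  define h where "h w = (LINT u|lborel. K u * (V (w - u) - V w))" for w
  define r where "r x = (LINT u|lborel. \<phi> u * F (x - u))" for x
  have [measurable]: "F \<in> borel_measurable borel" "X \<in> borel_measurable borel" "h \<in> borel_measurable borel" "r \<in> borel_measurable borel"
    unfolding F_def X_def h_def r_def by measurable
  have X': "X x = (LINT u|lborel. E u * \<phi> (x - u))" for x
    using lborel_integral_reflect[of "\<lambda>u. E u * \<phi> (x - u)" x] by (simp add: X_def)
  define C where "C = B * (LINT u|lborel. \<bar>\<phi> u\<bar>)"
  have XC: "\<bar>X x\<bar> \<le> C" for x
  proof -
    have "\<bar>X x\<bar> \<le> (LINT u|lborel. \<bar>E (x - u) * \<phi> u\<bar>)" unfolding X_def by (rule integral_abs_bound)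
    also have "\<dots> \<le> (LINT u|lborel. B * \<bar>\<phi> u\<bar>)"
    proof (intro integral_mono)
      show "integrable lborel (\<lambda>u. \<bar>E (x - u) * \<phi> u\<bar>)"
        using integrable_mult_bounded[OF \<phi>, of "\<lambda>u. E (x - u)" B] B by (intro integrable_abs) (simp add: mult.commute)
    qed (use \<phi> B in \<open>auto simp: abs_mult intro!: mult_right_mono\<close>)
    finally show ?thesis by (simp add: C_def)
  qed
  \<comment> \<open>V * (E * \<phi>) = E * (V * \<phi>) = E * \<phi>.\<close>
  have VX: "(LINT v|lborel. V v * X (x - v)) = X x" for x
    unfolding X' using lborel_fubini_swap[OF integrable_product_convolution[OF V \<phi> _ B, where x=x]]
    by (simp add: V\<phi>')
  \<comment> \<open>K * (E * \<phi>) = (E * K) * \<phi>, a convolution of two integrable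
    functions.\<close>
  have KX: "(LINT v|lborel. K v * X (x - v)) = r x" for x
  proof -
    have "integrable (lborel \<Otimes>\<^sub>M lborel) (\<lambda>(v, u). K v * \<phi> u * E (x - v - u))"
      by (rule integrable_product_bounded[OF K \<phi> _ B]) measurable
    from lborel_fubini_swap[OF this] show ?thesis
      by (simp add: X_def r_def F' mult.commute[of _ "\<phi> _"])
  qed
  have r: "integrable lborel r"
  proof -
    have "integrable (lborel \<Otimes>\<^sub>M lborel) (\<lambda>(u, x). \<phi> u * F (x - u))"
    proof (rule lborel_pair.Fubini_integrable)
      have F: "integrable lborel F" using EK by (simp add: F_def[abs_def])
      then show "AE u in lborel. integrable lborel (\<lambda>x. case (u, x) of (u, x) \<Rightarrow> \<phi> u * F (x - u))"
        by (auto intro!: lborel_integrable_shift)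
      show "integrable lborel (\<lambda>u. LINT x|lborel. norm (case (u, x) of (u, x) \<Rightarrow> \<phi> u * F (x - u)))"
        using \<phi> lborel_integral_shift[of "\<lambda>x. \<bar>F x\<bar>"] by (simp add: abs_mult)
    qed measurable
    from lborel_pair.integrable_fst[OF lborel_pair.integrable_product_swap[OF this]] show ?thesis
      by (simp add: r_def[abs_def])
  qed
  have G: "integrable (lborel \<Otimes>\<^sub>M lborel) (\<lambda>(u, w). K u * (V (w - u) - V w))"
  proof (rule lborel_pair.Fubini_integrable)
    show "AE u in lborel. integrable lborel (\<lambda>w. case (u, w) of (u, w) \<Rightarrow> K u * (V (w - u) - V w))"
      using V by (auto intro!: lborel_integrable_shift)
    show "integrable lborel (\<lambda>u. LINT w|lborel. norm (case (u, w) of (u, w) \<Rightarrow> K u * (V (w - u) - V w)))"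
      using int_K\<omega> by (simp add: abs_mult V\<omega>)
  qed measurable

  have h: "integrable lborel h"
    using lborel_pair.integrable_fst[OF lborel_pair.integrable_product_swap[OF G]] by (simp add: h_def[abs_def])
  have h1: "(LINT u|lborel. \<bar>h u\<bar>) < 1"
  proof -
    have nG: "integrable (lborel \<Otimes>\<^sub>M lborel) (\<lambda>(u, w). \<bar>K u * (V (w - u) - V w)\<bar>)"
      using integrable_abs[OF G] by (simp add: case_prod_beta')
    have "(LINT w|lborel. \<bar>h w\<bar>) \<le> (LINT w|lborel. LINT u|lborel. \<bar>K u * (V (w - u) - V w)\<bar>)"
    proof (intro integral_mono integrable_abs h)
      show "integrable lborel (\<lambda>w. LINT u|lborel. \<bar>K u * (V (w - u) - V w)\<bar>)"
        using lborel_pair.integrable_fst[OF lborel_pair.integrable_product_swap[OF nG]] by simp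
      show "\<bar>h w\<bar> \<le> (LINT u|lborel. \<bar>K u * (V (w - u) - V w)\<bar>)" for w
        unfolding h_def by (rule integral_abs_bound)
    qed
    also have "\<dots> = (LINT u|lborel. LINT w|lborel. \<bar>K u * (V (w - u) - V w)\<bar>)"
      using lborel_pair.Fubini_integral[OF nG] by simp
    also have "\<dots> < 1" using lt by (simp add: abs_mult V\<omega>)
    finally show ?thesis .
  qed
  \<comment> \<open>h * X = K * (V * X) - V * X = K * X - X, by the reproducing property of V on
    X.\<close>
  have hX: "(LINT w|lborel. h w * X (x - w)) = r x - X x" for x
  proof -
    have GX: "integrable (lborel \<Otimes>\<^sub>M lborel) (\<lambda>(u, w). K u * (V (w - u) - V w) * X (x - w))"
      using integrable_mult_bounded[OF G, of "\<lambda>(u, w). X (x - w)" C] XC by (simp add: case_prod_beta')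
    have "(LINT w|lborel. h w * X (x - w)) = (LINT w|lborel. LINT u|lborel. K u * (V (w - u) - V w) * X (x - w))"
      by (simp add: h_def)
    also have "\<dots> = (LINT u|lborel. LINT w|lborel. K u * (V (w - u) - V w) * X (x - w))"
      using lborel_pair.Fubini_integral[OF GX] by simp
    also have "\<dots> = (LINT u|lborel. K u * (X (x - u) - X x))"
    proof (intro Bochner_Integration.integral_cong refl)
      fix u
      have i: "integrable lborel (\<lambda>w. V (w - a) * X (x - w))" for a
        using integrable_mult_bounded[OF lborel_integrable_shift[OF V, of a], of "\<lambda>w. X (x - w)" C] XC by simp
      have sh: "(LINT w|lborel. V (w - a) * X (x - w)) = X (x - a)" for a
        using lborel_integral_shift[of "\<lambda>w. V w * X (x - a - w)" a] VX[of "x - a"] by simp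
      have "(LINT w|lborel. K u * (V (w - u) - V w) * X (x - w)) = K u * (LINT w|lborel. V (w - u) * X (x - w) - V (w - 0) * X (x - w))"
        by (simp add: mult.assoc left_diff_distrib)
      also have "\<dots> = K u * (X (x - u) - X x)"
        by (subst Bochner_Integration.integral_diff[OF i i]) (simp add: sh VX)
      finally show "(LINT w|lborel. K u * (V (w - u) - V w) * X (x - w)) = K u * (X (x - u) - X x)" .
    qed
    also have "\<dots> = (LINT u|lborel. K u * X (x - u)) - (LINT u|lborel. K u * X x)"
      unfolding right_diff_distrib using XC K
      by (intro Bochner_Integration.integral_diff integrable_mult_bounded[where B=C]) auto
    finally show ?thesis by (simp add: KX K1)
  qed
  have "integrable lborel X"
  proof (rule integrable_of_contraction[OF _ XC r h h1])
    fix x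
    have "X x = r x - (LINT w|lborel. h w * X (x - w))" using hX[of x] by simp
    moreover have "\<bar>LINT w|lborel. h w * X (x - w)\<bar> \<le> (LINT w|lborel. \<bar>h w\<bar> * \<bar>X (x - w)\<bar>)"
      using integral_abs_bound[of lborel "\<lambda>w. h w * X (x - w)"] by (simp add: abs_mult)
    ultimately show "\<bar>X x\<bar> \<le> \<bar>r x\<bar> + (LINT u|lborel. \<bar>h u\<bar> * \<bar>X (x - u)\<bar>)" by linarith
  qed measurable
  then show ?thesis using \<phi> \<phi>x \<phi>pos by (intro that[of \<phi>]) (auto simp: X_def[abs_def])
qed

section \<open>The convolution equation on the half-line\<close>

lemma filterlim_minus_const_at_top: "filterlim (\<lambda>y. y - c) at_top at_top" for c :: real
  using filterlim_tendsto_add_at_top[OF tendsto_const[of "- c"] filterlim_ident] by simp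

lemma tendsto_shift_at_top:
  fixes f :: "real \<Rightarrow> real"
  assumes "(f \<longlongrightarrow> L) at_top" shows "((\<lambda>y. f (y - c)) \<longlongrightarrow> L) at_top"
  using filterlim_compose[OF assms filterlim_minus_const_at_top] .

lemma conv_tendsto_zero:
  fixes f g :: "real \<Rightarrow> real"
  assumes f: "integrable lborel f" and [measurable]: "g \<in> borel_measurable borel"
    and B: "\<And>x. \<bar>g x\<bar> \<le> B" and lim: "(g \<longlongrightarrow> 0) at_top"
  shows "((\<lambda>y. LINT w|lborel. f w * g (y - w)) \<longlongrightarrow> 0) at_top"
proof -
  have [measurable]: "f \<in> borel_measurable borel" using f by auto
  have "((\<lambda>y. LINT w|lborel. f w * g (y - w)) \<longlongrightarrow> (LINT w|(lborel::real measure). 0)) at_top"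
  proof (rule integral_dominated_convergence_at_top[where w="\<lambda>w. \<bar>f w\<bar> * B"])
    show "integrable lborel (\<lambda>w. \<bar>f w\<bar> * B)" using f by simp
    show "AE w in lborel. ((\<lambda>y. f w * g (y - w)) \<longlongrightarrow> 0) at_top"
      using tendsto_mult_right_zero[OF tendsto_shift_at_top[OF lim]] by simp
    have "norm (f w * g (y - w)) \<le> \<bar>f w\<bar> * B" for w y
      using mult_left_mono[OF B[of "y - w"] abs_ge_zero[of "f w"]] by (simp add: abs_mult)
    then show "\<forall>\<^sub>F y in at_top. AE w in lborel. norm (f w * g (y - w)) \<le> \<bar>f w\<bar> * B" by simp
  qed measurable
  then show ?thesis by simp
qed

text \<open>Averaging a slowly varying function by \<open>f\<close> amounts asymptotically to
  multiplying it by the integral of \<open>f\<close>. As \<open>g\<close> may be unbounded,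
  dominated convergence is applied to the differences g y - g (y - v), whose bound is linear in v
  and calls for the first moment of \<open>f\<close>.\<close>

lemma conv_slowly_varying:
  fixes f g :: "real \<Rightarrow> real"
  assumes f: "integrable lborel f" "integrable lborel (\<lambda>x. \<bar>x\<bar> * f x)" and [measurable]: "g \<in> borel_measurable borel"
    and C: "\<And>y v. \<bar>g y - g (y - v)\<bar> \<le> C * (\<bar>v\<bar> + 1)"
    and slow: "\<And>v. ((\<lambda>y. g y - g (y - v)) \<longlongrightarrow> 0) at_top"
  shows "integrable lborel (\<lambda>v. f v * (g y - g (y - v)))"
    and "integrable lborel (\<lambda>v. f v * g (y - v))"
    and "((\<lambda>y. g y * integral\<^sup>L lborel f - (LINT v|lborel. f v * g (y - v))) \<longlongrightarrow> 0) at_top"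
proof -
  have [measurable]: "f \<in> borel_measurable borel" using f by auto
  have int: "integrable lborel (\<lambda>v. \<bar>f v\<bar> * (C * (\<bar>v\<bar> + 1)))"
  proof -
    have "integrable lborel (\<lambda>v. C * \<bar>\<bar>v\<bar> * f v\<bar> + C * \<bar>f v\<bar>)"
      using f by (intro Bochner_Integration.integrable_add integrable_mult_right integrable_abs)
    then show ?thesis by (simp add: abs_mult algebra_simps)
  qed
  have le: "norm (f v * (g y - g (y - v))) \<le> \<bar>f v\<bar> * (C * (\<bar>v\<bar> + 1))" for y v
    using C by (auto simp: abs_mult intro!: mult_left_mono)
  show i1: "integrable lborel (\<lambda>v. f v * (g y - g (y - v)))" for y
    by (rule Bochner_Integration.integrable_bound[OF int]) (use le in \<open>auto intro: order_trans[OF _ abs_ge_self]\<close>)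
  have "integrable lborel (\<lambda>v. f v * g y - f v * (g y - g (y - v)))" for y
    using i1 f by (intro Bochner_Integration.integrable_diff integrable_mult_left)
  then show i2: "integrable lborel (\<lambda>v. f v * g (y - v))" for y by (simp add: right_diff_distrib)
  have "((\<lambda>y. LINT v|lborel. f v * (g y - g (y - v))) \<longlongrightarrow> (LINT v|(lborel::real measure). 0)) at_top"
  proof (rule integral_dominated_convergence_at_top[OF _ _ int])
    show "AE v in lborel. ((\<lambda>y. f v * (g y - g (y - v))) \<longlongrightarrow> 0) at_top"
      using tendsto_mult_right_zero[OF slow] by simp
    show "\<forall>\<^sub>F y in at_top. AE v in lborel. norm (f v * (g y - g (y - v))) \<le> \<bar>f v\<bar> * (C * (\<bar>v\<bar> + 1))"
      using le by simp
  qed measurable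
  moreover have "(LINT v|lborel. f v * (g y - g (y - v))) = g y * integral\<^sup>L lborel f - (LINT v|lborel. f v * g (y - v))" for y
    using i2[of y] f by (simp add: right_diff_distrib mult.commute)
  ultimately show "((\<lambda>y. g y * integral\<^sup>L lborel f - (LINT v|lborel. f v * g (y - v))) \<longlongrightarrow> 0) at_top" by simp
qed

lemma tendsto_zero_of_convolution_equation:
  fixes m E \<phi> \<epsilon> :: "real \<Rightarrow> real"
  assumes [measurable]: "m \<in> borel_measurable borel" "E \<in> borel_measurable borel" "\<epsilon> \<in> borel_measurable borel"
    and m0: "\<And>y. y < 0 \<Longrightarrow> m y = 0"
    and C: "\<And>y v. 0 \<le> v \<Longrightarrow> \<bar>m y - m (y - v)\<bar> \<le> C * (v + 1)"
    and slow: "\<And>v. 0 \<le> v \<Longrightarrow> ((\<lambda>y. m y - m (y - v)) \<longlongrightarrow> 0) at_top"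
    and B: "\<And>y. \<bar>E y\<bar> \<le> B" and E0: "\<And>y. y < 0 \<Longrightarrow> E y = 0" and "a \<noteq> 0"
    and eq: "\<And>y. a * (LINT v|lborel. indicator {0..<1} v * m (y - v)) + (LINT w|lborel. E w * (m (y - w) - m (y - w - 1))) = \<epsilon> y"
    and \<epsilon>: "\<And>y. \<bar>\<epsilon> y\<bar> \<le> D" "(\<epsilon> \<longlongrightarrow> 0) at_top"
    and \<phi>: "integrable lborel \<phi>" "integrable lborel (\<lambda>x. \<bar>x\<bar> * \<phi> x)" "integral\<^sup>L lborel \<phi> \<noteq> 0"
    and E\<phi>: "integrable lborel (\<lambda>x. LINT u|lborel. E (x - u) * \<phi> u)"
  shows "(m \<longlongrightarrow> 0) at_top"
proof -
  have [measurable]: "\<phi> \<in> borel_measurable borel" using \<phi> by auto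
  have C': "\<bar>m y - m (y - v)\<bar> \<le> C * (\<bar>v\<bar> + 1)" for y v
    using C[of v y] C[of "-v" "y - v"] by (cases "0 \<le> v") (auto simp: abs_minus_commute)
  have slow': "((\<lambda>y. m y - m (y - v)) \<longlongrightarrow> 0) at_top" for v
  proof (cases "0 \<le> v")
    case False
    then have "((\<lambda>y. - (m (y - v) - m (y - v - (- v)))) \<longlongrightarrow> - 0) at_top"
      by (intro tendsto_minus tendsto_shift_at_top[OF slow]) auto
    then show ?thesis by simp
  qed (rule slow)
  have C0: "0 \<le> C" using C[of 0 0] by simp
  have B0: "0 \<le> B" using B[of 0] by linarith
  let ?\<psi> = "indicator {0..<1::real} :: real \<Rightarrow> real"
  have \<psi>: "integrable lborel ?\<psi>" "integrable lborel (\<lambda>x. \<bar>x\<bar> * ?\<psi> x)" "integral\<^sup>L lborel ?\<psi> = 1"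
  proof -
    show "integrable lborel (\<lambda>x. \<bar>x\<bar> * ?\<psi> x)"
      by (rule Bochner_Integration.integrable_bound[of _ ?\<psi>]) (auto simp: indicator_def)
  qed auto
  define p where "p y = (LINT v|lborel. ?\<psi> v * m (y - v))" for y
  define d where "d y = m y - m (y - 1)" for y
  define Z where "Z x = (LINT u|lborel. E (x - u) * \<phi> u)" for x
  define q where "q y = (LINT w|lborel. E w * d (y - w))" for y
  have [measurable]: "p \<in> borel_measurable borel" "d \<in> borel_measurable borel" "Z \<in> borel_measurable borel" "q \<in> borel_measurable borel"
    unfolding p_def d_def Z_def q_def by measurable
  note m\<psi> = conv_slowly_varying[OF \<psi>(1,2) _ C' slow']
  have mp: "((\<lambda>y. m y - p y) \<longlongrightarrow> 0) at_top" using m\<psi>(3) by (simp add: p_def \<psi>(3))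
  have dB: "\<bar>d y\<bar> \<le> 2 * C" for y unfolding d_def using C'[of y 1] by simp
  have d_lim: "(d \<longlongrightarrow> 0) at_top" unfolding d_def by (rule slow')
  have d0: "d y = 0" if "y < 0" for y using that by (simp add: d_def m0)
  have pdiff: "p y - p (y - v) = (LINT t|lborel. ?\<psi> t * (m (y - t) - m (y - t - v)))" for y v
    using m\<psi>(2)[of y] m\<psi>(2)[of "y - v"] by (simp add: p_def right_diff_distrib diff_diff_add add.commute)
  have pC: "\<bar>p y - p (y - v)\<bar> \<le> C * (\<bar>v\<bar> + 1)" for y v
  proof -
    have "norm (LINT t|lborel. ?\<psi> t * (m (y - t) - m (y - t - v))) \<le> (LINT t|lborel. ?\<psi> t * (C * (\<bar>v\<bar> + 1)))"
    proof (rule Bochner_Integration.integral_norm_bound_integral)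
      show "integrable lborel (\<lambda>t. ?\<psi> t * (m (y - t) - m (y - t - v)))"
        by (rule integrable_mult_bounded[OF \<psi>(1) _ C']) simp
      show "integrable lborel (\<lambda>t. ?\<psi> t * (C * (\<bar>v\<bar> + 1)))" by (intro integrable_mult_left \<psi>(1))
      show "norm (?\<psi> t * (m (y - t) - m (y - t - v))) \<le> ?\<psi> t * (C * (\<bar>v\<bar> + 1))" for t
        using C'[of "y - t" v] by (cases "t \<in> {0..<1}") auto
    qed
    then show ?thesis using \<psi>(3) by (simp add: pdiff)
  qed
  have pslow: "((\<lambda>y. p y - p (y - v)) \<longlongrightarrow> 0) at_top" for v
    unfolding pdiff by (rule conv_tendsto_zero[OF \<psi>(1) _ C' slow']) measurable
  have eq': "p y = (\<epsilon> y - q y) / a" for y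
    using eq[of y] \<open>a \<noteq> 0\<close> by (simp add: p_def q_def d_def field_simps)
  \<comment> \<open>\<open>d\<close> and \<open>E\<close> vanish at negative arguments, so the
    integrand is supported between 0 and z and the integral grows at most linearly in z.\<close>
  have int_d: "integrable lborel (\<lambda>u. d u * E (z - u))"
    and le_d: "(LINT u|lborel. \<bar>d u * E (z - u)\<bar>) \<le> 2 * C * B * \<bar>z\<bar>" for z
  proof -
    have le: "\<bar>d u * E (z - u)\<bar> \<le> 2 * C * B * indicator {0..\<bar>z\<bar>} u" for u
    proof (cases "u \<in> {0..\<bar>z\<bar>}")
      case False
      then have "d u = 0 \<or> E (z - u) = 0" using d0[of u] E0[of "z - u"] by force
      then show ?thesis using False by auto
    next
      case True
      then show ?thesis using mult_mono[OF dB[of u] B[of "z - u"]] C0 by (simp add: abs_mult)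
    qed
    have i: "integrable lborel (\<lambda>u. 2 * C * B * indicator {0..\<bar>z\<bar>} u)" by simp
    show i2: "integrable lborel (\<lambda>u. d u * E (z - u))"
      by (rule Bochner_Integration.integrable_bound[OF i]) (use le in \<open>auto intro: order_trans[OF _ abs_ge_self]\<close>)
    have "(LINT u|lborel. \<bar>d u * E (z - u)\<bar>) \<le> (LINT u|lborel. 2 * C * B * indicator {0..\<bar>z\<bar>} u)"
      using i2 i le by (intro integral_mono integrable_abs)
    then show "(LINT u|lborel. \<bar>d u * E (z - u)\<bar>) \<le> 2 * C * B * \<bar>z\<bar>" by simp
  qed
  have q': "q y = (LINT u|lborel. d u * E (y - u))" for y
    using lborel_integral_reflect[of "\<lambda>u. d u * E (y - u)" y] by (simp add: q_def mult.commute)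
  \<comment> \<open>The bound for E * d grows linearly; the first moment of \<phi> absorbs this
    growth in the integration over v.\<close>
  have F: "integrable (lborel \<Otimes>\<^sub>M lborel) (\<lambda>(v, u). \<phi> v * d u * E (y - v - u))" for y
  proof (rule lborel_pair.Fubini_integrable)
    show "AE v in lborel. integrable lborel (\<lambda>u. case (v, u) of (v, u) \<Rightarrow> \<phi> v * d u * E (y - v - u))"
      using int_d by (simp add: mult.assoc)
    have "integrable lborel (\<lambda>v. 2 * C * B * (\<bar>y\<bar> * \<bar>\<phi> v\<bar> + \<bar>\<bar>v\<bar> * \<phi> v\<bar>))"
      using \<phi> by (intro integrable_mult_right Bochner_Integration.integrable_add integrable_abs)
    then show "integrable lborel (\<lambda>v. LINT u|lborel. norm (case (v, u) of (v, u) \<Rightarrow> \<phi> v * d u * E (y - v - u)))"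
    proof (rule Bochner_Integration.integrable_bound)
      have "norm (LINT u|lborel. norm (\<phi> v * d u * E (y - v - u))) \<le> 2 * C * B * (\<bar>y\<bar> * \<bar>\<phi> v\<bar> + \<bar>\<bar>v\<bar> * \<phi> v\<bar>)" for v
      proof -
        have "norm (LINT u|lborel. norm (\<phi> v * d u * E (y - v - u))) = \<bar>\<phi> v\<bar> * (LINT u|lborel. \<bar>d u * E (y - v - u)\<bar>)"
          by (simp add: abs_mult mult.assoc)
        also have "\<dots> \<le> \<bar>\<phi> v\<bar> * (2 * C * B * \<bar>y - v\<bar>)" by (intro mult_left_mono le_d) simp
        also have "\<dots> \<le> \<bar>\<phi> v\<bar> * (2 * C * B * (\<bar>y\<bar> + \<bar>v\<bar>))" using C0 B0 by (intro mult_left_mono) auto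
        finally show ?thesis by (simp add: abs_mult algebra_simps)
      qed
      then show "AE v in lborel. norm (LINT u|lborel. norm (case (v, u) of (v, u) \<Rightarrow> \<phi> v * d u * E (y - v - u)))
          \<le> norm (2 * C * B * (\<bar>y\<bar> * \<bar>\<phi> v\<bar> + \<bar>\<bar>v\<bar> * \<phi> v\<bar>))"
        by (auto intro: order_trans[OF _ abs_ge_self])
    qed measurable
  qed measurable
  have q\<phi>_int: "integrable lborel (\<lambda>v. \<phi> v * q (y - v))" for y
    using lborel_pair.integrable_fst[OF F[of y]] by (simp add: q' mult.assoc)
  \<comment> \<open>\<phi> * (E * d) = (E * \<phi>) * d: an integrable function is now convolved
    with a bounded one that tends to 0.\<close>
  have q\<phi>: "(LINT v|lborel. \<phi> v * q (y - v)) = (LINT w|lborel. Z w * d (y - w))" for y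
  proof -
    have "(LINT v|lborel. \<phi> v * q (y - v)) = (LINT u|lborel. d u * (LINT v|lborel. \<phi> v * E (y - v - u)))"
      unfolding q' by (rule lborel_fubini_swap[OF F])
    also have "\<dots> = (LINT u|lborel. Z (y - u) * d u)"
      by (simp add: Z_def diff_diff_add add.commute mult.commute)
    finally show ?thesis
      using lborel_integral_reflect[of "\<lambda>u. Z (y - u) * d u" y] by simp
  qed
  have "(LINT v|lborel. \<phi> v * p (y - v)) = ((LINT v|lborel. \<phi> v * \<epsilon> (y - v)) - (LINT w|lborel. Z w * d (y - w))) / a" for y
  proof -
    have "(LINT v|lborel. \<phi> v * p (y - v)) = (LINT v|lborel. (\<phi> v * \<epsilon> (y - v) - \<phi> v * q (y - v)) / a)"
      by (simp add: eq' right_diff_distrib)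
    also have "\<dots> = ((LINT v|lborel. \<phi> v * \<epsilon> (y - v)) - (LINT v|lborel. \<phi> v * q (y - v))) / a"
      using q\<phi>_int integrable_mult_bounded[OF \<phi>(1) _ \<epsilon>(1), of "\<lambda>v. y - v"] by simp
    finally show ?thesis by (simp add: q\<phi>)
  qed
  moreover have "((\<lambda>y. ((LINT v|lborel. \<phi> v * \<epsilon> (y - v)) - (LINT w|lborel. Z w * d (y - w))) / a) \<longlongrightarrow> (0 - 0) / a) at_top"
    using E\<phi> \<phi>(1) \<epsilon> dB d_lim \<open>a \<noteq> 0\<close>
    by (intro tendsto_divide tendsto_diff tendsto_const conv_tendsto_zero[where B=D] conv_tendsto_zero[where B="2*C"])
      (auto simp: Z_def[abs_def])
  ultimately have "((\<lambda>y. LINT v|lborel. \<phi> v * p (y - v)) \<longlongrightarrow> 0) at_top" by simp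
  \<comment> \<open>Slow variation of p undoes the convolution with \<phi>, whose integral is not 0;
    slow variation of m then undoes the unit average.\<close>
  from tendsto_add[OF this conv_slowly_varying(3)[OF \<phi>(1,2) _ pC pslow]]
  have "((\<lambda>y. p y * integral\<^sup>L lborel \<phi>) \<longlongrightarrow> 0) at_top" by simp
  from tendsto_divide[OF this tendsto_const \<phi>(3)] have "(p \<longlongrightarrow> 0) at_top" using \<phi>(3) by simp
  from tendsto_add[OF mp this] show ?thesis by simp
qed

section \<open>Mellin transforms and multiplicative convolution\<close>

text \<open>Support in [1, \<infinity>) is required almost everywhere, since
  \<open>interval_measure\<close> lives on the whole line; \<sigma> is an abscissa of absolute
  convergence.\<close>

definition mellin_finite :: "real \<Rightarrow> real measure \<Rightarrow> bool" where
  "mellin_finite \<sigma> \<mu> \<longleftrightarrow> sets \<mu> = sets borel \<and> (AE x in \<mu>. 1 \<le> x) \<and> (\<integral>\<^sup>+x. ennreal (x powr - \<sigma>) \<partial>\<mu>) < \<infinity>"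

text \<open>The integral of x^(-s) on the vertical line s = \<sigma> + i t, with modulus and phase
  separated so that it becomes a characteristic function in log x.\<close>

definition mellin :: "real \<Rightarrow> real measure \<Rightarrow> real \<Rightarrow> complex" where
  "mellin \<sigma> \<mu> t = (CLINT x|\<mu>. (x powr - \<sigma>) *\<^sub>R iexp (- (t * ln x)))"

lemma mellin_integrable:
  assumes "mellin_finite \<sigma> \<mu>"
  shows "integrable \<mu> (\<lambda>x. (x powr - \<sigma>) *\<^sub>R iexp (- (t * ln x)))"
proof -
  have [measurable_cong]: "sets \<mu> = sets borel" using assms by (simp add: mellin_finite_def)
  show ?thesis using assms by (intro integrableI_bounded) (auto simp: mellin_finite_def)
qed

text \<open>The weight exp (\<sigma> y) / c undoes the density c x^(-\<sigma>), so the measure is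
  recovered from its finite image under ln. The constant c will normalise that image to a
  probability measure.\<close>

lemma emeasure_eq_distr_ln:
  assumes \<mu>: "mellin_finite \<sigma> \<mu>" and "c > 0" and [measurable]: "X \<in> sets borel"
  shows "emeasure \<mu> X = (\<integral>\<^sup>+y. ennreal (exp (\<sigma> * y) / c) * indicator X (exp y)
      \<partial>distr (density \<mu> (\<lambda>x. ennreal (c * x powr - \<sigma>))) borel ln)"
proof -
  have [measurable_cong]: "sets \<mu> = sets borel" using \<mu> by (simp add: mellin_finite_def)
  have [measurable]: "X \<in> sets \<mu>" by simp
  have "(\<integral>\<^sup>+y. ennreal (exp (\<sigma> * y) / c) * indicator X (exp y) \<partial>distr (density \<mu> (\<lambda>x. ennreal (c * x powr - \<sigma>))) borel ln)
      = (\<integral>\<^sup>+x. ennreal (c * x powr - \<sigma>) * (ennreal (exp (\<sigma> * ln x) / c) * indicator X (exp (ln x))) \<partial>\<mu>)"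
    by (simp add: nn_integral_distr nn_integral_density)
  also have "\<dots> = (\<integral>\<^sup>+x. indicator X x \<partial>\<mu>)"
  proof (rule nn_integral_cong_AE)
    have "AE x in \<mu>. 1 \<le> x" using \<mu> by (simp add: mellin_finite_def)
    then show "AE x in \<mu>. ennreal (c * x powr - \<sigma>) * (ennreal (exp (\<sigma> * ln x) / c) * indicator X (exp (ln x))) = indicator X x"
    proof eventually_elim
      case (elim x)
      have "c * x powr - \<sigma> * (exp (\<sigma> * ln x) / c) = 1"
        using elim \<open>c > 0\<close> by (simp add: powr_def exp_minus)
      then have "ennreal (c * x powr - \<sigma>) * ennreal (exp (\<sigma> * ln x) / c) = 1"
        using \<open>c > 0\<close> by (simp add: ennreal_mult[symmetric])
      then show ?case using elim by (simp flip: mult.assoc)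
    qed
  qed
  finally show ?thesis by simp
qed

text \<open>The image of c x^(-\<sigma>) d\<mu> under ln has this transform as its characteristic
  function, up to the factor c and the sign of t. Levy uniqueness applies once the total masses,
  read off at t = 0, are seen to agree.\<close>

lemma mellin_unique:
  assumes \<mu>: "mellin_finite \<sigma> \<mu>" and \<nu>: "mellin_finite \<sigma> \<nu>" and eq: "\<And>t. mellin \<sigma> \<mu> t = mellin \<sigma> \<nu> t"
  shows "\<mu> = \<nu>"
proof -
  define T where "T \<kappa> = (\<integral>\<^sup>+x. ennreal (x powr - \<sigma>) \<partial>\<kappa>)" for \<kappa> :: "real measure"
  have T: "T \<kappa> < \<infinity>" "mellin \<sigma> \<kappa> 0 = of_real (enn2real (T \<kappa>))" if "mellin_finite \<sigma> \<kappa>" for \<kappa>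
  proof -
    have [measurable_cong]: "sets \<kappa> = sets borel" using that by (simp add: mellin_finite_def)
    show "T \<kappa> < \<infinity>" using that by (simp add: mellin_finite_def T_def)
    have "mellin \<sigma> \<kappa> 0 = (CLINT x|\<kappa>. of_real (x powr - \<sigma>))"
      unfolding mellin_def by (intro Bochner_Integration.integral_cong) (auto simp: scaleR_conv_of_real)
    also have "\<dots> = of_real (enn2real (T \<kappa>))"
      by (simp add: T_def integral_eq_nn_integral)
    finally show "mellin \<sigma> \<kappa> 0 = of_real (enn2real (T \<kappa>))" .
  qed
  define D where "D c \<kappa> = distr (density \<kappa> (\<lambda>x. ennreal (c * x powr - \<sigma>))) borel ln" for c and \<kappa> :: "real measure"
  have D: "emeasure (D c \<kappa>) UNIV = ennreal c * T \<kappa>" if "mellin_finite \<sigma> \<kappa>" "c > 0" for c \<kappa>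
  proof -
    have [measurable_cong]: "sets \<kappa> = sets borel" using that by (simp add: mellin_finite_def)
    have [simp]: "space \<kappa> = UNIV" using sets_eq_imp_space_eq[of \<kappa> borel] that by (simp add: mellin_finite_def)
    show ?thesis using that
      by (simp add: D_def emeasure_distr emeasure_density T_def nn_integral_cmult ennreal_mult)
  qed
  have charD: "char (D c \<kappa>) t = c *\<^sub>R mellin \<sigma> \<kappa> (- t)" if "mellin_finite \<sigma> \<kappa>" "c > 0" for c \<kappa> t
  proof -
    have [measurable_cong]: "sets \<kappa> = sets borel" using that by (simp add: mellin_finite_def)
    have "char (D c \<kappa>) t = (CLINT x|\<kappa>. (c * x powr - \<sigma>) *\<^sub>R iexp (t * ln x))"
      using that unfolding char_def D_def by (subst integral_distr) (auto simp: integral_density)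
    also have "\<dots> = (CLINT x|\<kappa>. c *\<^sub>R ((x powr - \<sigma>) *\<^sub>R iexp (t * ln x)))" by simp
    also have "\<dots> = c *\<^sub>R mellin \<sigma> \<kappa> (- t)"
      by (simp only: integral_scaleR_right mellin_def) simp
    finally show ?thesis .
  qed
  have Teq: "T \<mu> = T \<nu>"
  proof -
    have "enn2real (T \<mu>) = enn2real (T \<nu>)" using eq[of 0] T(2)[OF \<mu>] T(2)[OF \<nu>] by simp
    then show ?thesis using T(1)[OF \<mu>] T(1)[OF \<nu>] by (metis ennreal_enn2real infinity_ennreal_def)
  qed
  have sets: "sets \<mu> = sets borel" "sets \<nu> = sets borel" using \<mu> \<nu> by (auto simp: mellin_finite_def)
  obtain c where c: "c > 0" and Dc: "D c \<mu> = D c \<nu>"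
  proof (cases "T \<mu> = 0")
    \<comment> \<open>The zero measure cannot be normalised and is treated apart.\<close>
    case True
    have "D 1 \<mu> = D 1 \<nu>"
    proof (rule measure_eqI)
      fix X assume "X \<in> sets (D 1 \<mu>)"
      have "emeasure (D 1 \<kappa>) X = 0" if "mellin_finite \<sigma> \<kappa>" "T \<kappa> = 0" for \<kappa>
        using D[OF that(1), of 1] that(2) emeasure_mono[of X UNIV "D 1 \<kappa>"] by (simp add: D_def)
      then show "emeasure (D 1 \<mu>) X = emeasure (D 1 \<nu>) X" using \<mu> \<nu> True Teq by simp
    qed (simp add: D_def)
    then show ?thesis using that[of 1] by simp
  next
    case False
    define c where "c = 1 / enn2real (T \<mu>)"
    have "enn2real (T \<mu>) > 0" using False T(1)[OF \<mu>] by (simp add: enn2real_positive_iff zero_less_iff_neq_zero)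
    then have c: "c > 0" by (simp add: c_def)
    have "ennreal c * T \<mu> = ennreal (c * enn2real (T \<mu>))"
      using T(1)[OF \<mu>] c by (simp add: ennreal_mult)
    also have "\<dots> = 1" using \<open>enn2real (T \<mu>) > 0\<close> by (simp add: c_def)
    finally have 1: "ennreal c * T \<mu> = 1" .
    have rd: "real_distribution (D c \<kappa>)" if "mellin_finite \<sigma> \<kappa>" "T \<kappa> = T \<mu>" for \<kappa>
    proof -
      have "prob_space (D c \<kappa>)" by (rule prob_spaceI) (use D[OF that(1) c] 1 that(2) in \<open>simp add: D_def\<close>)
      then show ?thesis by (simp add: real_distribution_def real_distribution_axioms_def D_def)
    qed
    have "char (D c \<mu>) = char (D c \<nu>)" using charD[OF \<mu> c] charD[OF \<nu> c] eq by (intro ext) simp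
    from Levy_uniqueness[OF rd[OF \<mu> refl] rd[OF \<nu> Teq[symmetric]] this] show ?thesis by (rule that[OF c])
  qed
  show ?thesis
  proof (rule measure_eqI)
    fix X assume "X \<in> sets \<mu>"
    then have "X \<in> sets borel" using sets by simp
    from emeasure_eq_distr_ln[OF \<mu> c this] emeasure_eq_distr_ln[OF \<nu> c this] Dc
    show "emeasure \<mu> X = emeasure \<nu> X" by (simp add: D_def)
  qed (simp add: sets)
qed

text \<open>Rankin's bound: for 1 <= u <= x and \<sigma> >= 0 the indicator value 1 is at most (x /
  u)^\<sigma>.\<close>

lemma mellin_finite_emeasure_atMost:
  assumes \<mu>: "mellin_finite \<sigma> \<mu>" and \<sigma>: "\<sigma> \<ge> 0"
  shows "emeasure \<mu> {..x} < \<infinity>"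
proof -
  have [measurable_cong]: "sets \<mu> = sets borel" using \<mu> by (simp add: mellin_finite_def)
  have "AE u in \<mu>. 1 \<le> u" using \<mu> by (simp add: mellin_finite_def)
  then have ae: "AE u in \<mu>. indicator {..x} u \<le> ennreal (x powr \<sigma>) * ennreal (u powr - \<sigma>)"
  proof eventually_elim
    case (elim u)
    show ?case
    proof (cases "u \<le> x")
      case True
      have "1 \<le> (x / u) powr \<sigma>" using True elim \<sigma> by (intro ge_one_powr_ge_zero) auto
      also have "\<dots> = x powr \<sigma> * u powr - \<sigma>" using True elim by (simp add: powr_divide powr_minus_divide)
      finally show ?thesis using True by (simp add: ennreal_mult[symmetric])
    qed auto
  qed
  have "emeasure \<mu> {..x} = (\<integral>\<^sup>+u. indicator {..x} u \<partial>\<mu>)" by simp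
  also have "\<dots> \<le> (\<integral>\<^sup>+u. ennreal (x powr \<sigma>) * ennreal (u powr - \<sigma>) \<partial>\<mu>)"
    by (rule nn_integral_mono_AE[OF ae])
  also have "\<dots> = ennreal (x powr \<sigma>) * (\<integral>\<^sup>+u. ennreal (u powr - \<sigma>) \<partial>\<mu>)"
    by (simp add: nn_integral_cmult)
  also have "\<dots> < \<infinity>" using \<mu> by (simp add: mellin_finite_def ennreal_mult_less_top)
  finally show ?thesis .
qed

lemma mellin_finite_sigma_finite:
  assumes \<mu>: "mellin_finite \<sigma> \<mu>" and \<sigma>: "\<sigma> \<ge> 0"
  shows "sigma_finite_measure \<mu>"
proof
  have s: "sets \<mu> = sets borel" using \<mu> by (simp add: mellin_finite_def)
  show "\<exists>A. countable A \<and> A \<subseteq> sets \<mu> \<and> \<Union>A = space \<mu> \<and> (\<forall>a\<in>A. emeasure \<mu> a \<noteq> \<infinity>)"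
  proof (intro exI[of _ "range (\<lambda>n::nat. {..real n})"] conjI ballI)
    show "\<Union>(range (\<lambda>n::nat. {..real n})) = space \<mu>"
      using sets_eq_imp_space_eq[OF s] real_arch_simple by auto
    show "emeasure \<mu> a \<noteq> \<infinity>" if "a \<in> range (\<lambda>n::nat. {..real n})" for a
      using that mellin_finite_emeasure_atMost[OF \<mu> \<sigma>] by (auto simp: less_top)
  qed (auto simp: s)
qed

lemma mellin_kernel_mult:
  assumes "1 \<le> x" "1 \<le> y"
  shows "(x * y) powr - \<sigma> = x powr - \<sigma> * y powr - \<sigma>"
    and "iexp (- (t * ln (x * y))) = iexp (- (t * ln x)) * iexp (- (t * ln y))"
  using assms by (simp_all add: powr_mult ln_mult algebra_simps flip: exp_add)

text \<open>Fubini and the multiplicativity of x^(-s), which holds on [1, \<infinity>) and hence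
  almost everywhere for the product measure.\<close>

lemma mult_conv_mellin:
  assumes A: "mellin_finite \<sigma> A" and B: "mellin_finite \<sigma> B" and \<sigma>: "\<sigma> \<ge> 0"
  shows mellin_finite_mult_conv: "mellin_finite \<sigma> (mult_conv A B)"
    and nn_integral_mult_conv_powr: "(\<integral>\<^sup>+x. ennreal (x powr - \<sigma>) \<partial>mult_conv A B) =
      (\<integral>\<^sup>+x. ennreal (x powr - \<sigma>) \<partial>A) * (\<integral>\<^sup>+x. ennreal (x powr - \<sigma>) \<partial>B)"
    and mellin_mult_conv: "mellin \<sigma> (mult_conv A B) t = mellin \<sigma> A t * mellin \<sigma> B t"
proof -
  interpret A: sigma_finite_measure A by (rule mellin_finite_sigma_finite[OF A \<sigma>])
  interpret B: sigma_finite_measure B by (rule mellin_finite_sigma_finite[OF B \<sigma>])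
  interpret AB: pair_sigma_finite A B ..
  have [measurable_cong]: "sets A = sets borel" "sets B = sets borel" using A B by (auto simp: mellin_finite_def)
  have aeA: "AE x in A. 1 \<le> x" and aeB: "AE x in B. 1 \<le> x" using A B by (auto simp: mellin_finite_def)
  have ae: "AE z in A \<Otimes>\<^sub>M B. 1 \<le> fst z \<and> 1 \<le> snd z"
  proof (rule AB.AE_pair_measure)
    show "AE x in A. AE y in B. 1 \<le> fst (x, y) \<and> 1 \<le> snd (x, y)"
      using aeA aeB by auto
  qed measurable
  have sets: "sets (mult_conv A B) = sets borel" by (simp add: mult_conv_def)
  have "AE x in mult_conv A B. 1 \<le> x"
    unfolding mult_conv_def
  proof (subst AE_distr_iff)
    show "AE z in A \<Otimes>\<^sub>M B. 1 \<le> (case z of (x, y) \<Rightarrow> x * y)"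
      using ae by eventually_elim (auto simp: split_beta intro: mult_ge1_I)
  qed measurable
  have "(\<integral>\<^sup>+x. ennreal (x powr - \<sigma>) \<partial>mult_conv A B) = (\<integral>\<^sup>+z. ennreal ((fst z * snd z) powr - \<sigma>) \<partial>(A \<Otimes>\<^sub>M B))"
    unfolding mult_conv_def by (subst nn_integral_distr) (auto simp: split_beta)
  also have "\<dots> = (\<integral>\<^sup>+z. ennreal (fst z powr - \<sigma>) * ennreal (snd z powr - \<sigma>) \<partial>(A \<Otimes>\<^sub>M B))"
    by (rule nn_integral_cong_AE) (use ae in \<open>eventually_elim, auto simp: mellin_kernel_mult(1) ennreal_mult\<close>)
  also have "\<dots> = (\<integral>\<^sup>+x. \<integral>\<^sup>+y. ennreal (x powr - \<sigma>) * ennreal (y powr - \<sigma>) \<partial>B \<partial>A)"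
    by (subst B.nn_integral_fst[symmetric]) auto
  also have "\<dots> = (\<integral>\<^sup>+x. ennreal (x powr - \<sigma>) \<partial>A) * (\<integral>\<^sup>+x. ennreal (x powr - \<sigma>) \<partial>B)"
    by (simp add: nn_integral_cmult nn_integral_multc)
  finally show nn: "(\<integral>\<^sup>+x. ennreal (x powr - \<sigma>) \<partial>mult_conv A B) =
      (\<integral>\<^sup>+x. ennreal (x powr - \<sigma>) \<partial>A) * (\<integral>\<^sup>+x. ennreal (x powr - \<sigma>) \<partial>B)" .
  show "mellin_finite \<sigma> (mult_conv A B)"
    using A B \<open>AE x in mult_conv A B. 1 \<le> x\<close>
    by (simp add: mellin_finite_def sets nn ennreal_mult_less_top)
  let ?k = "\<lambda>x. (x powr - \<sigma>) *\<^sub>R iexp (- (t * ln x))"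
  have int: "integrable (A \<Otimes>\<^sub>M B) (\<lambda>(x, y). ?k x * ?k y)"
  proof (rule AB.Fubini_integrable)
    show "AE x in A. integrable B (\<lambda>y. case (x, y) of (x, y) \<Rightarrow> ?k x * ?k y)"
      using mellin_integrable[OF B] by (intro AE_I2) (simp only: prod.case integrable_mult_right)
    have "integrable A (\<lambda>x. norm (?k x) * (LINT y|B. norm (?k y)))"
      using mellin_integrable[OF A] by (intro integrable_mult_left integrable_norm)
    then show "integrable A (\<lambda>x. LINT y|B. norm (case (x, y) of (x, y) \<Rightarrow> ?k x * ?k y))"
      by (simp only: prod.case norm_mult integral_mult_right_zero)
  qed measurable
  have "mellin \<sigma> (mult_conv A B) t = (CLINT z|A \<Otimes>\<^sub>M B. ?k (fst z * snd z))"
    unfolding mellin_def mult_conv_def by (subst integral_distr) (auto simp: split_beta)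
  also have "\<dots> = (CLINT z|A \<Otimes>\<^sub>M B. (case z of (x, y) \<Rightarrow> ?k x * ?k y))"
  proof (rule integral_cong_AE)
    show "AE z in A \<Otimes>\<^sub>M B. ?k (fst z * snd z) = (case z of (x, y) \<Rightarrow> ?k x * ?k y)"
      using ae
    proof eventually_elim
      case (elim z)
      then show ?case
        unfolding split_beta mellin_kernel_mult[OF conjunct1[OF elim] conjunct2[OF elim]]
        by (simp only: mult_scaleR_left mult_scaleR_right scaleR_scaleR mult.commute)
    qed
  qed measurable
  also have "\<dots> = (CLINT x|A. CLINT y|B. ?k x * ?k y)"
    using AB.integral_fst[OF int] by simp
  also have "\<dots> = mellin \<sigma> A t * mellin \<sigma> B t"
    unfolding mellin_def by (simp only: integral_mult_right_zero integral_mult_left_zero)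
  finally show "mellin \<sigma> (mult_conv A B) t = mellin \<sigma> A t * mellin \<sigma> B t" .
qed

lemma mellin_return_one:
  shows "mellin_finite \<sigma> (return borel 1)" "(\<integral>\<^sup>+x. ennreal (x powr - \<sigma>) \<partial>return borel 1) = 1" "mellin \<sigma> (return borel 1) t = 1"
proof -
  have AE1: "(AE x in return borel (1::real). 1 \<le> x)" by (subst AE_return) auto
  show nn: "(\<integral>\<^sup>+x. ennreal (x powr - \<sigma>) \<partial>return borel 1) = 1" by (subst nn_integral_return) auto
  show "mellin_finite \<sigma> (return borel 1)" by (simp add: mellin_finite_def AE1 nn)
  show "mellin \<sigma> (return borel 1) t = 1" unfolding mellin_def by (subst integral_return) auto
qed

lemma mult_conv_power_mellin:
  assumes A: "mellin_finite \<sigma> A" and \<sigma>: "\<sigma> \<ge> 0"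
  shows "mellin_finite \<sigma> (mult_conv_power A n) \<and>
    (\<integral>\<^sup>+x. ennreal (x powr - \<sigma>) \<partial>mult_conv_power A n) = (\<integral>\<^sup>+x. ennreal (x powr - \<sigma>) \<partial>A) ^ n \<and>
    mellin \<sigma> (mult_conv_power A n) t = mellin \<sigma> A t ^ n"
  by (induction n) (auto simp: mellin_return_one mult_conv_mellin[OF A _ \<sigma>])

section \<open>Integration against series of convolution powers\<close>

lemma measurable_mult_conv_series:
  "borel_measurable (mult_conv_series c A) = borel_measurable borel"
  "borel_measurable (mult_conv_power A n) = borel_measurable borel"
  by (rule measurable_cong_sets; simp)+

lemma nn_integral_mult_conv_series:
  assumes "f \<in> borel_measurable borel"
  shows "(\<integral>\<^sup>+x. f x \<partial>mult_conv_series c A) = (\<Sum>n. ennreal (c n) * (\<integral>\<^sup>+x. f x \<partial>mult_conv_power A n))"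
  using assms
proof induction
  case (cong f g)
  then show ?case by simp
next
  case (set X)
  then have "X \<in> sets borel" by simp
  then show ?case by (simp add: emeasure_mult_conv_series)
next
  case (mult u k)
  have [measurable]: "u \<in> borel_measurable (mult_conv_series c A)" "u \<in> borel_measurable (mult_conv_power A n)" for n
    using mult by (simp_all add: measurable_mult_conv_series)
  have "(\<integral>\<^sup>+x. k * u x \<partial>mult_conv_series c A) = k * (\<Sum>n. ennreal (c n) * (\<integral>\<^sup>+x. u x \<partial>mult_conv_power A n))"
    using mult by (subst nn_integral_cmult) auto
  also have "\<dots> = (\<Sum>n. k * (ennreal (c n) * (\<integral>\<^sup>+x. u x \<partial>mult_conv_power A n)))"
    by (rule ennreal_suminf_cmult[symmetric])
  also have "\<dots> = (\<Sum>n. ennreal (c n) * (\<integral>\<^sup>+x. k * u x \<partial>mult_conv_power A n))"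
    by (intro suminf_cong) (simp add: nn_integral_cmult mult.left_commute)
  finally show ?case .
next
  case (add u v)
  have [measurable]: "u \<in> borel_measurable (mult_conv_series c A)" "u \<in> borel_measurable (mult_conv_power A n)"
    "v \<in> borel_measurable (mult_conv_series c A)" "v \<in> borel_measurable (mult_conv_power A n)" for n
    using add by (simp_all add: measurable_mult_conv_series)
  have "(\<integral>\<^sup>+x. v x + u x \<partial>mult_conv_series c A) =
      (\<Sum>n. ennreal (c n) * (\<integral>\<^sup>+x. v x \<partial>mult_conv_power A n)) + (\<Sum>n. ennreal (c n) * (\<integral>\<^sup>+x. u x \<partial>mult_conv_power A n))"
    using add by (subst nn_integral_add) auto
  also have "\<dots> = (\<Sum>n. ennreal (c n) * (\<integral>\<^sup>+x. v x \<partial>mult_conv_power A n) + ennreal (c n) * (\<integral>\<^sup>+x. u x \<partial>mult_conv_power A n))"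
    by (intro suminf_add summableI)
  also have "\<dots> = (\<Sum>n. ennreal (c n) * (\<integral>\<^sup>+x. v x + u x \<partial>mult_conv_power A n))"
    by (intro suminf_cong) (simp add: nn_integral_add distrib_left)
  finally show ?case .
next
  case (seq U)
  have [measurable]: "U i \<in> borel_measurable (mult_conv_series c A)" "U i \<in> borel_measurable (mult_conv_power A n)" for i n
    using seq by (simp_all add: measurable_mult_conv_series)
  have "(\<integral>\<^sup>+x. (SUP i. U i x) \<partial>mult_conv_series c A) = (SUP i. \<integral>\<^sup>+x. U i x \<partial>mult_conv_series c A)"
    by (rule nn_integral_monotone_convergence_SUP) (use seq in auto)
  also have "\<dots> = (SUP i. \<Sum>n. ennreal (c n) * (\<integral>\<^sup>+x. U i x \<partial>mult_conv_power A n))"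
    using seq by simp
  also have "\<dots> = (\<Sum>n. SUP i. ennreal (c n) * (\<integral>\<^sup>+x. U i x \<partial>mult_conv_power A n))"
  proof (rule ennreal_suminf_SUP_eq[symmetric])
    show "incseq (\<lambda>i. ennreal (c n) * (\<integral>\<^sup>+x. U i x \<partial>mult_conv_power A n))" for n
      using \<open>incseq U\<close> unfolding incseq_def le_fun_def by (intro allI impI mult_left_mono nn_integral_mono) auto
  qed
  also have "\<dots> = (\<Sum>n. ennreal (c n) * (\<integral>\<^sup>+x. (SUP i. U i x) \<partial>mult_conv_power A n))"
  proof (rule suminf_cong)
    fix n
    have "(\<integral>\<^sup>+x. (SUP i. U i x) \<partial>mult_conv_power A n) = (SUP i. \<integral>\<^sup>+x. U i x \<partial>mult_conv_power A n)"
      by (rule nn_integral_monotone_convergence_SUP) (use seq in auto)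
    then show "(SUP i. ennreal (c n) * (\<integral>\<^sup>+x. U i x \<partial>mult_conv_power A n)) =
        ennreal (c n) * (\<integral>\<^sup>+x. (SUP i. U i x) \<partial>mult_conv_power A n)"
      by (simp add: SUP_mult_left_ennreal)
  qed
  finally show ?case by (simp add: image_comp)
qed

lemma ennreal_sums_enn2real:
  assumes "(\<Sum>n. a n) < (\<infinity>::ennreal)"
  shows "(\<lambda>n. enn2real (a n)) sums enn2real (\<Sum>n. a n)"
proof -
  have fin: "a n < \<infinity>" for n
  proof -
    have "sum a {n} \<le> (\<Sum>n. a n)" by (intro sum_le_suminf summableI) auto
    then show ?thesis using assms by (simp add: order.strict_trans1)
  qed
  have a: "ennreal (enn2real (a n)) = a n" for n
    using fin[of n] by (intro ennreal_enn2real) simp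
  have ne: "(\<Sum>n. ennreal (enn2real (a n))) \<noteq> top" using assms by (simp add: a)
  have s: "summable (\<lambda>n. enn2real (a n))" by (rule summable_suminf_not_top[OF _ ne]) simp
  have "(\<Sum>n. a n) = ennreal (\<Sum>n. enn2real (a n))"
    using suminf_ennreal2[OF _ s] by (simp add: a)
  then show ?thesis using s by (simp add: suminf_nonneg summable_sums)
qed

lemma sums_integral_mult_conv_series_nonneg:
  fixes f :: "real \<Rightarrow> real"
  assumes c: "\<And>n. 0 \<le> c n" and f: "integrable (mult_conv_series c A) f" and f0: "\<And>x. 0 \<le> f x"
  shows "(\<lambda>n. c n * (LINT x|mult_conv_power A n. f x)) sums (LINT x|mult_conv_series c A. f x)"
proof -
  have m[measurable]: "f \<in> borel_measurable borel"
    using borel_measurable_integrable[OF f] by (simp add: measurable_mult_conv_series)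
  have fin: "(\<integral>\<^sup>+x. ennreal (f x) \<partial>mult_conv_series c A) < \<infinity>"
    using f f0 by (simp add: integrable_iff_bounded)
  have eq: "(\<integral>\<^sup>+x. ennreal (f x) \<partial>mult_conv_series c A) = (\<Sum>n. ennreal (c n) * (\<integral>\<^sup>+x. ennreal (f x) \<partial>mult_conv_power A n))"
    by (rule nn_integral_mult_conv_series) measurable
  from ennreal_sums_enn2real[OF fin[unfolded eq]]
  show ?thesis using f0 c
    by (simp add: integral_eq_nn_integral measurable_mult_conv_series eq enn2real_mult)
qed

lemma sums_integral_mult_conv_series_real:
  fixes f :: "real \<Rightarrow> real"
  assumes c: "\<And>n. 0 \<le> c n" and f: "integrable (mult_conv_series c A) f" and fn: "\<And>n. integrable (mult_conv_power A n) f"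
  shows "(\<lambda>n. c n * (LINT x|mult_conv_power A n. f x)) sums (LINT x|mult_conv_series c A. f x)"
proof -
  have eq: "(LINT x|M. f x) = (LINT x|M. max 0 (f x)) - (LINT x|M. max 0 (- f x))" if "integrable M f" for M
  proof -
    have "(LINT x|M. max 0 (f x)) - (LINT x|M. max 0 (- f x)) = (LINT x|M. max 0 (f x) - max 0 (- f x))"
      using that by (intro Bochner_Integration.integral_diff[symmetric] integrable_max) auto
    also have "\<dots> = (LINT x|M. f x)" by (intro Bochner_Integration.integral_cong) auto
    finally show ?thesis ..
  qed
  have "(\<lambda>n. c n * (LINT x|mult_conv_power A n. max 0 (f x)) - c n * (LINT x|mult_conv_power A n. max 0 (- f x)))
     sums ((LINT x|mult_conv_series c A. max 0 (f x)) - (LINT x|mult_conv_series c A. max 0 (- f x)))"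
    using f by (intro sums_diff sums_integral_mult_conv_series_nonneg c integrable_max) auto
  then show ?thesis by (simp add: eq[OF f] eq[OF fn] right_diff_distrib)
qed

lemma sums_integral_mult_conv_series:
  fixes f :: "real \<Rightarrow> complex"
  assumes c: "\<And>n. 0 \<le> c n" and f: "integrable (mult_conv_series c A) f" and fn: "\<And>n. integrable (mult_conv_power A n) f"
  shows "(\<lambda>n. c n *\<^sub>R (CLINT x|mult_conv_power A n. f x)) sums (CLINT x|mult_conv_series c A. f x)"
  unfolding sums_complex_iff
  using sums_integral_mult_conv_series_real[OF c integrable_Re[OF f] integrable_Re[OF fn]]
    sums_integral_mult_conv_series_real[OF c integrable_Im[OF f] integrable_Im[OF fn]] f fn by simp

text \<open>The transform takes convolution powers to powers, hence the series to the power series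
  with the same coefficients. Summability at the real value t = 0 controls all t, because the phases
  have modulus 1.\<close>

lemma mult_conv_series_mellin:
  assumes A: "mellin_finite \<sigma> A" and \<sigma>: "\<sigma> \<ge> 0" and c: "\<And>n. 0 \<le> c n"
    and sm: "summable (\<lambda>n. c n * enn2real (\<integral>\<^sup>+x. ennreal (x powr - \<sigma>) \<partial>A) ^ n)"
  shows "mellin_finite \<sigma> (mult_conv_series c A)"
    and "(\<lambda>n. c n *\<^sub>R mellin \<sigma> A t ^ n) sums mellin \<sigma> (mult_conv_series c A) t"
proof -
  define r where "r = enn2real (\<integral>\<^sup>+x. ennreal (x powr - \<sigma>) \<partial>A)"
  have r: "(\<integral>\<^sup>+x. ennreal (x powr - \<sigma>) \<partial>A) = ennreal r" "0 \<le> r" using A by (auto simp: r_def mellin_finite_def)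
  note pw = mult_conv_power_mellin[OF A \<sigma>]
  have "(\<integral>\<^sup>+x. ennreal (x powr - \<sigma>) \<partial>mult_conv_series c A) = (\<Sum>n. ennreal (c n * r ^ n))"
  proof (subst nn_integral_mult_conv_series)
    have "ennreal (c n) * (\<integral>\<^sup>+x. ennreal (x powr - \<sigma>) \<partial>mult_conv_power A n) = ennreal (c n * r ^ n)" for n
      unfolding conjunct1[OF conjunct2[OF pw[of n]]] r(1) using r(2) c by (simp add: ennreal_power ennreal_mult)
    then show "(\<Sum>n. ennreal (c n) * (\<integral>\<^sup>+x. ennreal (x powr - \<sigma>) \<partial>mult_conv_power A n)) = (\<Sum>n. ennreal (c n * r ^ n))"
      by (rule suminf_cong)
  qed measurable
  also have "\<dots> = ennreal (\<Sum>n. c n * r ^ n)"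
    by (rule suminf_ennreal2[OF _ sm[folded r_def]]) (simp add: c r(2))
  finally have fin: "(\<integral>\<^sup>+x. ennreal (x powr - \<sigma>) \<partial>mult_conv_series c A) < \<infinity>" by simp
  \<comment> \<open>Almost everywhere support is rephrased through a null set, a form that passes
    through the series of measures.\<close>
  have ae: "(AE x in M. 1 \<le> x) \<longleftrightarrow> emeasure M {..<1} = 0" if "sets M = sets borel" for M :: "real measure"
    using that sets_eq_imp_space_eq[OF that] by (intro AE_iff_measurable) auto
  have "emeasure (mult_conv_power A n) {..<1} = 0" for n
    using conjunct1[OF pw[of n]] ae[OF sets_mult_conv_power] unfolding mellin_finite_def by blast
  then have "AE x in mult_conv_series c A. 1 \<le> x" by (simp add: ae emeasure_mult_conv_series)
  with fin show S: "mellin_finite \<sigma> (mult_conv_series c A)" by (simp add: mellin_finite_def)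
  have "(\<lambda>n. c n *\<^sub>R mellin \<sigma> (mult_conv_power A n) t) sums mellin \<sigma> (mult_conv_series c A) t"
    unfolding mellin_def
    by (rule sums_integral_mult_conv_series[OF c mellin_integrable[OF S] mellin_integrable[OF conjunct1[OF pw]]])
  then show "(\<lambda>n. c n *\<^sub>R mellin \<sigma> A t ^ n) sums mellin \<sigma> (mult_conv_series c A) t"
    unfolding conjunct2[OF conjunct2[OF pw]] .
qed

section \<open>Generalized number systems\<close>

text \<open>The value of \<open>interval_measure\<close> is known on half-open intervals. Those that
  exhaust \<open>{..<1}\<close> end strictly below 1, because F may jump at 1, as N does.\<close>

lemma AE_interval_measure_ge_1:
  assumes "mono F" "\<And>x. continuous (at_right x) F" "\<And>x. x < 1 \<Longrightarrow> F x = 0"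
  shows "AE x in interval_measure F. 1 \<le> (x::real)"
proof -
  let ?U = "\<lambda>n::nat. {- real n<..1 - 1 / real (Suc n)}"
  have U: "?U n \<in> null_sets (interval_measure F)" for n
    using assms by (auto simp: null_sets_def emeasure_interval_measure_Ioc_eq monoD)
  have "{..<1} = (\<Union>n. ?U n)"
  proof (intro equalityI subsetI)
    fix x :: real assume "x \<in> {..<1}"
    then obtain n0 where n0: "inverse (real (Suc n0)) < 1 - x" using reals_Archimedean[of "1 - x"] by auto
    obtain n1 where n1: "- x < real n1" using reals_Archimedean2 by blast
    have "1 / real (Suc (max n0 n1)) \<le> 1 / real (Suc n0)" by (intro divide_left_mono) auto
    then have "x \<in> ?U (max n0 n1)" using n0 n1 by (auto simp: inverse_eq_divide)
    then show "x \<in> (\<Union>n. ?U n)" by blast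
  qed (auto intro: order.strict_trans1)
  then have "{..<1} \<in> null_sets (interval_measure F)" using null_sets_UN[of ?U, OF U] by simp
  from AE_not_in[OF this] show ?thesis by eventually_elim auto
qed

lemma powr_complex_eq:
  assumes "1 \<le> x"
  shows "complex_of_real x powr - Complex \<sigma> t = (x powr - \<sigma>) *\<^sub>R iexp (- (t * ln x))"
proof -
  have "complex_of_real x powr - Complex \<sigma> t = exp (- Complex \<sigma> t * of_real (ln x))"
    using assms by (simp add: powr_def Ln_of_real)
  also have "- Complex \<sigma> t * of_real (ln x) = of_real (- \<sigma> * ln x) + \<i> * of_real (- (t * ln x))"
    by (simp add: complex_eq_iff)
  finally show ?thesis using assms
    by (simp add: exp_add powr_def scaleR_conv_of_real exp_of_real[symmetric] del: of_real_mult of_real_minus exp_of_real)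
qed

lemma gen_number_system_mellin:
  assumes "gen_number_system N P"
  obtains \<sigma> where "\<sigma> \<ge> 0" "mellin_finite \<sigma> (interval_measure N)" "mellin_finite \<sigma> (interval_measure P)"
    "\<And>t. mellin \<sigma> (interval_measure N) t = exp (mellin \<sigma> (interval_measure P) t)"
proof -
  obtain \<sigma>0 where \<sigma>0: "\<And>s::complex. Re s > \<sigma>0 \<Longrightarrow>
        set_integrable (interval_measure N) {1..} (\<lambda>x. complex_of_real x powr (- s)) \<and>
        set_integrable (interval_measure P) {1..} (\<lambda>x. complex_of_real x powr (- s)) \<and>
        (LINT x:{1..}|interval_measure N. complex_of_real x powr (- s)) =
          exp (LINT x:{1..}|interval_measure P. complex_of_real x powr (- s))"
    using assms unfolding gen_number_system_def by blast
  \<comment> \<open>The half-plane of convergence is open and may start left of 0; this choice lies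
    strictly inside it and is non-negative.\<close>
  define \<sigma> where "\<sigma> = max 0 (\<sigma>0 + 1)"
  have \<sigma>: "\<sigma> \<ge> 0" "Re (Complex \<sigma> t) > \<sigma>0" for t by (auto simp: \<sigma>_def)
  have aeN: "AE x in interval_measure N. 1 \<le> x" and aeP: "AE x in interval_measure P. 1 \<le> x"
    using assms by (intro AE_interval_measure_ge_1; simp add: gen_number_system_def)+
  have ind: "AE x in interval_measure F. indicator {1..} x *\<^sub>R (complex_of_real x powr - Complex \<sigma> t)
      = (x powr - \<sigma>) *\<^sub>R iexp (- (t * ln x))"
    if "AE x in interval_measure F. 1 \<le> x" for F t
    using that by eventually_elim (simp add: powr_complex_eq)
  have fin: "mellin_finite \<sigma> (interval_measure F)"
    if ae: "AE x in interval_measure F. 1 \<le> x" and "set_integrable (interval_measure F) {1..} (\<lambda>x. complex_of_real x powr (- Complex \<sigma> 0))" for F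
  proof -
    have "(\<integral>\<^sup>+x. ennreal (x powr - \<sigma>) \<partial>interval_measure F) =
        (\<integral>\<^sup>+x. ennreal (norm (indicator {1..} x *\<^sub>R (complex_of_real x powr - Complex \<sigma> 0))) \<partial>interval_measure F)"
      by (rule nn_integral_cong_AE) (use ind[OF ae, of 0] in \<open>eventually_elim, simp\<close>)
    also have "\<dots> < \<infinity>" using that(2) unfolding set_integrable_def integrable_iff_bounded by simp
    finally show ?thesis using ae by (simp add: mellin_finite_def)
  qed
  have mel: "(LINT x:{1..}|interval_measure F. complex_of_real x powr (- Complex \<sigma> t)) = mellin \<sigma> (interval_measure F) t"
    if "AE x in interval_measure F. 1 \<le> x" and "set_integrable (interval_measure F) {1..} (\<lambda>x. complex_of_real x powr (- Complex \<sigma> t))" for F t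
    unfolding mellin_def set_lebesgue_integral_def
    by (rule integral_cong_AE) (use ind[OF that(1), of t] that(2) in \<open>auto simp: set_integrable_def\<close>)
  show ?thesis
    using \<sigma>0[OF \<sigma>(2)] by (intro that[OF \<sigma>(1)] fin aeN aeP) (auto simp flip: mel[OF aeN] mel[OF aeP])
qed

lemma summable_exp_real: "summable (\<lambda>n. r ^ n / fact n)" for r :: real
  using summable_exp[of r] by (simp add: divide_inverse mult.commute)

text \<open>The even and odd parts of the exponential series are cosh and sinh; their difference exp
  (-z) is the transform of dM.\<close>

lemma dM_mellin:
  assumes \<sigma>: "\<sigma> \<ge> 0" and P: "mellin_finite \<sigma> (interval_measure P)"
  shows "mellin_finite \<sigma> (dM_even P)" "mellin_finite \<sigma> (dM_odd P)"
    "mellin \<sigma> (dM_even P) t = cosh (mellin \<sigma> (interval_measure P) t)"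
    "mellin \<sigma> (dM_odd P) t = sinh (mellin \<sigma> (interval_measure P) t)"
proof -
  define r where "r = enn2real (\<integral>\<^sup>+x. ennreal (x powr - \<sigma>) \<partial>interval_measure P)"
  have r: "0 \<le> r" by (simp add: r_def)
  have 1: "summable (\<lambda>n. (if even n then 1 / fact n else 0) * r ^ n)"
    and 2: "summable (\<lambda>n. (if odd n then 1 / fact n else 0) * r ^ n)"
    using r by (intro summable_comparison_test'[OF summable_exp_real[of r], of 0]; simp)+
  have c: "0 \<le> (if even n then 1 / fact n else 0 :: real)" "0 \<le> (if odd n then 1 / fact n else 0 :: real)" for n :: nat
    by auto
  note e = mult_conv_series_mellin[OF P \<sigma> c(1) 1[unfolded r_def], folded dM_even_def]
  note o = mult_conv_series_mellin[OF P \<sigma> c(2) 2[unfolded r_def], folded dM_odd_def]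
  show "mellin_finite \<sigma> (dM_even P)" "mellin_finite \<sigma> (dM_odd P)" by (rule e(1), rule o(1))
  let ?p = "mellin \<sigma> (interval_measure P) t"
  have "(\<lambda>n. (if even n then 1 / fact n else 0) *\<^sub>R ?p ^ n) sums cosh ?p"
    using cosh_converges[of ?p] by (rule sums_cong[THEN iffD1, rotated]) (simp add: divide_inverse)
  then show "mellin \<sigma> (dM_even P) t = cosh ?p" by (rule sums_unique2[OF e(2)])
  have "(\<lambda>n. (if odd n then 1 / fact n else 0) *\<^sub>R ?p ^ n) sums sinh ?p"
    using sinh_converges[of ?p] by (rule sums_cong[THEN iffD1, rotated]) (simp add: divide_inverse)
  then show "mellin \<sigma> (dM_odd P) t = sinh ?p" by (rule sums_unique2[OF o(2)])
qed

context
  fixes N P :: "real \<Rightarrow> real"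
  assumes gns: "gen_number_system N P"
begin

text \<open>By uniqueness of transforms, zeta = exp becomes the identity of dN with the exponential
  series in dP, whose even and odd terms are the two parts of dM. This is the source of |dM| <=
  dN.\<close>

lemma emeasure_dN:
  assumes "X \<in> sets borel"
  shows "emeasure (interval_measure N) X = emeasure (dM_even P) X + emeasure (dM_odd P) X"
proof -
  obtain \<sigma> where \<sigma>: "\<sigma> \<ge> 0" and N: "mellin_finite \<sigma> (interval_measure N)" and P: "mellin_finite \<sigma> (interval_measure P)"
    and eq: "\<And>t. mellin \<sigma> (interval_measure N) t = exp (mellin \<sigma> (interval_measure P) t)"
    using gen_number_system_mellin[OF gns] by metis
  let ?c = "\<lambda>n::nat. 1 / fact n :: real"
  have "summable (\<lambda>n. ?c n * enn2real (\<integral>\<^sup>+x. ennreal (x powr - \<sigma>) \<partial>interval_measure P) ^ n)"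
    using summable_exp_real by simp
  note S = mult_conv_series_mellin[OF P \<sigma> _ this]
  have "interval_measure N = mult_conv_series ?c (interval_measure P)"
  proof (rule mellin_unique[OF N S(1)])
    fix t
    have "(\<lambda>n. ?c n *\<^sub>R mellin \<sigma> (interval_measure P) t ^ n) sums exp (mellin \<sigma> (interval_measure P) t)"
      using exp_converges[of "mellin \<sigma> (interval_measure P) t"] by (simp add: divide_inverse)
    then show "mellin \<sigma> (interval_measure N) t = mellin \<sigma> (mult_conv_series ?c (interval_measure P)) t"
      using S(2)[of t] by (auto simp: eq intro: sums_unique2)
  qed simp
  then have "emeasure (interval_measure N) X = (\<Sum>n. ennreal (?c n) * emeasure (mult_conv_power (interval_measure P) n) X)"
    using assms by (simp add: emeasure_mult_conv_series)
  also have "\<dots> = (\<Sum>n. ennreal (if even n then 1 / fact n else 0) * emeasure (mult_conv_power (interval_measure P) n) X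
      + ennreal (if odd n then 1 / fact n else 0) * emeasure (mult_conv_power (interval_measure P) n) X)"
    by (intro suminf_cong) auto
  also have "\<dots> = emeasure (dM_even P) X + emeasure (dM_odd P) X"
    unfolding dM_even_def dM_odd_def emeasure_mult_conv_series[OF assms] by (intro suminf_add[symmetric] summableI)
  finally show ?thesis .
qed

text \<open>Since \<open>e\<^sup>z cosh z = (e\<^sup>2\<^sup>z + 1) / 2\<close> and \<open>e\<^sup>z sinh z = (e\<^sup>2\<^sup>z - 1) / 2\<close> have non-negative Taylor
  coefficients differing only at \<open>n = 0\<close>, the identity \<open>dN * dM = \<delta>\<^sub>1\<close> can be expressed between positive measures.\<close>

lemma emeasure_mult_conv_dN_dM:
  assumes "X \<in> sets borel"
  shows "emeasure (mult_conv (interval_measure N) (dM_even P)) X =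
    emeasure (mult_conv (interval_measure N) (dM_odd P)) X + indicator X 1"
proof -
  obtain \<sigma> where \<sigma>: "\<sigma> \<ge> 0" and N: "mellin_finite \<sigma> (interval_measure N)" and P: "mellin_finite \<sigma> (interval_measure P)"
    and eq: "\<And>t. mellin \<sigma> (interval_measure N) t = exp (mellin \<sigma> (interval_measure P) t)"
    using gen_number_system_mellin[OF gns] by metis
  note M = dM_mellin[OF \<sigma> P]
  define \<delta> where "\<delta> n = (if n = 0 then 1 / 2 else 0 :: real)" for n :: nat
  \<comment> \<open>Taylor coefficients of (exp (2 z) + s) / 2, with s = 1 for exp z * cosh z and s
    = -1 for exp z * sinh z. At n = 0 they equal 1 and 0 respectively, so they stay
    non-negative.\<close>
  define c where "c s n = 2 ^ n / fact n / 2 + s * \<delta> n" for s :: real and n :: nat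
  let ?S = "\<lambda>s. mult_conv_series (c s) (interval_measure P)"
  define r where "r = enn2real (\<integral>\<^sup>+x. ennreal (x powr - \<sigma>) \<partial>interval_measure P)"
  have c0: "0 \<le> c s n" if "s \<in> {1, -1}" for s n using that by (auto simp: c_def \<delta>_def)
  have c_mult: "c s n * x ^ n = (2 * x) ^ n / fact n / 2 + s * \<delta> n" for s x n
    by (cases "n = 0") (simp_all add: c_def \<delta>_def power_mult_distrib)
  have \<delta>: "\<delta> sums (1 / 2)" unfolding \<delta>_def by (rule sums_single)
  have sm: "summable (\<lambda>n. c s n * r ^ n)" for s
    unfolding c_mult
    by (rule summable_add[OF summable_divide[OF summable_exp_real] summable_mult[OF sums_summable[OF \<delta>]]])
  note S = mult_conv_series_mellin[OF P \<sigma> c0 sm[unfolded r_def]]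
  have Sm: "mellin \<sigma> (?S s) t = (exp (2 * mellin \<sigma> (interval_measure P) t) + of_real s) / 2" if "s \<in> {1,-1}" for s t
  proof -
    define p where "p = mellin \<sigma> (interval_measure P) t"
    have "(2 *\<^sub>R p) ^ n /\<^sub>R fact n = (2 ^ n / fact n) *\<^sub>R p ^ n" for n
      unfolding scaleR_power scaleR_scaleR by (simp only: divide_inverse mult.commute)
    then have "(\<lambda>n. (2 ^ n / fact n) *\<^sub>R p ^ n) sums exp (2 *\<^sub>R p)"
      using exp_converges[of "2 *\<^sub>R p"] by (simp only:)
    from sums_scaleR_right[OF this, of "1 / 2"]
    have 1: "(\<lambda>n. (2 ^ n / fact n / 2) *\<^sub>R p ^ n) sums ((1 / 2) *\<^sub>R exp (2 *\<^sub>R p))"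
      unfolding scaleR_scaleR by (simp only: times_divide_eq_left mult_1)
    have "(s * \<delta> n) *\<^sub>R p ^ n = (if n = 0 then (s / 2) *\<^sub>R 1 else 0)" for n
      unfolding \<delta>_def by (cases "n = 0") simp_all
    then have 2: "(\<lambda>n. (s * \<delta> n) *\<^sub>R p ^ n) sums ((s / 2) *\<^sub>R 1)"
      using sums_single[of 0 "\<lambda>_. (s / 2) *\<^sub>R (1::complex)"] by (simp only:)
    have "(\<lambda>n. c s n *\<^sub>R p ^ n) sums ((1 / 2) *\<^sub>R exp (2 *\<^sub>R p) + (s / 2) *\<^sub>R 1)"
      unfolding c_def scaleR_left_distrib by (rule sums_add[OF 1 2])
    also have "(1 / 2) *\<^sub>R exp (2 *\<^sub>R p) + (s / 2) *\<^sub>R 1 = (exp (2 * p) + of_real s) / 2"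
    proof -
      have "2 *\<^sub>R p = 2 * p" by (simp add: scaleR_conv_of_real)
      then show ?thesis by (simp only:) (simp add: complex_eq_iff)
    qed
    finally have "(\<lambda>n. c s n *\<^sub>R p ^ n) sums ((exp (2 * p) + of_real s) / 2)" .
    from sums_unique2[OF S(2)[OF that, of t, folded p_def] this]
    show ?thesis unfolding p_def .
  qed
  have exp2: "exp z * cosh z = (exp (2 * z) + 1) / 2" "exp z * sinh z = (exp (2 * z) - 1) / 2" for z :: complex
  proof -
    have "exp z * exp (- z) = 1" by (simp flip: exp_add)
    then show "exp z * cosh z = (exp (2 * z) + 1) / 2" "exp z * sinh z = (exp (2 * z) - 1) / 2"
      unfolding cosh_field_def sinh_field_def exp_double power2_eq_square
      by (simp_all only: times_divide_eq_right distrib_left right_diff_distrib)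
  qed
  have e: "mult_conv (interval_measure N) (dM_even P) = ?S 1"
  proof (rule mellin_unique[OF mellin_finite_mult_conv[OF N M(1) \<sigma>] S(1)])
    show "mellin \<sigma> (mult_conv (interval_measure N) (dM_even P)) t = mellin \<sigma> (?S 1) t" for t
      by (simp add: mellin_mult_conv[OF N M(1) \<sigma>] eq M(3) Sm exp2)
  qed simp
  have o: "mult_conv (interval_measure N) (dM_odd P) = ?S (- 1)"
  proof (rule mellin_unique[OF mellin_finite_mult_conv[OF N M(2) \<sigma>] S(1)])
    show "mellin \<sigma> (mult_conv (interval_measure N) (dM_odd P)) t = mellin \<sigma> (?S (- 1)) t" for t
      by (simp add: mellin_mult_conv[OF N M(2) \<sigma>] eq M(4) Sm exp2)
  qed simp
  let ?E = "\<lambda>n. emeasure (mult_conv_power (interval_measure P) n) X"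
  \<comment> \<open>The two series differ only in the term n = 0, whose convolution power is the
    unit mass at 1.\<close>
  have "emeasure (?S 1) X = (\<Sum>n. ennreal (c (- 1) n) * ?E n + (if n = 0 then indicator X 1 else 0))"
    unfolding emeasure_mult_conv_series[OF assms]
  proof (intro suminf_cong)
    fix n
    show "ennreal (c 1 n) * ?E n = ennreal (c (- 1) n) * ?E n + (if n = 0 then indicator X 1 else 0)"
    proof (cases "n = 0")
      case True
      then show ?thesis using assms by (simp add: c_def \<delta>_def)
    qed (simp add: c_def \<delta>_def)
  qed
  also have "\<dots> = emeasure (?S (- 1)) X + (\<Sum>n. if n = 0 then indicator X (1::real) else 0)"
    unfolding emeasure_mult_conv_series[OF assms] by (intro suminf_add[symmetric] summableI)
  also have "(\<Sum>n::nat. if n = 0 then indicator X (1::real) else 0 :: ennreal) = indicator X 1"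
    using sums_single[of 0 "\<lambda>_. indicator X (1::real) :: ennreal"] by (simp add: sums_iff)
  finally show ?thesis by (simp add: e o)
qed

end

section \<open>Passage to logarithmic coordinates\<close>

text \<open>The image of u^(-1) d\<mu>(u) under y = log u. For the two parts of dM, the distribution
  functions at y differ by m(exp y).\<close>

definition log_measure :: "real measure \<Rightarrow> real measure" where
  "log_measure \<mu> = distr (density \<mu> (\<lambda>u. ennreal (1 / u))) borel ln"

lemma sets_log_measure [simp, measurable_cong]: "sets (log_measure \<mu>) = sets borel"
  by (simp add: log_measure_def)

lemma mellin_finite_AE: "mellin_finite \<sigma> \<mu> \<Longrightarrow> AE x in \<mu>. 1 \<le> x"
  by (simp add: mellin_finite_def)

lemma mellin_finite_sets: "mellin_finite \<sigma> \<mu> \<Longrightarrow> sets \<mu> = sets borel"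
  by (simp add: mellin_finite_def)

lemma integral_log_measure:
  fixes f :: "real \<Rightarrow> real"
  assumes \<mu>: "mellin_finite \<sigma> \<mu>" and [measurable]: "f \<in> borel_measurable borel"
  shows "(LINT w|log_measure \<mu>. f w) = (LINT u|\<mu>. f (ln u) / u)"
proof -
  have [measurable_cong]: "sets \<mu> = sets borel" by (rule mellin_finite_sets[OF \<mu>])
  have "AE u in \<mu>. 0 \<le> 1 / u" using mellin_finite_AE[OF \<mu>] by eventually_elim simp
  then show ?thesis unfolding log_measure_def
    by (subst integral_distr) (simp_all add: integral_density)
qed

lemma AE_log_measure:
  assumes \<mu>: "mellin_finite \<sigma> \<mu>"
  shows "AE w in log_measure \<mu>. 0 \<le> w"
proof -
  have [measurable_cong]: "sets \<mu> = sets borel" by (rule mellin_finite_sets[OF \<mu>])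
  show ?thesis
    unfolding log_measure_def
  proof (subst AE_distr_iff)
    show "AE u in density \<mu> (\<lambda>u. ennreal (1 / u)). 0 \<le> ln u"
      using mellin_finite_AE[OF \<mu>] by (subst AE_density) auto
  qed auto
qed

lemma emeasure_log_measure:
  assumes \<mu>: "mellin_finite \<sigma> \<mu>" and [measurable]: "X \<in> sets borel"
  shows "emeasure (log_measure \<mu>) X = (\<integral>\<^sup>+u. ennreal (1 / u) * indicator X (ln u) \<partial>\<mu>)"
proof -
  have [measurable_cong]: "sets \<mu> = sets borel" by (rule mellin_finite_sets[OF \<mu>])
  have "emeasure (log_measure \<mu>) X = (\<integral>\<^sup>+w. indicator X w \<partial>log_measure \<mu>)" by simp
  also have "\<dots> = (\<integral>\<^sup>+u. indicator X (ln u) \<partial>density \<mu> (\<lambda>u. ennreal (1 / u)))"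
    unfolding log_measure_def by (rule nn_integral_distr) measurable
  also have "\<dots> = (\<integral>\<^sup>+u. ennreal (1 / u) * indicator X (ln u) \<partial>\<mu>)"
    by (rule nn_integral_density) measurable
  finally show ?thesis .
qed

text \<open>Where ln u > z the density 1 / u is at most exp (-z). With z = y - 1 and N(x) = O(x)
  this bounds the mass of unit windows uniformly.\<close>

lemma emeasure_log_measure_le:
  assumes \<mu>: "mellin_finite \<sigma> \<mu>"
  shows "emeasure (log_measure \<mu>) {z<..y} \<le> ennreal (exp (- z)) * emeasure \<mu> {..exp y}"
proof -
  have [measurable_cong]: "sets \<mu> = sets borel" by (rule mellin_finite_sets[OF \<mu>])
  have "emeasure (log_measure \<mu>) {z<..y} = (\<integral>\<^sup>+u. ennreal (1 / u) * indicator {z<..y} (ln u) \<partial>\<mu>)"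
    using \<mu> by (rule emeasure_log_measure) simp
  also have "\<dots> \<le> (\<integral>\<^sup>+u. ennreal (exp (- z)) * indicator {..exp y} u \<partial>\<mu>)"
  proof (rule nn_integral_mono_AE)
    show "AE u in \<mu>. ennreal (1 / u) * indicator {z<..y} (ln u) \<le> ennreal (exp (- z)) * indicator {..exp y} u"
      using mellin_finite_AE[OF \<mu>]
    proof eventually_elim
      case (elim u)
      show ?case
      proof (cases "ln u \<in> {z<..y}")
        case True
        then have "exp z \<le> u" "u \<le> exp y" using elim by (simp_all add: ln_ge_iff ln_le_cancel_iff[symmetric] less_imp_le del: ln_le_cancel_iff)
        moreover from this have "1 / u \<le> exp (- z)" using elim by (simp add: exp_minus divide_simps)
        ultimately show ?thesis using True by (simp add: ennreal_leI)
      qed simp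
    qed
  qed
  also have "\<dots> = ennreal (exp (- z)) * emeasure \<mu> {..exp y}" by (simp add: nn_integral_cmult_indicator)
  finally show ?thesis .
qed

lemma emeasure_log_measure_atMost:
  assumes \<mu>: "mellin_finite \<sigma> \<mu>" and \<sigma>: "\<sigma> \<ge> 0"
  shows "emeasure (log_measure \<mu>) {..y} < \<infinity>"
proof -
  \<comment> \<open>The half-open interval starts below 0 in order to keep a possible atom at 0, the
    image of one at 1.\<close>
  have "emeasure (log_measure \<mu>) {..y} = emeasure (log_measure \<mu>) {-1<..y}"
    using AE_log_measure[OF \<mu>] by (intro emeasure_eq_AE) auto
  also have "\<dots> \<le> ennreal (exp (- (- 1))) * emeasure \<mu> {..exp y}" by (rule emeasure_log_measure_le[OF \<mu>])
  also have "\<dots> < \<infinity>" using mellin_finite_emeasure_atMost[OF \<mu> \<sigma>] by (simp add: ennreal_mult_less_top)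
  finally show ?thesis .
qed

lemma sigma_finite_log_measure:
  assumes \<mu>: "mellin_finite \<sigma> \<mu>" and \<sigma>: "\<sigma> \<ge> 0"
  shows "sigma_finite_measure (log_measure \<mu>)"
proof
  show "\<exists>A. countable A \<and> A \<subseteq> sets (log_measure \<mu>) \<and> \<Union>A = space (log_measure \<mu>) \<and> (\<forall>a\<in>A. emeasure (log_measure \<mu>) a \<noteq> \<infinity>)"
  proof (intro exI[of _ "range (\<lambda>n::nat. {..real n})"] conjI ballI)
    show "\<Union>(range (\<lambda>n::nat. {..real n})) = space (log_measure \<mu>)"
      using real_arch_simple by (auto simp: log_measure_def)
    show "emeasure (log_measure \<mu>) a \<noteq> \<infinity>" if "a \<in> range (\<lambda>n::nat. {..real n})" for a
      using that emeasure_log_measure_atMost[OF \<mu> \<sigma>] by (auto simp: less_top)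
  qed auto
qed

lemma measure_log_measure_atMost:
  assumes \<mu>: "mellin_finite \<sigma> \<mu>"
  shows "measure (log_measure \<mu>) {..y} = (LINT u:{1..exp y}|\<mu>. 1 / u)"
proof -
  have [measurable_cong]: "sets \<mu> = sets borel" by (rule mellin_finite_sets[OF \<mu>])
  have "measure (log_measure \<mu>) {..y} = (LINT w|log_measure \<mu>. indicator {..y} w)"
    by (simp add: log_measure_def)
  also have "\<dots> = (LINT u|\<mu>. indicator {..y} (ln u) / u)" by (rule integral_log_measure[OF \<mu>]) simp
  also have "\<dots> = (LINT u|\<mu>. indicator {1..exp y} u *\<^sub>R (1 / u))"
  proof (rule integral_cong_AE)
    show "AE u in \<mu>. indicator {..y} (ln u) / u = indicator {1..exp y} u *\<^sub>R (1 / u)"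
      using mellin_finite_AE[OF \<mu>]
    proof eventually_elim
      case (elim u)
      then have "ln u \<le> y \<longleftrightarrow> u \<le> exp y" by (metis exp_le_cancel_iff exp_ln less_le_trans zero_less_one)
      then show ?case using elim by (simp add: indicator_def)
    qed
  qed measurable
  finally show ?thesis by (simp add: set_lebesgue_integral_def)
qed

text \<open>A common frame for measures on [0, \<infinity>) finite on bounded sets: it serves for
  measures in logarithmic coordinates and, in the integration by parts, for those in the original
  variable.\<close>

locale half_line_measure = sigma_finite_measure \<alpha> for \<alpha> :: "real measure" +
  assumes sets_eq [simp, measurable_cong]: "sets \<alpha> = sets borel"
    and fin: "\<And>y. emeasure \<alpha> {..y} < \<infinity>"
    and AE_nonneg: "AE w in \<alpha>. 0 \<le> w"
begin

lemma space_eq [simp]: "space \<alpha> = UNIV"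
  using sets_eq_imp_space_eq[OF sets_eq] by simp

lemma emeasure_Ioc_fin: "emeasure \<alpha> {z<..y} < \<infinity>"
  using fin[of y] emeasure_mono[of "{z<..y}" "{..y}" \<alpha>] by (simp add: order.strict_trans1 subset_iff)

lemma measure_Ioc:
  assumes "z \<le> y" shows "measure \<alpha> {z<..y} = measure \<alpha> {..y} - measure \<alpha> {..z}"
proof -
  have "{..y} - {..z} = {z<..y}" by auto
  then show ?thesis
    using measure_Diff[of \<alpha> "{..y}" "{..z}"] fin[of y] assms by (simp add: less_top)
qed

lemma measure_neg: "y < 0 \<Longrightarrow> measure \<alpha> {..y} = 0"
proof -
  assume "y < 0"
  then have "measure \<alpha> {..y} = measure \<alpha> {}"
    using AE_nonneg by (intro measure_eq_AE) (auto elim!: eventually_mono)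
  then show ?thesis by simp
qed

lemma measurable_cdf [measurable]: "(\<lambda>y. measure \<alpha> {..y}) \<in> borel_measurable borel"
proof (rule borel_measurable_mono)
  show "mono (\<lambda>y. measure \<alpha> {..y})"
    using fin by (intro monoI measure_mono_fmeasurable) (auto simp: fmeasurable_def)
qed

lemma bounded_conv:
  fixes E :: "real \<Rightarrow> real"
  assumes [measurable]: "E \<in> borel_measurable borel" and B: "\<And>y. \<bar>E y\<bar> \<le> B" and E0: "\<And>y. y < 0 \<Longrightarrow> E y = 0"
  shows "integrable \<alpha> (\<lambda>w. E (y - w))"
proof -
  have i: "integrable \<alpha> (\<lambda>w. B * indicator {..y} w)"
    using fin[of y] by (intro integrable_mult_right integrable_real_indicator) auto
  have "norm (E (y - w)) \<le> norm (B * indicator {..y} w)" for w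
    using B[of "y - w"] E0[of "y - w"] by (cases "w \<le> y") auto
  then show ?thesis by (intro Bochner_Integration.integrable_bound[OF i]) auto
qed

text \<open>Both sides are the unit average of E * d\<alpha>. On the right the average has moved
  onto d\<alpha>, which becomes the mass of a unit window, so that a Stieltjes convolution turns
  into a Lebesgue one.\<close>

lemma conv_indicator:
  fixes E :: "real \<Rightarrow> real"
  assumes [measurable]: "E \<in> borel_measurable borel" and B: "\<And>y. \<bar>E y\<bar> \<le> B" and E0: "\<And>y. y < 0 \<Longrightarrow> E y = 0"
  shows "integrable lborel (\<lambda>v. indicator {0..<1} v * (LINT u|\<alpha>. E (y - v - u)))"
    and "integrable lborel (\<lambda>w. E w * (measure \<alpha> {..y - w} - measure \<alpha> {..y - w - 1}))"
    and "(LINT v|lborel. indicator {0..<1} v * (LINT u|\<alpha>. E (y - v - u))) =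
     (LINT w|lborel. E w * (measure \<alpha> {..y - w} - measure \<alpha> {..y - w - 1}))"
proof -
  interpret pair_sigma_finite \<alpha> lborel ..
  let ?\<psi> = "indicator {0..<1} :: real \<Rightarrow> real"
  have B0: "0 \<le> B" using B[of 0] by linarith
  have \<psi>: "integrable lborel ?\<psi>" "integral\<^sup>L lborel ?\<psi> = 1" by simp_all
  have i\<psi>: "integrable lborel (\<lambda>v. ?\<psi> v * E (z - v))" for z
    by (rule integrable_mult_bounded[OF \<psi>(1) _ B]) measurable
  have le: "(LINT v|lborel. \<bar>?\<psi> v * E (z - v)\<bar>) \<le> B * indicator {0..} z" for z
  proof -
    have "(LINT v|lborel. \<bar>?\<psi> v * E (z - v)\<bar>) \<le> (LINT v|lborel. (B * indicator {0..} z) * ?\<psi> v)"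
    proof (rule integral_mono)
      show "\<bar>?\<psi> v * E (z - v)\<bar> \<le> (B * indicator {0..} z) * ?\<psi> v" for v
        using B[of "z - v"] E0[of "z - v"] by (cases "v \<in> {0..<1}"; cases "0 \<le> z") auto
    qed (use i\<psi> \<psi> in \<open>auto intro: integrable_abs\<close>)
    then show ?thesis using \<psi>(2) by simp
  qed
  have int_\<alpha>: "integrable \<alpha> (\<lambda>u. B * indicator {0..} (y - u))"
  proof -
    have "indicator {0..} (y - u) = (indicator {..y} u :: real)" for u by (simp add: indicator_def)
    then show ?thesis
      using fin[of y] integrable_real_indicator[of "{..y}" \<alpha>] by (simp only:) (intro integrable_mult_right, simp)
  qed
  have F1: "integrable (\<alpha> \<Otimes>\<^sub>M lborel) (\<lambda>(u, v). ?\<psi> v * E (y - v - u))"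
  proof (rule Fubini_integrable)
    show "integrable \<alpha> (\<lambda>u. LINT v|lborel. norm (case (u, v) of (u, v) \<Rightarrow> ?\<psi> v * E (y - v - u)))"
    proof (rule Bochner_Integration.integrable_bound[OF int_\<alpha>])
      have "norm (LINT v|lborel. norm (?\<psi> v * E (y - v - u))) \<le> norm (B * indicator {0..} (y - u))" for u
        using le[of "y - u"] B0 by (simp add: algebra_simps)
      then show "AE u in \<alpha>. norm (LINT v|lborel. norm (case (u, v) of (u, v) \<Rightarrow> ?\<psi> v * E (y - v - u)))
        \<le> norm (B * indicator {0..} (y - u))" by simp
    qed measurable
    show "AE u in \<alpha>. integrable lborel (\<lambda>v. case (u, v) of (u, v) \<Rightarrow> ?\<psi> v * E (y - v - u))"
      using i\<psi>[of "y - _"] by (simp add: algebra_simps)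
  qed measurable
  have refl: "(LINT w|lborel. f (E w * ?\<psi> (z - w))) = (LINT v|lborel. f (?\<psi> v * E (z - v)))" for z and f :: "real \<Rightarrow> real"
    using lborel_integral_reflect[of "\<lambda>v. f (?\<psi> v * E (z - v))" z] by (simp add: mult.commute)
  have i\<psi>': "integrable lborel (\<lambda>w. E w * ?\<psi> (z - w))" for z
    using lborel_integrable_reflect[OF i\<psi>[of z], of z] by (simp add: mult.commute)
  have F2: "integrable (\<alpha> \<Otimes>\<^sub>M lborel) (\<lambda>(u, w). E w * ?\<psi> (y - u - w))"
  proof (rule Fubini_integrable)
    show "integrable \<alpha> (\<lambda>u. LINT w|lborel. norm (case (u, w) of (u, w) \<Rightarrow> E w * ?\<psi> (y - u - w)))"
    proof (rule Bochner_Integration.integrable_bound[OF int_\<alpha>])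
      have "norm (LINT w|lborel. norm (E w * ?\<psi> (y - u - w))) \<le> norm (B * indicator {0..} (y - u))" for u
        using le[of "y - u"] B0 refl[of norm "y - u"] by simp
      then show "AE u in \<alpha>. norm (LINT w|lborel. norm (case (u, w) of (u, w) \<Rightarrow> E w * ?\<psi> (y - u - w)))
        \<le> norm (B * indicator {0..} (y - u))" by simp
    qed measurable
    show "AE u in \<alpha>. integrable lborel (\<lambda>w. case (u, w) of (u, w) \<Rightarrow> E w * ?\<psi> (y - u - w))"
      using i\<psi>' by simp
  qed measurable
  show "integrable lborel (\<lambda>v. ?\<psi> v * (LINT u|\<alpha>. E (y - v - u)))"
    using integrable_snd[OF F1] by simp
  have G: "(LINT u|\<alpha>. E w * ?\<psi> (y - u - w)) = E w * (measure \<alpha> {..y - w} - measure \<alpha> {..y - w - 1})" for w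
  proof -
    \<comment> \<open>Reflecting the window [0, 1) gives an interval open on the left and closed on
      the right, hence an exact difference of masses of closed half-lines.\<close>
    have "(LINT u|\<alpha>. ?\<psi> (y - u - w)) = (LINT u|\<alpha>. indicator {y - w - 1<..y - w} u)"
      by (intro Bochner_Integration.integral_cong) (auto simp: indicator_def)
    then show ?thesis using measure_Ioc[of "y - w - 1" "y - w"] by simp
  qed
  show "integrable lborel (\<lambda>w. E w * (measure \<alpha> {..y - w} - measure \<alpha> {..y - w - 1}))"
    using integrable_snd[OF F2] by (simp only: G)
  have "(LINT v|lborel. ?\<psi> v * (LINT u|\<alpha>. E (y - v - u))) = (LINT v|lborel. LINT u|\<alpha>. ?\<psi> v * E (y - v - u))" by simp
  also have "\<dots> = (LINT u|\<alpha>. LINT v|lborel. ?\<psi> v * E (y - v - u))"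
    by (rule Fubini_integral[OF F1])
  also have "\<dots> = (LINT u|\<alpha>. LINT w|lborel. E w * ?\<psi> (y - u - w))"
    using refl[of "\<lambda>x. x" "y - _"] by (simp add: diff_diff_add add.commute)
  also have "\<dots> = (LINT w|lborel. LINT u|\<alpha>. E w * ?\<psi> (y - u - w))"
    by (rule Fubini_integral[OF F2, symmetric])
  finally show "(LINT v|lborel. ?\<psi> v * (LINT u|\<alpha>. E (y - v - u))) =
     (LINT w|lborel. E w * (measure \<alpha> {..y - w} - measure \<alpha> {..y - w - 1}))" by (simp only: G)
qed

end

lemma half_line_log_measure:
  assumes "mellin_finite \<sigma> \<mu>" "\<sigma> \<ge> 0"
  shows "half_line_measure (log_measure \<mu>)"
  using assms sigma_finite_log_measure emeasure_log_measure_atMost AE_log_measure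
  by (intro half_line_measure.intro half_line_measure_axioms.intro) auto

lemma emeasure_interval_measure_atMost:
  assumes "mono F" "\<And>x. continuous (at_right x) F" "\<And>x. x < 1 \<Longrightarrow> F x = 0"
  shows "emeasure (interval_measure F) {..z} = ennreal (F z)"
proof -
  \<comment> \<open>The left end lies below both z and 1, so F vanishes there and the half-open
    interval carries all the mass of \<open>{..z}\<close>.\<close>
  have "AE u in interval_measure F. u \<in> {..z} \<longleftrightarrow> u \<in> {min 0 (z - 1)<..z}"
  proof -
    have "AE u in interval_measure F. 1 \<le> u" by (rule AE_interval_measure_ge_1) (use assms in auto)
    then show ?thesis by eventually_elim auto
  qed
  then have "emeasure (interval_measure F) {..z} = emeasure (interval_measure F) {min 0 (z - 1)<..z}"
    by (intro emeasure_eq_AE) auto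
  also have "\<dots> = ennreal (F z - F (min 0 (z - 1)))"
    using assms by (intro emeasure_interval_measure_Ioc) (auto simp: monoD)
  finally show ?thesis using assms(3)[of "min 0 (z - 1)"] by simp
qed

text \<open>For v > 0, u v <= x means u <= x / v, a half-line of mass F(x / v). With F = N this
  brings dN * dM into the form where E can be inserted.\<close>

lemma integral_mult_conv_interval_measure:
  assumes F: "mono F" "\<And>x. continuous (at_right x) F" "\<And>x. x < 1 \<Longrightarrow> F x = 0"
    and \<mu>: "mellin_finite \<sigma> \<mu>" and \<sigma>: "\<sigma> \<ge> 0"
  shows "(LINT v|\<mu>. F (x / v)) = measure (mult_conv (interval_measure F) \<mu>) {..x}"
proof -
  have [measurable_cong]: "sets \<mu> = sets borel" by (rule mellin_finite_sets[OF \<mu>])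
  have [measurable]: "F \<in> borel_measurable borel" by (rule borel_measurable_mono[OF F(1)])
  have F0: "0 \<le> F x" for x using monoD[OF F(1), of "min 0 x" x] F(3)[of "min 0 x"] by simp
  interpret \<mu>: sigma_finite_measure \<mu> by (rule mellin_finite_sigma_finite[OF \<mu> \<sigma>])
  interpret F: sigma_finite_measure "interval_measure F"
    using F by (intro sigma_finite_interval_measure) (auto simp: monoD)
  interpret pair_sigma_finite "interval_measure F" \<mu> ..
  have sp: "space \<mu> = UNIV" using sets_eq_imp_space_eq[OF mellin_finite_sets[OF \<mu>]] by simp
  let ?X = "{z \<in> space (interval_measure F \<Otimes>\<^sub>M \<mu>). fst z * snd z \<le> x}"
  have [measurable]: "?X \<in> sets (interval_measure F \<Otimes>\<^sub>M \<mu>)" by measurable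
  have "emeasure (mult_conv (interval_measure F) \<mu>) {..x} = emeasure (interval_measure F \<Otimes>\<^sub>M \<mu>) ?X"
    unfolding mult_conv_def by (subst emeasure_distr) (auto intro!: arg_cong[where f="emeasure _"] simp: space_pair_measure)
  also have "\<dots> = (\<integral>\<^sup>+v. emeasure (interval_measure F) ((\<lambda>u. (u, v)) -` ?X) \<partial>\<mu>)"
    by (rule emeasure_pair_measure_alt2) measurable
  also have "\<dots> = (\<integral>\<^sup>+v. ennreal (F (x / v)) \<partial>\<mu>)"
  proof (rule nn_integral_cong_AE)
    show "AE v in \<mu>. emeasure (interval_measure F) ((\<lambda>u. (u, v)) -` ?X) = ennreal (F (x / v))"
      using mellin_finite_AE[OF \<mu>]
    proof eventually_elim
      case (elim v)
      have "(\<lambda>u. (u, v)) -` ?X = {..x / v}"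
        using elim by (auto simp: space_pair_measure sp pos_le_divide_eq)
      then show ?case by (simp add: emeasure_interval_measure_atMost[OF F])
    qed
  qed
  finally show ?thesis
    using F0 by (simp add: integral_eq_nn_integral measure_def)
qed

text \<open>Dividing by the transform at 0 makes the integral 1, and taking real parts commutes with
  convolution by the real function E. A Borel representative is chosen because the Fubini arguments
  take place in \<open>lborel\<close>.\<close>

lemma obtain_real_kernel:
  fixes E :: "real \<Rightarrow> real" and K :: "real \<Rightarrow> complex"
  assumes [measurable]: "E \<in> borel_measurable borel" and B: "\<And>x. \<bar>E x\<bar> \<le> B"
    and K: "integrable lebesgue K" and c0: "fourier K 0 \<noteq> 0" and EK: "integrable lebesgue (line_conv E K)"
  obtains k where "integrable lborel k" "integral\<^sup>L lborel k = 1"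
    "integrable lborel (\<lambda>x. LINT u|lborel. E (x - u) * k u)"
proof -
  define c where "c = fourier K 0"
  have c: "c = (CLINT u|lebesgue. K u)" "c \<noteq> 0" using c0 by (simp_all add: c_def fourier_def)
  have Kc: "integrable lebesgue (\<lambda>u. K u / c)" using K by simp
  have r: "integrable lebesgue (\<lambda>u. Re (K u / c))" by (rule integrable_Re[OF Kc])
  obtain k where [measurable]: "k \<in> borel_measurable lborel" and ae: "AE u in lborel. Re (K u / c) = k u"
    using completion_ex_borel_measurable_real[OF borel_measurable_integrable[OF r]] by blast
  have ae': "AE u in lebesgue. Re (K u / c) = k u" using ae by (rule AE_completion)
  have km: "k \<in> borel_measurable lebesgue" by (rule measurable_completion) measurable
  have "integrable lebesgue k" by (rule integrable_cong_AE_imp[OF r km]) (use ae' in auto)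
  then have k: "integrable lborel k" by (simp add: integrable_completion)
  have "integral\<^sup>L lborel k = (LINT u|lebesgue. k u)" by (simp add: integral_completion)
  also have "\<dots> = (LINT u|lebesgue. Re (K u / c))"
    using ae' r km by (intro integral_cong_AE) auto
  also have "\<dots> = Re (CLINT u|lebesgue. K u / c)" by (rule integral_Re[OF Kc])
  also have "\<dots> = 1" using c by simp
  finally have k1: "integral\<^sup>L lborel k = 1" .
  have conv: "(LINT u|lborel. E (x - u) * k u) = Re (line_conv E K x / c)" for x
  proof -
    have Em: "(\<lambda>u. E (x - u)) \<in> borel_measurable lebesgue" by (rule measurable_completion) measurable
    have i: "integrable lebesgue (\<lambda>u. complex_of_real (E (x - u)) * K u)"
    proof (rule Bochner_Integration.integrable_bound[OF integrable_mult_right[OF integrable_norm[OF K], of B]])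
      show "(\<lambda>u. complex_of_real (E (x - u)) * K u) \<in> borel_measurable lebesgue"
        using Em K by measurable
      have "norm (complex_of_real (E (x - u)) * K u) \<le> norm (B * norm (K u))" for u
        using mult_right_mono[OF B[of "x - u"] norm_ge_zero[of "K u"]] by (simp add: norm_mult)
      then show "AE u in lebesgue. norm (complex_of_real (E (x - u)) * K u) \<le> norm (B * norm (K u))" by simp
    qed
    have "(LINT u|lborel. E (x - u) * k u) = (LINT u|lebesgue. E (x - u) * k u)"
      by (simp add: integral_completion)
    also have "\<dots> = (LINT u|lebesgue. Re (complex_of_real (E (x - u)) * K u / c))"
    proof (rule integral_cong_AE)
      show "AE u in lebesgue. E (x - u) * k u = Re (complex_of_real (E (x - u)) * K u / c)"
        using ae' by eventually_elim (simp flip: times_divide_eq_right)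
      show "(\<lambda>u. E (x - u) * k u) \<in> borel_measurable lebesgue" using Em km by measurable
      show "(\<lambda>u. Re (complex_of_real (E (x - u)) * K u / c)) \<in> borel_measurable lebesgue"
        using integrable_Re[OF integrable_divide[OF i, of c]] by auto
    qed
    also have "\<dots> = Re (CLINT u|lebesgue. complex_of_real (E (x - u)) * K u / c)"
      by (rule integral_Re) (use i in simp)
    also have "\<dots> = Re (line_conv E K x / c)" by (simp add: line_conv_def)
    finally show ?thesis .
  qed
  have "integrable lebesgue (\<lambda>x. LINT u|lborel. E (x - u) * k u)"
    unfolding conv by (rule integrable_Re) (use EK in simp)
  then have "integrable lborel (\<lambda>x. LINT u|lborel. E (x - u) * k u)"
    by (subst (asm) integrable_completion) measurable
  with k k1 show ?thesis by (rule that)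
qed

section \<open>Integration by parts and slow variation\<close>

lemma integral_inverse_square:
  assumes "0 < u" "u \<le> b"
  shows "integrable lborel (\<lambda>t::real. indicator {u..b} t / t\<^sup>2)" "(LINT t|lborel. indicator {u..b} t / t\<^sup>2) = 1 / u - 1 / b"
proof -
  have "continuous_on {u..b} (\<lambda>t. 1 / t\<^sup>2)" using assms by (intro continuous_intros) auto
  from borel_integrable_atLeastAtMost'[OF this]
  show "integrable lborel (\<lambda>t::real. indicator {u..b} t / t\<^sup>2)" by (simp add: set_integrable_def)
  have "(LBINT t. (1 / t\<^sup>2) * indicator {u..b} t) = (- 1 / b) - (- 1 / u)"
  proof (rule integral_FTC_Icc_real[OF assms(2)])
    fix t assume t: "u \<le> t" "t \<le> b"
    then show "((\<lambda>t. - 1 / t) has_field_derivative 1 / t\<^sup>2) (at t)"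
      using assms by (auto intro!: derivative_eq_intros simp: power2_eq_square)
    show "isCont (\<lambda>t. 1 / t\<^sup>2) t" using t assms by (intro continuous_intros) auto
  qed
  then show "(LINT t|lborel. indicator {u..b} t / t\<^sup>2) = 1 / u - 1 / b" by simp
qed

lemma half_line_measure_mellin_finite:
  assumes "mellin_finite \<sigma> \<mu>" "\<sigma> \<ge> 0"
  shows "half_line_measure \<mu>"
proof (intro half_line_measure.intro half_line_measure_axioms.intro)
  show "AE w in \<mu>. 0 \<le> w" using mellin_finite_AE[OF assms(1)] by eventually_elim simp
qed (use assms mellin_finite_sigma_finite mellin_finite_emeasure_atMost mellin_finite_sets in auto)

text \<open>Integration by parts, from \<open>1 / u = 1 / b + \<integral>\<^sub>u\<^sup>b t\<^sup>-\<^sup>2 dt\<close> and Fubini.\<close>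

lemma log_measure_increment:
  assumes \<mu>: "mellin_finite \<sigma> \<mu>" and \<sigma>: "\<sigma> \<ge> 0" and ab: "1 \<le> a" "a \<le> b"
  shows "integrable lborel (\<lambda>t. indicator {a..b} t / t\<^sup>2 * (measure \<mu> {..t} - measure \<mu> {..a}))"
    and "measure (log_measure \<mu>) {..ln b} - measure (log_measure \<mu>) {..ln a} = (measure \<mu> {..b} - measure \<mu> {..a}) / b +
      (LINT t|lborel. indicator {a..b} t / t\<^sup>2 * (measure \<mu> {..t} - measure \<mu> {..a}))"
proof -
  interpret half_line_measure \<mu> by (rule half_line_measure_mellin_finite[OF \<mu> \<sigma>])
  interpret L: half_line_measure "log_measure \<mu>" by (rule half_line_log_measure[OF \<mu> \<sigma>])
  interpret P: pair_sigma_finite \<mu> lborel ..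
  \<comment> \<open>The density t^(-2) on the region a < u <= t <= b. Integration over t gives 1 / u
    - 1 / b, integration over u gives the mass of the interval from a to t.\<close>
  define F where "F u t = indicator {a<..b} u * (if u \<le> t then indicator {a..b} t / t\<^sup>2 else 0)" for u t :: real
  have [measurable]: "case_prod F \<in> borel_measurable (\<mu> \<Otimes>\<^sub>M lborel)" unfolding F_def by measurable
  have F1: "F u t = indicator {a<..b} u * (indicator {u..b} t / t\<^sup>2)" for u t
    by (auto simp: F_def indicator_def)
  have F2: "F u t = indicator {a..b} t / t\<^sup>2 * indicator {a<..t} u" for u t
    by (auto simp: F_def indicator_def)
  have F0: "norm (F u t) = F u t" for u t by (simp add: F_def)
  have it: "integrable lborel (F u)" "integral\<^sup>L lborel (F u) = indicator {a<..b} u * (1 / u - 1 / b)" for u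
  proof -
    have Fu: "F u = (\<lambda>t. indicator {a<..b} u * (indicator {u..b} t / t\<^sup>2))" by (simp add: F1 fun_eq_iff)
    then show "integrable lborel (F u)" using integral_inverse_square(1)[of u b] ab
      by (cases "u \<in> {a<..b}") auto
    show "integral\<^sup>L lborel (F u) = indicator {a<..b} u * (1 / u - 1 / b)" using integral_inverse_square(2)[of u b] ab
      by (cases "u \<in> {a<..b}") (auto simp: Fu)
  qed
  have iI: "integrable \<mu> (indicator {a<..b} :: real \<Rightarrow> real)"
    using emeasure_Ioc_fin by (intro integrable_real_indicator) auto
  have iu: "integrable \<mu> (\<lambda>u. indicator {a<..b} u * (1 / u))"
  proof (rule Bochner_Integration.integrable_bound[OF iI])
    show "AE u in \<mu>. norm (indicator {a<..b} u * (1 / u)) \<le> norm (indicator {a<..b} u :: real)"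
      using ab by (intro AE_I2) (auto simp: indicator_def)
  qed measurable
  have iJ: "integrable \<mu> (\<lambda>u. indicator {a<..b} u * (1 / u - 1 / b))"
    using iu iI by (simp add: right_diff_distrib)
  have int: "integrable (\<mu> \<Otimes>\<^sub>M lborel) (case_prod F)"
  proof (rule P.Fubini_integrable)
    show "integrable \<mu> (\<lambda>u. LINT t|lborel. norm (case (u, t) of (u, t) \<Rightarrow> F u t))"
      using iJ by (simp only: prod.case F0 it(2))
    show "AE u in \<mu>. integrable lborel (\<lambda>t. case (u, t) of (u, t) \<Rightarrow> F u t)"
      using it(1) by simp
  qed measurable
  have G: "(LINT u|\<mu>. F u t) = indicator {a..b} t / t\<^sup>2 * (measure \<mu> {..t} - measure \<mu> {..a})" for t
  proof (cases "t \<in> {a..b}")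
    case True
    then show ?thesis using measure_Ioc[of a t] by (simp add: F2)
  qed (simp add: F2)
  show "integrable lborel (\<lambda>t. indicator {a..b} t / t\<^sup>2 * (measure \<mu> {..t} - measure \<mu> {..a}))"
    using P.integrable_snd[OF int] by (simp only: G)
  have "measure (log_measure \<mu>) {..ln b} - measure (log_measure \<mu>) {..ln a} = measure (log_measure \<mu>) {ln a<..ln b}"
    using ab by (subst L.measure_Ioc) auto
  also have "\<dots> = (LINT w|log_measure \<mu>. indicator {ln a<..ln b} w)" by simp
  also have "\<dots> = (LINT u|\<mu>. indicator {ln a<..ln b} (ln u) / u)" by (rule integral_log_measure[OF \<mu>]) simp
  also have "\<dots> = (LINT u|\<mu>. indicator {a<..b} u * (1 / u))"
  proof (rule integral_cong_AE)
    show "AE u in \<mu>. indicator {ln a<..ln b} (ln u) / u = indicator {a<..b} u * (1 / u)"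
      using mellin_finite_AE[OF \<mu>] by eventually_elim (use ab in \<open>auto simp: indicator_def\<close>)
  qed measurable
  also have "\<dots> = (LINT u|\<mu>. indicator {a<..b} u * (1 / b) + indicator {a<..b} u * (1 / u - 1 / b))"
    by (intro Bochner_Integration.integral_cong) (auto simp: algebra_simps)
  also have "\<dots> = (LINT u|\<mu>. indicator {a<..b} u * (1 / b)) + (LINT u|\<mu>. indicator {a<..b} u * (1 / u - 1 / b))"
    by (rule Bochner_Integration.integral_add[OF integrable_mult_left[OF iI] iJ])
  also have "(LINT u|\<mu>. indicator {a<..b} u * (1 / b)) = (measure \<mu> {..b} - measure \<mu> {..a}) / b"
    using measure_Ioc[OF ab(2)] by simp
  also have "(LINT u|\<mu>. indicator {a<..b} u * (1 / u - 1 / b)) = (LINT u|\<mu>. LINT t|lborel. F u t)"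
    by (simp only: it(2))
  also have "\<dots> = (LINT t|lborel. LINT u|\<mu>. F u t)"
    by (rule P.Fubini_integral[OF int, symmetric])
  finally show "measure (log_measure \<mu>) {..ln b} - measure (log_measure \<mu>) {..ln a} = (measure \<mu> {..b} - measure \<mu> {..a}) / b +
      (LINT t|lborel. indicator {a..b} t / t\<^sup>2 * (measure \<mu> {..t} - measure \<mu> {..a}))" by (simp only: G)
qed

text \<open>On an interval [a, b] of fixed ratio b / a = exp h, integration by parts leaves (M b - M
  a) / b and an integral of (M t - M a) / t^2. Both are small if M(x) = o(x), the integral because
  its range has length at most b.\<close>

lemma log_measure_diff_slowly_varying:
  assumes A: "mellin_finite \<sigma> A" and B: "mellin_finite \<sigma> B" and \<sigma>: "\<sigma> \<ge> 0"
    and small: "(\<lambda>x. measure A {..x} - measure B {..x}) \<in> o(\<lambda>x. x)" and h: "0 \<le> h"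
  defines "m \<equiv> \<lambda>y. measure (log_measure A) {..y} - measure (log_measure B) {..y}"
  shows "((\<lambda>y. m y - m (y - h)) \<longlongrightarrow> 0) at_top"
proof (rule tendstoI)
  fix e :: real assume e: "0 < e"
  define M where "M x = measure A {..x} - measure B {..x}" for x
  define c where "c = exp h"
  have c: "1 \<le> c" using h by (simp add: c_def)
  \<comment> \<open>The boundary term will contribute \<open>2 * e'\<close> and the integral
    \<open>2 * e' * c\<^sup>2\<close>; this choice makes their sum e / 2.\<close>
  define e' where "e' = e / (4 + 4 * c\<^sup>2)"
  have c4: "0 < 4 + 4 * c\<^sup>2" by (simp add: add_pos_nonneg)
  have e': "0 < e'" "e' * (2 + 2 * c\<^sup>2) = e / 2"
    using e c4 by (auto simp: e'_def field_simps)
  from landau_o.smallD[OF small e'(1)] obtain X0 where X0: "\<And>x. X0 \<le> x \<Longrightarrow> \<bar>M x\<bar> \<le> e' * \<bar>x\<bar>"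
    unfolding M_def by (auto simp: eventually_at_top_linorder)
  define X where "X = max 1 X0"
  have X: "1 \<le> X" "\<And>x. X \<le> x \<Longrightarrow> \<bar>M x\<bar> \<le> e' * x" using X0 by (fastforce simp: X_def)+
  have "dist (m y - m (y - h)) 0 < e" if y: "ln X + h \<le> y" for y
  proof -
    define a where "a = exp (y - h)"
    define b where "b = exp y"
    have b: "b = c * a" by (simp add: a_def b_def c_def flip: exp_add)
    have "X = exp (ln X)" using X by simp
    also have "\<dots> \<le> a" unfolding a_def using y by simp
    finally have Xa: "X \<le> a" .
    have ab: "1 \<le> a" "a \<le> b" using Xa X(1) h by (simp, simp add: a_def b_def)
    let ?I = "\<lambda>t. indicator {a..b} t / t\<^sup>2 * (M t - M a)"
    note iA = log_measure_increment[OF A \<sigma> ab] and iB = log_measure_increment[OF B \<sigma> ab]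
    have I_eq: "?I = (\<lambda>t. indicator {a..b} t / t\<^sup>2 * (measure A {..t} - measure A {..a}) -
        indicator {a..b} t / t\<^sup>2 * (measure B {..t} - measure B {..a}))"
    proof
      fix t
      have "M t - M a = (measure A {..t} - measure A {..a}) - (measure B {..t} - measure B {..a})" by (simp add: M_def)
      then show "?I t = indicator {a..b} t / t\<^sup>2 * (measure A {..t} - measure A {..a}) -
          indicator {a..b} t / t\<^sup>2 * (measure B {..t} - measure B {..a})" by (simp only: right_diff_distrib)
    qed
    have iI: "integrable lborel ?I" unfolding I_eq by (rule Bochner_Integration.integrable_diff[OF iA(1) iB(1)])
    have "m y - m (y - h) = (measure A {..b} - measure A {..a}) / b - (measure B {..b} - measure B {..a}) / b +
       integral\<^sup>L lborel ?I"
      unfolding I_eq Bochner_Integration.integral_diff[OF iA(1) iB(1)]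
      using iA(2) iB(2) by (simp add: m_def a_def b_def)
    also have "(measure A {..b} - measure A {..a}) / b - (measure B {..b} - measure B {..a}) / b = (M b - M a) / b"
      by (simp add: M_def diff_divide_distrib)
    finally have eq: "m y - m (y - h) = (M b - M a) / b + integral\<^sup>L lborel ?I" .
    have M2: "\<bar>M t - M a\<bar> \<le> 2 * e' * b" if "t \<in> {a..b}" for t
    proof -
      have "\<bar>M t\<bar> \<le> e' * t" "\<bar>M a\<bar> \<le> e' * a" using X(2) Xa that by auto
      moreover have "e' * t \<le> e' * b" "e' * a \<le> e' * b" using that ab e' by (auto intro!: mult_left_mono)
      ultimately show ?thesis by linarith
    qed
    have "\<bar>M b - M a\<bar> / b \<le> 2 * e' * b / b"
      using M2[of b] ab by (intro divide_right_mono) auto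
    then have 1: "\<bar>(M b - M a) / b\<bar> \<le> 2 * e'" using ab by (simp add: abs_div)
    have "norm (integral\<^sup>L lborel ?I) \<le> (LINT t|lborel. indicator {a..b} t * (2 * e' * b / a\<^sup>2))"
    proof (rule Bochner_Integration.integral_norm_bound_integral[OF iI])
      show "norm (?I t) \<le> indicator {a..b} t * (2 * e' * b / a\<^sup>2)" for t
      proof (cases "t \<in> {a..b}")
        case True
        then have "a\<^sup>2 \<le> t\<^sup>2" using ab by (intro power_mono) auto
        then have "\<bar>M t - M a\<bar> / t\<^sup>2 \<le> 2 * e' * b / a\<^sup>2"
          using M2[OF True] ab e' by (intro frac_le) auto
        then show ?thesis using True by (simp add: abs_mult abs_div)
      qed simp
      show "integrable lborel (\<lambda>t. indicator {a..b} t * (2 * e' * b / a\<^sup>2))"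
        by (intro integrable_mult_left integrable_real_indicator) (use ab in auto)
    qed
    also have "\<dots> = (b - a) * (2 * e' * b / a\<^sup>2)" using ab by simp
    also have "\<dots> \<le> b * (2 * e' * b / a\<^sup>2)" using ab e' by (intro mult_right_mono) auto
    also have "\<dots> = 2 * e' * c\<^sup>2" using ab by (simp add: b power2_eq_square)
    finally have 2: "\<bar>integral\<^sup>L lborel ?I\<bar> \<le> 2 * e' * c\<^sup>2" by simp
    have "\<bar>m y - m (y - h)\<bar> \<le> 2 * e' + 2 * e' * c\<^sup>2" unfolding eq using abs_triangle_ineq 1 2 by linarith
    then have "\<bar>m y - m (y - h)\<bar> \<le> e' * (2 + 2 * c\<^sup>2)" by (simp add: algebra_simps)
    then show ?thesis using e e' by simp
  qed
  then show "\<forall>\<^sub>F y in at_top. dist (m y - m (y - h)) 0 < e"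
    unfolding eventually_at_top_linorder by blast
qed

text \<open>Put x = exp y / u in N(x) = a x + x E(log x) and integrate against exp (-y) d\<mu>(u):
  the two terms become the distribution function of \<open>log_measure\<close> and its convolution
  with E. For u > exp y all terms vanish.\<close>

lemma log_measure_conv_E:
  assumes N: "mono N" "\<And>x. continuous (at_right x) N" "\<And>x. x < 1 \<Longrightarrow> N x = 0"
    and NE: "\<And>x. x \<ge> 1 \<Longrightarrow> N x = a * x + x * E (ln x)"
    and [measurable]: "E \<in> borel_measurable borel" and B: "\<And>y. \<bar>E y\<bar> \<le> B" and E0: "\<And>y. y < 0 \<Longrightarrow> E y = 0"
    and \<mu>: "mellin_finite \<sigma> \<mu>" and \<sigma>: "\<sigma> \<ge> 0"
  shows "a * measure (log_measure \<mu>) {..y} + (LINT w|log_measure \<mu>. E (y - w)) =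
    exp (- y) * measure (mult_conv (interval_measure N) \<mu>) {..exp y}"
proof -
  have [measurable_cong]: "sets \<mu> = sets borel" by (rule mellin_finite_sets[OF \<mu>])
  have [measurable]: "N \<in> borel_measurable borel" by (rule borel_measurable_mono[OF N(1)])
  interpret half_line_measure "log_measure \<mu>" by (rule half_line_log_measure[OF \<mu> \<sigma>])
  have iE: "integrable (log_measure \<mu>) (\<lambda>w. E (y - w))" by (rule bounded_conv[OF _ B E0]) measurable
  have ii: "integrable (log_measure \<mu>) (indicator {..y} :: real \<Rightarrow> real)"
    using fin[of y] by (intro integrable_real_indicator) auto
  have "a * measure (log_measure \<mu>) {..y} + (LINT w|log_measure \<mu>. E (y - w)) =
      (LINT w|log_measure \<mu>. a * indicator {..y} w) + (LINT w|log_measure \<mu>. E (y - w))"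
    by simp
  also have "\<dots> = (LINT w|log_measure \<mu>. a * indicator {..y} w + E (y - w))"
    by (rule Bochner_Integration.integral_add[OF integrable_mult_right[OF ii] iE, symmetric])
  also have "\<dots> = (LINT u|\<mu>. (a * indicator {..y} (ln u) + E (y - ln u)) / u)"
    by (rule integral_log_measure[OF \<mu>]) measurable
  also have "\<dots> = (LINT u|\<mu>. exp (- y) * N (exp y / u))"
  proof (rule integral_cong_AE)
    show "AE u in \<mu>. (a * indicator {..y} (ln u) + E (y - ln u)) / u = exp (- y) * N (exp y / u)"
      using mellin_finite_AE[OF \<mu>]
    proof eventually_elim
      case (elim u)
      have iff: "ln u \<le> y \<longleftrightarrow> u \<le> exp y" using elim by (metis exp_le_cancel_iff exp_ln less_le_trans zero_less_one)
      show ?case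
      proof (cases "u \<le> exp y")
        case True
        then have "1 \<le> exp y / u" using elim by simp
        then have "N (exp y / u) = a * (exp y / u) + exp y / u * E (y - ln u)"
          using NE elim by (simp add: ln_div)
        also have "exp (- y) * \<dots> = (exp (- y) * exp y) * ((a + E (y - ln u)) / u)"
          by (simp add: add_divide_distrib distrib_left mult_ac)
        finally show ?thesis using True iff by (simp flip: exp_add)
      next
        case False
        then have "exp y / u < 1" using elim by simp
        then show ?thesis using False iff N(3) E0[of "y - ln u"] by simp
      qed
    qed
  qed measurable
  also have "\<dots> = exp (- y) * measure (mult_conv (interval_measure N) \<mu>) {..exp y}"
    using integral_mult_conv_interval_measure[OF N \<mu> \<sigma>, of "exp y"] by simp
  finally show ?thesis .
qed

text \<open>An interval of length v is covered by at most v + 1 unit windows. The argument runs on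
  the sum of the two measures, which dominates their difference and is monotone.\<close>

lemma log_measure_window_bound:
  assumes A: "half_line_measure \<alpha>" and B: "half_line_measure \<beta>"
    and C: "\<And>y. measure \<alpha> {y - 1<..y} + measure \<beta> {y - 1<..y} \<le> C" and v: "0 \<le> v"
  defines "m \<equiv> \<lambda>y. measure \<alpha> {..y} - measure \<beta> {..y}"
  shows "\<bar>m y - m (y - v)\<bar> \<le> C * (v + 1)"
proof -
  interpret A: half_line_measure \<alpha> by (rule A)
  interpret B: half_line_measure \<beta> by (rule B)
  have C0: "0 \<le> C" using C[of 0] by (smt (verit) measure_nonneg)
  define H where "H z = measure \<alpha> {..z} + measure \<beta> {..z}" for z
  have Hd: "H y - H z = measure \<alpha> {z<..y} + measure \<beta> {z<..y}" if "z \<le> y" for y z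
    using that by (simp add: H_def A.measure_Ioc B.measure_Ioc)
  have step: "H y - H (y - real n) \<le> real n * C" for n
  proof (induction n)
    case (Suc n)
    have "H (y - real n) - H (y - real n - 1) \<le> C"
      using Hd[of "y - real n - 1" "y - real n"] C[of "y - real n"] by simp
    moreover have "y - real n - 1 = y - real (Suc n)" by simp
    ultimately show ?case using Suc by (simp add: distrib_right)
  qed simp
  define n where "n = nat \<lceil>v\<rceil>"
  have n: "v \<le> real n" "real n \<le> v + 1" using v by (simp_all add: n_def)
  have "\<bar>m y - m (y - v)\<bar> \<le> measure \<alpha> {y - v<..y} + measure \<beta> {y - v<..y}"
    using v measure_nonneg[of \<alpha> "{y - v<..y}"] measure_nonneg[of \<beta> "{y - v<..y}"]
      A.measure_Ioc[of "y - v" y] B.measure_Ioc[of "y - v" y] by (simp add: m_def)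
  also have "\<dots> = H y - H (y - v)" using Hd[of "y - v" y] v by simp
  also have "\<dots> \<le> H y - H (y - real n)"
  proof -
    have "0 \<le> H (y - v) - H (y - real n)" using n by (subst Hd) simp_all
    then show ?thesis by simp
  qed
  also have "\<dots> \<le> real n * C" by (rule step)
  also have "\<dots> \<le> C * (v + 1)" using n C0 by (simp add: mult.commute mult_left_mono)
  finally show ?thesis .
qed

theorem theorem4p1:
  fixes N P E :: "real \<Rightarrow> real" and K :: "real \<Rightarrow> complex" and a :: real
  assumes "gen_number_system N P"
    and "N \<in> O(\<lambda>x. x)"
    and "a > 0"
    and "\<And>x. x \<ge> 1 \<Longrightarrow> N x = a * x + x * E (ln x)"
    and "\<And>y. y < 0 \<Longrightarrow> E y = 0"
    and "integrable lebesgue K"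
    and "fourier K 0 \<noteq> 0"
    and "integrable lebesgue (line_conv E K)"
    and "M_fun P \<in> o(\<lambda>x. x)"
  shows "m_fun P \<in> o(\<lambda>x. 1)"
proof -
  have N: "mono N" "\<And>x. continuous (at_right x) N" "\<And>x. x < 1 \<Longrightarrow> N x = 0"
    using assms(1) by (auto simp: gen_number_system_def)
  have [measurable]: "N \<in> borel_measurable borel" by (rule borel_measurable_mono[OF N(1)])
  have N0: "0 \<le> N x" for x using monoD[OF N(1), of "min 0 x" x] N(3)[of "min 0 x"] by simp
  obtain C where C: "\<And>x. 1 \<le> x \<Longrightarrow> N x \<le> C * x" and C0: "0 \<le> C"
  proof -
    from landau_o.bigE[OF assms(2)] obtain c where c: "0 < c" "\<forall>\<^sub>F x in at_top. norm (N x) \<le> c * norm x" .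
    from c(2) obtain x0 where x0: "\<And>x. x0 \<le> x \<Longrightarrow> \<bar>N x\<bar> \<le> c * \<bar>x\<bar>"
      by (auto simp: eventually_at_top_linorder)
    \<comment> \<open>The hypothesis is an eventual bound; below x0 monotonicity gives N x <= N x0,
      so the sum of both constants serves for all x >= 1.\<close>
    have "N x \<le> (c + N x0) * x" if "1 \<le> x" for x
    proof (cases "x0 \<le> x")
      case True
      then have "N x \<le> c * x" using x0[of x] that by simp
      also have "\<dots> \<le> (c + N x0) * x" using that N0 by (simp add: distrib_right)
      finally show ?thesis .
    next
      case False
      then have "N x \<le> N x0 * 1" using monoD[OF N(1)] by simp
      also have "\<dots> \<le> (c + N x0) * x" using that N0[of x0] c(1) by (intro mult_mono) auto
      finally show ?thesis .
    qed
    then show ?thesis using c(1) N0[of x0] by (intro that[of "c + N x0"]) auto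
  qed
  \<comment> \<open>E is determined by N on the whole line, which supplies its measurability and its
    bound.\<close>
  have E_eq: "E = (\<lambda>y. if y < 0 then 0 else N (exp y) / exp y - a)"
  proof
    fix y
    show "E y = (if y < 0 then 0 else N (exp y) / exp y - a)"
      using assms(4)[of "exp y"] assms(5)[of y] by (simp add: field_simps)
  qed
  have [measurable]: "E \<in> borel_measurable borel" unfolding E_eq by measurable
  have EB: "\<bar>E y\<bar> \<le> C + a" for y
  proof (cases "y < 0")
    case False
    then have "N (exp y) \<le> C * exp y" by (intro C) simp
    then have "N (exp y) / exp y \<le> C" by (simp add: pos_divide_le_eq)
    moreover have "0 \<le> N (exp y) / exp y" using N0 by simp
    ultimately show ?thesis using False assms(3) C0 unfolding E_eq by (simp add: abs_le_iff)
  qed (use C0 assms(3,5) in simp)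
  obtain k where k: "integrable lborel k" "integral\<^sup>L lborel k = 1" "integrable lborel (\<lambda>x. LINT u|lborel. E (x - u) * k u)"
    by (rule obtain_real_kernel[OF _ EB assms(6-8)]) measurable
  obtain \<phi> where \<phi>: "integrable lborel \<phi>" "integrable lborel (\<lambda>x. \<bar>x\<bar> * \<phi> x)" "integral\<^sup>L lborel \<phi> > 0"
    "integrable lborel (\<lambda>x. LINT u|lborel. E (x - u) * \<phi> u)"
    by (rule obtain_moment_kernel[OF _ EB k]) measurable
  obtain \<sigma> where \<sigma>: "\<sigma> \<ge> 0" and mN: "mellin_finite \<sigma> (interval_measure N)" and mP: "mellin_finite \<sigma> (interval_measure P)"
    using gen_number_system_mellin[OF assms(1)] by metis
  note A = dM_mellin(1)[OF \<sigma> mP] and B = dM_mellin(2)[OF \<sigma> mP]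
  define \<alpha> where "\<alpha> = log_measure (dM_even P)"
  define \<beta> where "\<beta> = log_measure (dM_odd P)"
  interpret \<alpha>: half_line_measure \<alpha> unfolding \<alpha>_def by (rule half_line_log_measure[OF A \<sigma>])
  interpret \<beta>: half_line_measure \<beta> unfolding \<beta>_def by (rule half_line_log_measure[OF B \<sigma>])
  define m where "m y = measure \<alpha> {..y} - measure \<beta> {..y}" for y
  have [measurable]: "m \<in> borel_measurable borel" unfolding m_def by measurable
  have m0: "m y = 0" if "y < 0" for y using that by (simp add: m_def \<alpha>.measure_neg \<beta>.measure_neg)
  \<comment> \<open>The factor exp 1 is exp (-(y - 1)) * exp y, the loss from estimating 1 / u by
    its value at the left end of the window.\<close>
  have win: "measure \<alpha> {y - 1<..y} + measure \<beta> {y - 1<..y} \<le> C * exp 1" for y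
  proof -
    have fA: "emeasure \<alpha> {y - 1<..y} < \<infinity>" and fB: "emeasure \<beta> {y - 1<..y} < \<infinity>"
      by (rule \<alpha>.emeasure_Ioc_fin \<beta>.emeasure_Ioc_fin)+
    have "ennreal (measure \<alpha> {y - 1<..y} + measure \<beta> {y - 1<..y}) = emeasure \<alpha> {y - 1<..y} + emeasure \<beta> {y - 1<..y}"
      using fA fB by (simp add: emeasure_eq_ennreal_measure less_top)
    also have "\<dots> \<le> ennreal (exp (- (y - 1))) * emeasure (dM_even P) {..exp y} + ennreal (exp (- (y - 1))) * emeasure (dM_odd P) {..exp y}"
      unfolding \<alpha>_def \<beta>_def by (intro add_mono emeasure_log_measure_le[OF A] emeasure_log_measure_le[OF B])
    also have "\<dots> = ennreal (exp (- (y - 1))) * emeasure (interval_measure N) {..exp y}"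
      by (simp add: emeasure_dN[OF assms(1)] distrib_left)
    also have "\<dots> = ennreal (exp (- (y - 1)) * N (exp y))"
      using emeasure_interval_measure_atMost[of N "exp y"] N N0 by (simp add: ennreal_mult)
    finally have le: "measure \<alpha> {y - 1<..y} + measure \<beta> {y - 1<..y} \<le> exp (- (y - 1)) * N (exp y)"
      using N0 by (subst (asm) ennreal_le_iff) auto
    also have "\<dots> \<le> C * exp 1"
    proof (cases "y < 0")
      case True
      then show ?thesis using N(3)[of "exp y"] C0 by simp
    next
      case False
      then have "exp (- (y - 1)) * N (exp y) \<le> exp (- (y - 1)) * (C * exp y)" by (intro mult_left_mono C) auto
      also have "\<dots> = C * exp 1" by (simp flip: exp_add add: mult.left_commute)
      finally show ?thesis .
    qed
    finally show ?thesis .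
  qed
  have meq: "\<bar>m y - m (y - v)\<bar> \<le> C * exp 1 * (v + 1)" if "0 \<le> v" for y v
    unfolding m_def by (rule log_measure_window_bound[OF \<alpha>.half_line_measure_axioms \<beta>.half_line_measure_axioms win that])
  have small: "(\<lambda>x. measure (dM_even P) {..x} - measure (dM_odd P) {..x}) \<in> o(\<lambda>x. x)"
  proof -
    have "measure \<mu> {1..x} = measure \<mu> {..x}" if "mellin_finite \<sigma> \<mu>" for \<mu> x
    proof -
      have [measurable_cong]: "sets \<mu> = sets borel" using that by (rule mellin_finite_sets)
      have "AE u in \<mu>. u \<in> {1..x} \<longleftrightarrow> u \<in> {..x}" using mellin_finite_AE[OF that] by eventually_elim auto
      then show ?thesis by (intro measure_eq_AE) auto
    qed
    from this[OF A] this[OF B] assms(9) show ?thesis by (simp add: M_fun_def[abs_def])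
  qed
  have slow: "((\<lambda>y. m y - m (y - v)) \<longlongrightarrow> 0) at_top" if "0 \<le> v" for v
    unfolding m_def \<alpha>_def \<beta>_def by (rule log_measure_diff_slowly_varying[OF A B \<sigma> small that])
  \<comment> \<open>The unit mass at 1 gives \<open>{..exp y}\<close> mass 1 exactly when y >= 0,
    hence the cut at 0.\<close>
  define \<epsilon>0 where "\<epsilon>0 y = (if y < 0 then 0 else exp (- y))" for y :: real
  have [measurable]: "\<epsilon>0 \<in> borel_measurable borel" unfolding \<epsilon>0_def by measurable
  have \<epsilon>0B: "\<bar>\<epsilon>0 y\<bar> \<le> 1" for y by (simp add: \<epsilon>0_def)
  have \<epsilon>0_lim: "(\<epsilon>0 \<longlongrightarrow> 0) at_top"
  proof -
    have "((\<lambda>y::real. exp (- y)) \<longlongrightarrow> 0) at_top"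
      by (rule filterlim_compose[OF exp_at_bot filterlim_uminus_at_bot_at_top])
    moreover have "\<forall>\<^sub>F y in at_top. exp (- y) = \<epsilon>0 y"
      using eventually_ge_at_top[of 0] by eventually_elim (simp add: \<epsilon>0_def)
    ultimately show ?thesis by (rule Lim_transform_eventually)
  qed
  \<comment> \<open>dN * dM = \<delta> at 1 in logarithmic coordinates, as the difference of the
    relations for the even and the odd part.\<close>
  have eq0: "a * m y + ((LINT w|\<alpha>. E (y - w)) - (LINT w|\<beta>. E (y - w))) = \<epsilon>0 y" for y
  proof -
    let ?cA = "mult_conv (interval_measure N) (dM_even P)" and ?cB = "mult_conv (interval_measure N) (dM_odd P)"
    have "a * m y + ((LINT w|\<alpha>. E (y - w)) - (LINT w|\<beta>. E (y - w))) =
       (a * measure \<alpha> {..y} + (LINT w|\<alpha>. E (y - w))) - (a * measure \<beta> {..y} + (LINT w|\<beta>. E (y - w)))"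
      by (simp add: m_def right_diff_distrib)
    also have "\<dots> = exp (- y) * (measure ?cA {..exp y} - measure ?cB {..exp y})"
      unfolding \<alpha>_def \<beta>_def log_measure_conv_E[OF N assms(4) _ EB assms(5) A \<sigma>, simplified]
        log_measure_conv_E[OF N assms(4) _ EB assms(5) B \<sigma>, simplified] by (simp add: right_diff_distrib)
    also have "measure ?cA {..exp y} - measure ?cB {..exp y} = indicator {..exp y} 1"
    proof -
      \<comment> \<open>Finiteness of the odd side permits subtracting it in the identity between
        positive measures.\<close>
      have "emeasure ?cB {..exp y} < \<infinity>"
        by (rule mellin_finite_emeasure_atMost[OF mellin_finite_mult_conv[OF mN B \<sigma>] \<sigma>])
      then have "emeasure ?cA {..exp y} = ennreal (measure ?cB {..exp y} + indicator {..exp y} 1)"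
        by (simp add: emeasure_mult_conv_dN_dM[OF assms(1)] emeasure_eq_ennreal_measure less_top ennreal_indicator)
      then have "measure ?cA {..exp y} = measure ?cB {..exp y} + indicator {..exp y} 1"
        by (rule measure_eq_emeasure_eq_ennreal[rotated]) simp
      then show ?thesis by simp
    qed
    finally show ?thesis by (simp add: \<epsilon>0_def indicator_def)
  qed
  let ?\<psi> = "indicator {0..<1::real} :: real \<Rightarrow> real"
  have \<psi>: "integrable lborel ?\<psi>" by simp
  note cA = \<alpha>.conv_indicator[OF _ EB assms(5)] and cB = \<beta>.conv_indicator[OF _ EB assms(5)]
  define \<epsilon> where "\<epsilon> y = (LINT v|lborel. ?\<psi> v * \<epsilon>0 (y - v))" for y
  have [measurable]: "\<epsilon> \<in> borel_measurable borel" unfolding \<epsilon>_def by measurable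
  have i\<epsilon>: "integrable lborel (\<lambda>v. ?\<psi> v * \<epsilon>0 (y - v))" for y
    by (rule integrable_mult_bounded[OF \<psi> _ \<epsilon>0B]) measurable
  have \<epsilon>B: "\<bar>\<epsilon> y\<bar> \<le> 1" for y
  proof -
    have "norm (LINT v|lborel. ?\<psi> v * \<epsilon>0 (y - v)) \<le> integral\<^sup>L lborel ?\<psi>"
      by (rule Bochner_Integration.integral_norm_bound_integral[OF i\<epsilon> \<psi>]) (use \<epsilon>0B in \<open>auto simp: indicator_def\<close>)
    then show ?thesis by (simp add: \<epsilon>_def)
  qed
  have \<epsilon>_lim: "(\<epsilon> \<longlongrightarrow> 0) at_top"
    unfolding \<epsilon>_def by (rule conv_tendsto_zero[OF \<psi> _ \<epsilon>0B \<epsilon>0_lim]) measurable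
  \<comment> \<open>The average of \<open>eq0\<close> over y - v with 0 <= v < 1; on the convolution
    term it falls on d\<alpha> and d\<beta> and leaves E untouched.\<close>
  have eq: "a * (LINT v|lborel. ?\<psi> v * m (y - v)) + (LINT w|lborel. E w * (m (y - w) - m (y - w - 1))) = \<epsilon> y" for y
  proof -
    let ?TA = "\<lambda>v. ?\<psi> v * (LINT u|\<alpha>. E (y - v - u))" and ?TB = "\<lambda>v. ?\<psi> v * (LINT u|\<beta>. E (y - v - u))"
    have iA: "integrable lborel ?TA" and iB: "integrable lborel ?TB" by (rule cA(1) cB(1); measurable)+
    have "a * (?\<psi> v * m (y - v)) = ?\<psi> v * \<epsilon>0 (y - v) - (?TA v - ?TB v)" for v
      unfolding eq0[of "y - v", symmetric] by (simp add: algebra_simps)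
    then have "a * (LINT v|lborel. ?\<psi> v * m (y - v)) = (LINT v|lborel. ?\<psi> v * \<epsilon>0 (y - v) - (?TA v - ?TB v))"
      by (simp flip: integral_mult_right_zero)
    also have "\<dots> = \<epsilon> y - (integral\<^sup>L lborel ?TA - integral\<^sup>L lborel ?TB)"
      unfolding \<epsilon>_def using i\<epsilon> iA iB by simp
    also have "integral\<^sup>L lborel ?TA - integral\<^sup>L lborel ?TB = (LINT w|lborel. E w * (m (y - w) - m (y - w - 1)))"
    proof -
      have e: "integral\<^sup>L lborel ?TA = (LINT w|lborel. E w * (measure \<alpha> {..y - w} - measure \<alpha> {..y - w - 1}))"
        "integral\<^sup>L lborel ?TB = (LINT w|lborel. E w * (measure \<beta> {..y - w} - measure \<beta> {..y - w - 1}))"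
        by (rule cA(3) cB(3); measurable)+
      have i: "integrable lborel (\<lambda>w. E w * (measure \<alpha> {..y - w} - measure \<alpha> {..y - w - 1}))"
        "integrable lborel (\<lambda>w. E w * (measure \<beta> {..y - w} - measure \<beta> {..y - w - 1}))"
        by (rule cA(2) cB(2); measurable)+
      have "E w * (measure \<alpha> {..y - w} - measure \<alpha> {..y - w - 1}) - E w * (measure \<beta> {..y - w} - measure \<beta> {..y - w - 1})
          = E w * (m (y - w) - m (y - w - 1))" for w
        by (simp add: m_def algebra_simps)
      then show ?thesis unfolding e by (simp flip: Bochner_Integration.integral_diff[OF i])
    qed
    finally show ?thesis by simp
  qed
  have "(m \<longlongrightarrow> 0) at_top"
    by (rule tendsto_zero_of_convolution_equation[OF _ _ _ m0 meq slow EB assms(5) _ eq \<epsilon>B \<epsilon>_lim \<phi>(1,2) _ \<phi>(4)])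
      (use assms(3) \<phi>(3) in auto)
  from filterlim_compose[OF this ln_at_top] have "((\<lambda>x. m (ln x)) \<longlongrightarrow> 0) at_top" .
  moreover have "\<forall>\<^sub>F x in at_top. m (ln x) = m_fun P x"
    using eventually_gt_at_top[of 0]
    by eventually_elim (simp add: m_def m_fun_def \<alpha>_def \<beta>_def measure_log_measure_atMost[OF A] measure_log_measure_atMost[OF B])
  ultimately have "(m_fun P \<longlongrightarrow> 0) at_top" by (rule Lim_transform_eventually)
  then show ?thesis by (intro smalloI_tendsto) auto
qed

end
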